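(* Let $\mathcal{A}$ be a mass problem and $(\mathcal{B}_i)_{i\ge -1}$ mass problems such that $(\mathcal{A},\mathcal{A},\dots)\ge_{\mathcal{M}_\omega}(\mathcal{B}_i)_{i\in\omega}\ge_{\mathcal{M}_\omega}(\mathcal{B}_{-1},\mathcal{B}_{-1},\dots)$ and $\mathcal{B}_i\not\ge_{\mathcal{M}}\mathcal{A}$ for all $i\ge -1$. Then the interval $[(\mathcal{B}_i)_{i\ge -1},\mathcal{A}]_{\mathcal{P}_{\mathcal{M}}}$ is a first-order hyperdoctrine.
   Context: Notation. A mass problem is a subset of $\omega^\omega$. $f\oplus g$ is given by $(f\oplus g)(2n)=f(n)$, $(f\oplus g)(2n+1)=g(n)$; $n^\frown f$ is $f$ preceded by the value $n$; $\Phi_e$ is the $e$-th partial Turing functional; $\langle a_1,\dots,a_n\rangle$ a fixed computable bijection $\omega^n\to\omega$. $\mathcal{A}\le_{\mathcal{M}}\mathcal{B}$ iff some partial Turing functional $\Phi$ has $\Phi(\mathcal{B})\subseteq\mathcal{A}$; $\mathcal{M}$ (Medvedev lattice) is the Brouwer algebra of degrees with join $\mathcal{A}\oplus\mathcal{B}=\{f\oplus g:f\in\mathcal{A},g\in\mathcal{B}\}$, meet $\mathcal{A}\otimes\mathcal{B}=0^\frown\mathcal{A}\cup1^\frown\mathcal{B}$, implication $\mathcal{A}\to\mathcal{B}=\{e^\frown f:\forall g\in\mathcal{A}\,\Phi_e(g\oplus f)\in\mathcal{B}\}$ (a Brouwer algebra: $x\oplus y\ge z$ iff $y\ge x\to z$).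 $(\mathcal{A}_i)_i\le_{\mathcal{M}_\omega}(\mathcal{B}_i)_i$ iff a single partial Turing functional $\Phi$ has $\Phi(n^\frown\mathcal{B}_n)\subseteq\mathcal{A}_n$ for all $n$; $\mathcal{M}_\omega$ is the Brouwer algebra of these degrees under componentwise operations. In a Brouwer algebra, for $x\le y$ the interval $[x,y]$ is a Brouwer algebra with the same lattice operations and implication $u\to_{[x,y]}v=(u\to v)\oplus x$. Interval $[(\mathcal{B}_i)_{i\ge-1},\mathcal{A}]_{\mathcal{P}_{\mathcal{M}}}$ (for $\mathcal{A},(\mathcal{B}_i)$ as in the claim): write $\mathcal{B}_{(y_1,\dots,y_n)}=\mathcal{B}_{y_1}\oplus\dots\oplus\mathcal{B}_{y_n}$. The base category $\mathbf{C}$ has objects $\{1,\dots,m\}^n$ ($n,m\in\omega$) and $\omega,\omega^2,\dots$; its morphisms are the computable functions $\alpha$ such that $\mathcal{B}_y\ge_{\mathcal{M}}\mathcal{B}_{\alpha(y)}$ for all $y\in\mathrm{dom}(\alpha)$, uniformly in $y$. The functor sends $\{1,\dots,m\}^n$ to the Brouwer algebra interval between $(\mathcal{B}_{a_1}\oplus\dots\oplus\mathcal{B}_{a_n})_{(a_1,\dots,a_n)\in\{1,\dots,m\}^n}$ and the constant tuple $(\mathcal{A},\dots,\mathcal{A})$ in the corresponding finite power of $\mathcal{M}$, sends $\omega^n$ to the interval $[(\mathcal{B}_{a_1}\oplus\dots\oplus\mathcal{B}_{a_n})_{\langle a_1,\dots,a_n\rangle\in\omega},(\mathcal{A},\mathcal{A},\dots)]_{\mathcal{M}_\omega}$,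 and sends a morphism $\alpha:Y\to Z$ to the map $x\mapsto\alpha^*(x)\oplus(\mathcal{B}_i)_{i\in Y}$, where $(\alpha^*((\mathcal{C}_j)_{j\in Z}))_i=\mathcal{C}_{\alpha(i)}$ (identifying $\omega^n$ with $\omega$ and finite powers with finite sets via fixed computable bijections). First-order hyperdoctrine: over a category $\mathbf{C}$ with finite powers, a contravariant functor $\mathcal{P}:\mathbf{C}^{op}\to\mathbf{Poset}$ with: (i) each $\mathcal{P}(X)$ a Brouwer algebra; (ii) each $f^*=\mathcal{P}(f)$ a Brouwer algebra homomorphism; (iii) for each diagonal $\Delta_X$ an element $=_X\in\mathcal{P}(X\times X)$ with $\Delta_X^*(A)\le0$ iff $A\le{=_X}$; (iv) for each projection $\pi:\Gamma\times X\to\Gamma$, $\pi^*$ has a right adjoint $(\exists x)_\Gamma$ and a left adjoint $(\forall x)_\Gamma$, satisfying the Beck–Chevalley condition $(\exists x)_\Gamma\circ(s\times1_X)^*=s^*\circ(\exists x)_{\Gamma'}$ and $(\forall x)_\Gamma\circ(s\times1_X)^*=s^*\circ(\forall x)_{\Gamma'}$ for all $s:\Gamma\to\Gamma'$.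
   Formalization: The Beck–Chevalley conditions are claimed only for products Γ×X and Γ'×X in which Γ and X (and Γ' and X) are finite powers of a common object; for other categorical products that happen to exist in the base category they can fail. *)

theory Defs
  imports "HOL-Algebra.Lattice" "HOL-Library.FuncSet" "HOL-Library.Nat_Bijection"
begin

section \<open>Turing functionals\<close>

text \<open>
  Kleene's partial recursive functions in their unary presentation (tuples are passed through the
  Cantor pairing \<^const>\<open>prod_encode\<close>), relativised to an oracle. Every program denotes a
  partial Turing functional, and every partial Turing functional is denoted by a program.
\<close>

datatype prog =
    Zero
  | Succ
  | Fst
  | Snd
  | Oracle
  | Pair prog prog
  | Comp prog prog
  | PrimRec prog prog
  | Search prog

primrec run :: "prog \<Rightarrow> (nat \<Rightarrow> nat) \<Rightarrow> nat \<Rightarrow> nat option" where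
  "run Zero f = (\<lambda>x. Some 0)"
| "run Succ f = (\<lambda>x. Some (Suc x))"
| "run Fst f = (\<lambda>x. Some (fst (prod_decode x)))"
| "run Snd f = (\<lambda>x. Some (snd (prod_decode x)))"
| "run Oracle f = (\<lambda>x. Some (f x))"
| "run (Pair p q) f =
     (\<lambda>x. Option.bind (run p f x)
            (\<lambda>a. Option.bind (run q f x) (\<lambda>b. Some (prod_encode (a, b)))))"
| "run (Comp p q) f = (\<lambda>x. Option.bind (run q f x) (run p f))"
| "run (PrimRec p q) f =
     (\<lambda>x. rec_nat (run p f (fst (prod_decode x)))
            (\<lambda>k r. Option.bind r
               (\<lambda>v. run q f (prod_encode (fst (prod_decode x), prod_encode (k, v)))))
            (snd (prod_decode x)))"
| "run (Search p) f =
     (\<lambda>x. if \<exists>n. run p f (prod_encode (x, n)) = Some 0 \<and>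
                  (\<forall>k<n. run p f (prod_encode (x, k)) \<noteq> None)
          then Some (LEAST n. run p f (prod_encode (x, n)) = Some 0)
          else None)"

definition turing_functional :: "prog \<Rightarrow> (nat \<Rightarrow> nat) \<Rightarrow> (nat \<Rightarrow> nat) option" where
  "turing_functional p f =
     (if \<forall>n. run p f n \<noteq> None then Some (\<lambda>n. the (run p f n)) else None)"

primrec oracle_free :: "prog \<Rightarrow> bool" where
  "oracle_free Zero \<longleftrightarrow> True"
| "oracle_free Succ \<longleftrightarrow> True"
| "oracle_free Fst \<longleftrightarrow> True"
| "oracle_free Snd \<longleftrightarrow> True"
| "oracle_free Oracle \<longleftrightarrow> False"
| "oracle_free (Pair p q) \<longleftrightarrow> oracle_free p \<and> oracle_free q"
| "oracle_free (Comp p q) \<longleftrightarrow> oracle_free p \<and> oracle_free q"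
| "oracle_free (PrimRec p q) \<longleftrightarrow> oracle_free p \<and> oracle_free q"
| "oracle_free (Search p) \<longleftrightarrow> oracle_free p"


section \<open>Mass problems\<close>

type_synonym mass_problem = "(nat \<Rightarrow> nat) set"

definition reduces :: "prog \<Rightarrow> mass_problem \<Rightarrow> mass_problem \<Rightarrow> bool" where
  "reduces p B A \<longleftrightarrow> (\<forall>f\<in>B. \<exists>g\<in>A. turing_functional p f = Some g)"

definition medvedev_le :: "mass_problem \<Rightarrow> mass_problem \<Rightarrow> bool" where
  "medvedev_le A B \<longleftrightarrow> (\<exists>p. reduces p B A)"

definition prepend :: "nat \<Rightarrow> (nat \<Rightarrow> nat) \<Rightarrow> nat \<Rightarrow> nat" where
  "prepend n f = case_nat n f"

definition fjoin :: "(nat \<Rightarrow> nat) \<Rightarrow> (nat \<Rightarrow> nat) \<Rightarrow> nat \<Rightarrow> nat" where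
  "fjoin f g = (\<lambda>k. if even k then f (k div 2) else g (k div 2))"

definition mjoin :: "mass_problem \<Rightarrow> mass_problem \<Rightarrow> mass_problem" where
  "mjoin A B = {fjoin f g |f g. f \<in> A \<and> g \<in> B}"

text \<open>
  Reducibility of families, uniformly in the index, where \<open>c\<close> codes the indices in \<open>I\<close> by
  natural numbers.
\<close>

definition uniform_le ::
    "('i \<Rightarrow> nat) \<Rightarrow> 'i set \<Rightarrow> ('i \<Rightarrow> mass_problem) \<Rightarrow> ('i \<Rightarrow> mass_problem) \<Rightarrow> bool" where
  "uniform_le c I A B \<longleftrightarrow> (\<exists>p. \<forall>i\<in>I. reduces p (prepend (c i) ` B i) (A i))"

definition medvedev_omega_le ::
    "(nat \<Rightarrow> mass_problem) \<Rightarrow> (nat \<Rightarrow> mass_problem) \<Rightarrow> bool" where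
  "medvedev_omega_le A B \<longleftrightarrow> uniform_le (\<lambda>n. n) UNIV A B"


section \<open>Brouwer algebras\<close>

text \<open>
  The join of the library is \<open>\<oplus>\<close> and its meet is \<open>\<otimes>\<close>. All operations, including the
  implication, are determined by the order; distributivity follows from the existence of
  implications.
\<close>

locale brouwer_algebra = bounded_lattice +
  assumes implication_exists:
    "\<lbrakk>x \<in> carrier L; z \<in> carrier L\<rbrakk> \<Longrightarrow>
       \<exists>w\<in>carrier L. \<forall>y\<in>carrier L. z \<sqsubseteq> x \<squnion> y \<longleftrightarrow> w \<sqsubseteq> y"

definition implication :: "'a gorder \<Rightarrow> 'a \<Rightarrow> 'a \<Rightarrow> 'a" where
  "implication L x z =
     (THE w. w \<in> carrier L \<and>
        (\<forall>y\<in>carrier L. z \<sqsubseteq>\<^bsub>L\<^esub> x \<squnion>\<^bsub>L\<^esub> y \<longleftrightarrow> w \<sqsubseteq>\<^bsub>L\<^esub> y))"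

definition brouwer_hom :: "'a gorder \<Rightarrow> 'b gorder \<Rightarrow> ('a \<Rightarrow> 'b) \<Rightarrow> bool" where
  "brouwer_hom L M h \<longleftrightarrow>
     h \<in> carrier L \<rightarrow> carrier M \<and>
     h \<bottom>\<^bsub>L\<^esub> = \<bottom>\<^bsub>M\<^esub> \<and>
     h \<top>\<^bsub>L\<^esub> = \<top>\<^bsub>M\<^esub> \<and>
     (\<forall>x\<in>carrier L. \<forall>y\<in>carrier L.
        h (x \<squnion>\<^bsub>L\<^esub> y) = h x \<squnion>\<^bsub>M\<^esub> h y \<and>
        h (x \<sqinter>\<^bsub>L\<^esub> y) = h x \<sqinter>\<^bsub>M\<^esub> h y \<and>
        h (implication L x y) = implication M (h x) (h y))"

definition is_right_adjoint :: "'a gorder \<Rightarrow> 'b gorder \<Rightarrow> ('a \<Rightarrow> 'b) \<Rightarrow> ('b \<Rightarrow> 'a) \<Rightarrow> bool" where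
  "is_right_adjoint L M h E \<longleftrightarrow>
     E \<in> carrier M \<rightarrow> carrier L \<and>
     (\<forall>a\<in>carrier L. \<forall>b\<in>carrier M. h a \<sqsubseteq>\<^bsub>M\<^esub> b \<longleftrightarrow> a \<sqsubseteq>\<^bsub>L\<^esub> E b)"

definition is_left_adjoint :: "'a gorder \<Rightarrow> 'b gorder \<Rightarrow> ('a \<Rightarrow> 'b) \<Rightarrow> ('b \<Rightarrow> 'a) \<Rightarrow> bool" where
  "is_left_adjoint L M h F \<longleftrightarrow>
     F \<in> carrier M \<rightarrow> carrier L \<and>
     (\<forall>a\<in>carrier L. \<forall>b\<in>carrier M. F b \<sqsubseteq>\<^bsub>L\<^esub> a \<longleftrightarrow> b \<sqsubseteq>\<^bsub>M\<^esub> h a)"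


section \<open>Categories and finite powers\<close>

text \<open>
  Hom-sets need not be disjoint, so composition carries its objects: \<open>Cmp C X Y Z g f\<close> is
  \<open>g \<circ> f\<close> for \<open>f : X \<rightarrow> Y\<close> and \<open>g : Y \<rightarrow> Z\<close>.
\<close>

record ('o, 'm) cat =
  Obj :: "'o set"
  Hom :: "'o \<Rightarrow> 'o \<Rightarrow> 'm set"
  Idt :: "'o \<Rightarrow> 'm"
  Cmp :: "'o \<Rightarrow> 'o \<Rightarrow> 'o \<Rightarrow> 'm \<Rightarrow> 'm \<Rightarrow> 'm"

locale category =
  fixes C :: "('o, 'm) cat"
  assumes Idt_in_Hom: "X \<in> Obj C \<Longrightarrow> Idt C X \<in> Hom C X X"
    and Cmp_in_Hom:
      "\<lbrakk>X \<in> Obj C; Y \<in> Obj C; Z \<in> Obj C; f \<in> Hom C X Y; g \<in> Hom C Y Z\<rbrakk> \<Longrightarrow>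
         Cmp C X Y Z g f \<in> Hom C X Z"
    and Cmp_Idt_left:
      "\<lbrakk>X \<in> Obj C; Y \<in> Obj C; f \<in> Hom C X Y\<rbrakk> \<Longrightarrow> Cmp C X Y Y (Idt C Y) f = f"
    and Cmp_Idt_right:
      "\<lbrakk>X \<in> Obj C; Y \<in> Obj C; f \<in> Hom C X Y\<rbrakk> \<Longrightarrow> Cmp C X X Y f (Idt C X) = f"
    and Cmp_assoc:
      "\<lbrakk>W \<in> Obj C; X \<in> Obj C; Y \<in> Obj C; Z \<in> Obj C;
        f \<in> Hom C W X; g \<in> Hom C X Y; h \<in> Hom C Y Z\<rbrakk> \<Longrightarrow>
         Cmp C W Y Z h (Cmp C W X Y g f) = Cmp C W X Z (Cmp C X Y Z h g) f"

definition is_power ::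
    "('o, 'm) cat \<Rightarrow> 'o \<Rightarrow> nat \<Rightarrow> 'o \<Rightarrow> (nat \<Rightarrow> 'm) \<Rightarrow> bool" where
  "is_power C X n Q pr \<longleftrightarrow>
     X \<in> Obj C \<and> Q \<in> Obj C \<and> (\<forall>i<n. pr i \<in> Hom C Q X) \<and>
     (\<forall>T\<in>Obj C. \<forall>t. (\<forall>i<n. t i \<in> Hom C T X) \<longrightarrow>
        (\<exists>!u. u \<in> Hom C T Q \<and> (\<forall>i<n. Cmp C T Q X (pr i) u = t i)))"

definition is_product ::
    "('o, 'm) cat \<Rightarrow> 'o \<Rightarrow> 'o \<Rightarrow> 'o \<Rightarrow> 'm \<Rightarrow> 'm \<Rightarrow> bool" where
  "is_product C \<Gamma> X Q p q \<longleftrightarrow>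
     \<Gamma> \<in> Obj C \<and> X \<in> Obj C \<and> Q \<in> Obj C \<and> p \<in> Hom C Q \<Gamma> \<and> q \<in> Hom C Q X \<and>
     (\<forall>T\<in>Obj C. \<forall>f\<in>Hom C T \<Gamma>. \<forall>g\<in>Hom C T X.
        \<exists>!u. u \<in> Hom C T Q \<and> Cmp C T Q \<Gamma> p u = f \<and> Cmp C T Q X q u = g)"

definition powers_of_common_object :: "('o, 'm) cat \<Rightarrow> 'o \<Rightarrow> 'o \<Rightarrow> bool" where
  "powers_of_common_object C \<Gamma> X \<longleftrightarrow>
     (\<exists>Z m n pr pr'. is_power C Z m \<Gamma> pr \<and> is_power C Z n X pr')"


section \<open>First-order hyperdoctrines\<close>

text \<open>
  \<open>P\<close> is the functor on objects, and \<open>pull X Y f\<close> is \<open>f\<^sup>*\<close> from \<open>P Y\<close> to \<open>P X\<close> for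
  \<open>f : X \<rightarrow> Y\<close>. Adjoints between posets are unique, so the Beck--Chevalley conditions can be
  stated for arbitrary adjoints; \<open>u\<close> is the morphism \<open>s \<times> 1\<^sub>X\<close>.

  Since the base category is only required to have finite powers, the products
  \<open>\<Gamma> \<times> X\<close> and \<open>\<Gamma>' \<times> X\<close> in the Beck--Chevalley conditions are those which finite powers
  provide, namely \<open>Z\<^sup>m \<times> Z\<^sup>n\<close>. Other product cones may exist by accident, and for them these
  conditions can fail. For example, suppose that below the \<open>B\<^sub>i\<close> with \<open>i \<ge> 0\<close> are singletons of Turing
  independent functions, that \<open>B\<^sub>-\<^sub>1\<close> has the least degree, and that \<open>A\<close> is not reducible to
  \<open>B\<^sub>1 \<oplus> B\<^sub>3\<close>. The objects mapping to \<open>{1,2}\<close> are then the empty set and the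
  \<open>{1}\<^sup>n\<close> and \<open>{1,2}\<^sup>n\<close> for \<open>n \<ge> 1\<close>; their morphisms to \<open>{1,2,3}\<close> take values in \<open>{1,2}\<close>. Hence
  \<open>{1,2}\<^sup>2\<close> is a categorical product of \<open>{1,2}\<close> and \<open>{1,2,3}\<close>, and quantification over it does
  not commute with substitution along the inclusion of \<open>{1,2}\<close> in \<open>{1,2,3}\<close>. The adjoints
  themselves are required for all product cones.
\<close>

locale first_order_hyperdoctrine = category C
  for C :: "('o, 'm) cat" +
  fixes P :: "'o \<Rightarrow> 'p gorder"
    and pull :: "'o \<Rightarrow> 'o \<Rightarrow> 'm \<Rightarrow> 'p \<Rightarrow> 'p"
  assumes finite_powers: "X \<in> Obj C \<Longrightarrow> \<exists>Q pr. is_power C X n Q pr"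
    and fibre_brouwer: "X \<in> Obj C \<Longrightarrow> brouwer_algebra (P X)"
    and pull_hom:
      "\<lbrakk>X \<in> Obj C; Y \<in> Obj C; f \<in> Hom C X Y\<rbrakk> \<Longrightarrow> brouwer_hom (P Y) (P X) (pull X Y f)"
    and pull_Idt:
      "\<lbrakk>X \<in> Obj C; a \<in> carrier (P X)\<rbrakk> \<Longrightarrow> pull X X (Idt C X) a = a"
    and pull_Cmp:
      "\<lbrakk>X \<in> Obj C; Y \<in> Obj C; Z \<in> Obj C; f \<in> Hom C X Y; g \<in> Hom C Y Z; a \<in> carrier (P Z)\<rbrakk> \<Longrightarrow>
         pull X Z (Cmp C X Y Z g f) a = pull X Y f (pull Y Z g a)"
    and equality:
      "\<lbrakk>is_product C X X Q p q; \<Delta> \<in> Hom C X Q;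
        Cmp C X Q X p \<Delta> = Idt C X; Cmp C X Q X q \<Delta> = Idt C X\<rbrakk> \<Longrightarrow>
         \<exists>e\<in>carrier (P Q). \<forall>a\<in>carrier (P Q).
           pull X Q \<Delta> a \<sqsubseteq>\<^bsub>P X\<^esub> \<bottom>\<^bsub>P X\<^esub> \<longleftrightarrow> a \<sqsubseteq>\<^bsub>P Q\<^esub> e"
    and exists_adjoint:
      "is_product C \<Gamma> X Q p q \<Longrightarrow> \<exists>E. is_right_adjoint (P \<Gamma>) (P Q) (pull Q \<Gamma> p) E"
    and forall_adjoint:
      "is_product C \<Gamma> X Q p q \<Longrightarrow> \<exists>F. is_left_adjoint (P \<Gamma>) (P Q) (pull Q \<Gamma> p) F"
    and exists_beck_chevalley:
      "\<lbrakk>powers_of_common_object C \<Gamma> X; is_product C \<Gamma> X Q p q;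
        powers_of_common_object C \<Gamma>' X; is_product C \<Gamma>' X Q' p' q';
        s \<in> Hom C \<Gamma> \<Gamma>'; u \<in> Hom C Q Q';
        Cmp C Q Q' \<Gamma>' p' u = Cmp C Q \<Gamma> \<Gamma>' s p; Cmp C Q Q' X q' u = q;
        is_right_adjoint (P \<Gamma>) (P Q) (pull Q \<Gamma> p) E;
        is_right_adjoint (P \<Gamma>') (P Q') (pull Q' \<Gamma>' p') E';
        a \<in> carrier (P Q')\<rbrakk> \<Longrightarrow>
         E (pull Q Q' u a) = pull \<Gamma> \<Gamma>' s (E' a)"
    and forall_beck_chevalley:
      "\<lbrakk>powers_of_common_object C \<Gamma> X; is_product C \<Gamma> X Q p q;
        powers_of_common_object C \<Gamma>' X; is_product C \<Gamma>' X Q' p' q';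
        s \<in> Hom C \<Gamma> \<Gamma>'; u \<in> Hom C Q Q';
        Cmp C Q Q' \<Gamma>' p' u = Cmp C Q \<Gamma> \<Gamma>' s p; Cmp C Q Q' X q' u = q;
        is_left_adjoint (P \<Gamma>) (P Q) (pull Q \<Gamma> p) F;
        is_left_adjoint (P \<Gamma>') (P Q') (pull Q' \<Gamma>' p') F';
        a \<in> carrier (P Q')\<rbrakk> \<Longrightarrow>
         F (pull Q Q' u a) = pull \<Gamma> \<Gamma>' s (F' a)"


section \<open>The interval hyperdoctrine\<close>

definition tuples :: "nat set \<Rightarrow> nat \<Rightarrow> nat list set" where
  "tuples S n = {ys. length ys = n \<and> set ys \<subseteq> S}"

text \<open>
  On tuples of a fixed length \<open>n \<ge> 1\<close> this is a bijection onto the natural numbers.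
\<close>

fun tuple_code :: "nat list \<Rightarrow> nat" where
  "tuple_code [] = 0"
| "tuple_code [a] = a"
| "tuple_code (a # b # ys) = prod_encode (a, tuple_code (b # ys))"

text \<open>
  \<open>B\<^sub>(\<^sub>y\<^sub>1\<^sub>,\<^sub>.\<^sub>.\<^sub>.\<^sub>,\<^sub>y\<^sub>n\<^sub>)\<close>. The mass problem \<open>B\<^sub>-\<^sub>1\<close> belongs to the empty tuple, that is, to the
  terminal object.
\<close>

fun tuple_bound :: "(int \<Rightarrow> mass_problem) \<Rightarrow> nat list \<Rightarrow> mass_problem" where
  "tuple_bound B [] = B (- 1)"
| "tuple_bound B [a] = B (int a)"
| "tuple_bound B (a # b # ys) = mjoin (B (int a)) (tuple_bound B (b # ys))"

definition base_objects :: "nat list set set" where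
  "base_objects = {tuples {1..m} n |m n. True} \<union> {tuples UNIV n |n. 1 \<le> n}"

definition computable_tuple_map :: "nat list set \<Rightarrow> (nat list \<Rightarrow> nat list) \<Rightarrow> bool" where
  "computable_tuple_map Y \<alpha> \<longleftrightarrow>
     (\<exists>p. oracle_free p \<and>
        (\<forall>y\<in>Y. \<forall>f. run p f (tuple_code y) = Some (tuple_code (\<alpha> y))))"

definition base_category ::
    "(int \<Rightarrow> mass_problem) \<Rightarrow> (nat list set, nat list \<Rightarrow> nat list) cat" where
  "base_category B =
     \<lparr>Obj = base_objects,
      Hom = (\<lambda>Y Z. {\<alpha> \<in> Y \<rightarrow>\<^sub>E Z. computable_tuple_map Y \<alpha> \<and>
               uniform_le tuple_code Y (\<lambda>y. tuple_bound B (\<alpha> y)) (tuple_bound B)}),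
      Idt = (\<lambda>Y. restrict id Y),
      Cmp = (\<lambda>X Y Z \<beta> \<alpha>. compose X \<beta> \<alpha>)\<rparr>"

text \<open>
  Among the objects, the finite ones are exactly the \<open>{1,\<dots>,m}\<^sup>n\<close>; over them the order is that of
  a finite power of the Medvedev lattice. Over \<open>\<omega>\<^sup>n\<close> it is that of \<open>M\<^sub>\<omega>\<close>, transported along
  \<^const>\<open>tuple_code\<close>.
\<close>

definition family_le ::
    "nat list set \<Rightarrow> (nat list \<Rightarrow> mass_problem) \<Rightarrow> (nat list \<Rightarrow> mass_problem) \<Rightarrow> bool" where
  "family_le Y C D \<longleftrightarrow>
     (if finite Y then \<forall>y\<in>Y. medvedev_le (C y) (D y)
      else medvedev_omega_le (\<lambda>k. C (the_inv_into Y tuple_code k))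
                             (\<lambda>k. D (the_inv_into Y tuple_code k)))"

text \<open>
  Families are total functions whose values outside \<open>Y\<close> are ignored by \<^const>\<open>family_le\<close>.
\<close>

definition family_degree ::
    "nat list set \<Rightarrow> (nat list \<Rightarrow> mass_problem) \<Rightarrow> (nat list \<Rightarrow> mass_problem) set" where
  "family_degree Y C = {D. family_le Y C D \<and> family_le Y D C}"

definition interval_fibre ::
    "(int \<Rightarrow> mass_problem) \<Rightarrow> mass_problem \<Rightarrow> nat list set \<Rightarrow>
       (nat list \<Rightarrow> mass_problem) set gorder" where
  "interval_fibre B A Y =
     \<lparr>carrier = {family_degree Y C |C.
                   family_le Y (tuple_bound B) C \<and> family_le Y C (\<lambda>_. A)},
      eq = (=),
      le = (\<lambda>S T. \<exists>C\<in>S. \<exists>D\<in>T. family_le Y C D)\<rparr>"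

definition interval_pull ::
    "(int \<Rightarrow> mass_problem) \<Rightarrow> nat list set \<Rightarrow> nat list set \<Rightarrow> (nat list \<Rightarrow> nat list) \<Rightarrow>
       (nat list \<Rightarrow> mass_problem) set \<Rightarrow> (nat list \<Rightarrow> mass_problem) set" where
  "interval_pull B Y Z \<alpha> S =
     (\<Union>C\<in>S. family_degree Y (\<lambda>y. mjoin (C (\<alpha> y)) (tuple_bound B y)))"

end

theory Submission imports Defs begin

text \<open>
  All notions are reduced to uniform computations: one program which, for all parameters, computes
  from an oracle depending on the parameter a solution of a mass problem depending on it.

  Implications and universal quantifications need functionals as data. Instead of indices of
  programs, which would require a universal machine, the associates of Kleene's second algebra are
  used: the value at \<open>x\<close> of the functional coded by \<open>h\<close> at the argument \<open>g\<close> is found by evaluating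
  \<open>h\<close> on \<open>x\<close> and longer and longer prefixes of \<open>g\<close>. Every program is turned into an associate by
  recursion on its syntax.

  Substitution along any morphism \<open>\<alpha>\<close> has both adjoints. The right adjoint at \<open>z\<close> consists of the
  solutions over the points of the \<open>\<alpha>\<close>-fibre of \<open>z\<close>, tagged by these points, together with \<open>A\<close>,
  which accounts for fibres without a computable point. The left adjoint consists of the associates
  that map the bound of any point of that fibre to a solution over it, joined with the bound of \<open>z\<close>.
  Equality is the image of the least element under the right adjoint of substitution along the
  diagonal. The Beck--Chevalley conditions hold because a product of two powers of a common object
  is isomorphic to a concrete power, so that the square in question is a computable pullback whose
  points have bounds computable from the bounds of their images.
\<close>

section \<open>Relative computability\<close>

text \<open>A parameter may be any object, for instance an index together with a solution over it; a
  program sees of it only the oracle and the input attached to it. A predicate on parameters with an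
  oracle for each of them thus acts as a context and reducibility as entailment:
  \<open>uniform_leI\<close> proves a reduction in an arbitrary context,
  \<open>solvable_from_reduce\<close> uses it in any other. The fibres carry two orders, pointwise
  over finite objects and uniform over infinite ones; \<open>family_le_iff\<close> identifies both
  with one uniform order. Any problem with the right adjunction may represent an implication or a
  quantifier, since the order determines its degree; this admits associates where indices are
  customary. The Beck--Chevalley conditions meet an obstacle: a product cone speaks of morphisms,
  whereas the adjoints are made from single points and solutions of their bounds. Each pair of
  points has to come from a point of the product whose code and bound are computable from the pair;
  an accidental product may lack such a point.\<close>

definition computable_at ::
    "('a \<Rightarrow> bool) \<Rightarrow> ('a \<Rightarrow> nat \<Rightarrow> nat) \<Rightarrow> ('a \<Rightarrow> nat) \<Rightarrow> ('a \<Rightarrow> nat) \<Rightarrow> bool" where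
  "computable_at P r i t \<longleftrightarrow> (\<exists>p. \<forall>a. P a \<longrightarrow> run p (r a) (i a) = Some (t a))"

lemma computable_atI: "(\<And>a. P a \<Longrightarrow> run p (r a) (i a) = Some (t a)) \<Longrightarrow> computable_at P r i t"
  unfolding computable_at_def by blast

text \<open>The program never sees the parameter itself, so parameters can be renamed along any
  \<open>\<phi>\<close>, computable or not, as long as oracle, input and value agree.\<close>

lemma computable_at_reparam:
  assumes "computable_at P r i t" "\<And>b. Q b \<Longrightarrow> P (\<phi> b)"
    "\<And>b. Q b \<Longrightarrow> r' b = r (\<phi> b)" "\<And>b. Q b \<Longrightarrow> i' b = i (\<phi> b)" "\<And>b. Q b \<Longrightarrow> t' b = t (\<phi> b)"
  shows "computable_at Q r' i' t'"
proof -
  obtain p where "\<And>a. P a \<Longrightarrow> run p (r a) (i a) = Some (t a)"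
    using assms(1) unfolding computable_at_def by blast
  then show ?thesis by (intro computable_atI[of _ p]) (simp add: assms(2-))
qed

lemma computable_at_mono:
  assumes "computable_at P r i t" "\<And>b. Q b \<Longrightarrow> P b"
  shows "computable_at Q r i t"
  using assms(1) by (rule computable_at_reparam) (simp_all add: assms(2))

lemma computable_at_cong:
  assumes "computable_at P r i t" "\<And>b. P b \<Longrightarrow> t' b = t b"
  shows "computable_at P r i t'"
  using assms(1) by (rule computable_at_reparam) (simp_all add: assms(2))

lemma computable_at_input: "computable_at P r i i"
  \<comment> \<open>Decoding a number as a pair and encoding it again is the identity, which has no
    constructor of its own.\<close>
  by (rule computable_atI[of _ "Pair Fst Snd"]) simp

lemma computable_at_trans:
  assumes "computable_at P r i t" "computable_at P r t s"
  shows "computable_at P r i s"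
proof -
  obtain p q where "\<And>a. P a \<Longrightarrow> run p (r a) (i a) = Some (t a)"
    "\<And>a. P a \<Longrightarrow> run q (r a) (t a) = Some (s a)"
    using assms unfolding computable_at_def by blast
  then show ?thesis by (intro computable_atI[of _ "Comp q p"]) simp
qed

lemma computable_at_Suc [intro]:
  "computable_at P r i t \<Longrightarrow> computable_at P r i (\<lambda>a. Suc (t a))"
  by (erule computable_at_trans, rule computable_atI[of _ Succ]) simp

lemma computable_at_const [intro]: "computable_at P r i (\<lambda>_. n)"
proof (induction n)
  case 0
  show ?case by (rule computable_atI[of _ Zero]) simp
next
  case (Suc n)
  then show ?case by (rule computable_at_Suc)
qed

lemma computable_at_fst [intro]:
  "computable_at P r i t \<Longrightarrow> computable_at P r i (\<lambda>a. fst (prod_decode (t a)))"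
  by (erule computable_at_trans, rule computable_atI[of _ Fst]) simp

lemma computable_at_snd [intro]:
  "computable_at P r i t \<Longrightarrow> computable_at P r i (\<lambda>a. snd (prod_decode (t a)))"
  by (erule computable_at_trans, rule computable_atI[of _ Snd]) simp

lemma computable_at_oracle:
  "computable_at P r i t \<Longrightarrow> computable_at P r i (\<lambda>a. r a (t a))"
  by (erule computable_at_trans, rule computable_atI[of _ Oracle]) simp

lemma computable_at_pair [intro]:
  assumes "computable_at P r i t" "computable_at P r i s"
  shows "computable_at P r i (\<lambda>a. prod_encode (t a, s a))"
proof -
  obtain p q where "\<And>a. P a \<Longrightarrow> run p (r a) (i a) = Some (t a)"
    "\<And>a. P a \<Longrightarrow> run q (r a) (i a) = Some (s a)"
    using assms unfolding computable_at_def by blast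
  then show ?thesis by (intro computable_atI[of _ "Pair p q"]) simp
qed

text \<open>The step is a computation with the extended parameter \<open>(a, k, v)\<close>, where
  counter and previous value enter through the input. It has to converge for all \<open>k\<close>
  and \<open>v\<close>, which keeps partiality out of the recursion.\<close>

lemma computable_at_rec:
  assumes n: "computable_at P r i n" and b: "computable_at P r i b"
    and s: "computable_at (\<lambda>x. P (fst x)) (\<lambda>x. r (fst x))
      (\<lambda>x. prod_encode (i (fst x), prod_encode (fst (snd x), snd (snd x))))
      (\<lambda>x. s (fst x) (fst (snd x)) (snd (snd x)))"
  shows "computable_at P r i (\<lambda>a. rec_nat (b a) (s a) (n a))"
proof -
  obtain pn pb ps where p: "\<And>a. P a \<Longrightarrow> run pn (r a) (i a) = Some (n a)"
    "\<And>a. P a \<Longrightarrow> run pb (r a) (i a) = Some (b a)"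
    "\<And>x. P (fst x) \<Longrightarrow> run ps (r (fst x))
      (prod_encode (i (fst x), prod_encode (fst (snd x), snd (snd x)))) =
        Some (s (fst x) (fst (snd x)) (snd (snd x)))"
    using assms unfolding computable_at_def by blast
  have ps: "P a \<Longrightarrow> run ps (r a) (prod_encode (i a, prod_encode (k, v))) = Some (s a k v)" for a k v
    using p(3)[of "(a, k, v)"] by simp
  show ?thesis
  \<comment> \<open>\<open>PrimRec\<close> expects a pair of a parameter and a count;
    \<open>Pair Fst Snd\<close> passes the original input on as that parameter.\<close>
  proof (rule computable_atI[of _ "Comp (PrimRec pb ps) (Pair (Pair Fst Snd) pn)"])
    fix a assume a: "P a"
    have "rec_nat (Some (b a)) (\<lambda>k r'. Option.bind r'
               (\<lambda>v. run ps (r a) (prod_encode (i a, prod_encode (k, v))))) m =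
          Some (rec_nat (b a) (s a) m)" for m
      by (induction m) (simp_all add: ps[OF a])
    then show "run (Comp (PrimRec pb ps) (Pair (Pair Fst Snd) pn)) (r a) (i a) =
        Some (rec_nat (b a) (s a) (n a))"
      by (simp add: p a)
  qed
qed

text \<open>Every trial converges because \<open>s\<close> is total, so the side condition of
  \<open>Search\<close> holds at the first zero.\<close>

lemma computable_at_search:
  assumes s: "computable_at (\<lambda>x. P (fst x)) (\<lambda>x. r (fst x))
      (\<lambda>x. prod_encode (i (fst x), snd x)) (\<lambda>x. s (fst x) (snd x))"
    and ex: "\<And>a. P a \<Longrightarrow> \<exists>k. s a k = 0"
  shows "computable_at P r i (\<lambda>a. LEAST k. s a k = 0)"
proof -
  obtain p where p: "\<And>x. P (fst x) \<Longrightarrow> run p (r (fst x)) (prod_encode (i (fst x), snd x)) =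
        Some (s (fst x) (snd x))"
    using assms unfolding computable_at_def by blast
  have p: "P a \<Longrightarrow> run p (r a) (prod_encode (i a, k)) = Some (s a k)" for a k
    using p[of "(a, k)"] by simp
  show ?thesis
    by (rule computable_atI[of _ "Search p"]) (simp add: p ex)
qed

lemma computable_at_add [intro]:
  assumes "computable_at P r i t" "computable_at P r i s"
  shows "computable_at P r i (\<lambda>a. t a + s a)"
proof -
  have "computable_at P r i (\<lambda>a. rec_nat (t a) (\<lambda>_ v. Suc v) (s a))"
    by (intro computable_at_rec assms computable_atI[of _ "Comp Succ (Comp Snd Snd)"]) simp
  moreover have "rec_nat m (\<lambda>_ v. Suc v) n = m + n" for m n
    by (induction n) auto
  ultimately show ?thesis by simp
qed

lemma computable_at_pred [intro]:
  assumes "computable_at P r i t"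
  shows "computable_at P r i (\<lambda>a. t a - 1)"
proof -
  have "computable_at P r i (\<lambda>a. rec_nat 0 (\<lambda>k _. k) (t a))"
    by (intro computable_at_rec assms computable_atI[of _ "Comp Fst Snd"] computable_at_const) simp
  moreover have "rec_nat 0 (\<lambda>k _. k) n = n - 1" for n :: nat
    by (cases n) auto
  ultimately show ?thesis by simp
qed

lemma computable_at_diff [intro]:
  assumes "computable_at P r i t" "computable_at P r i s"
  shows "computable_at P r i (\<lambda>a. t a - s a)"
proof -
  have "computable_at P r i (\<lambda>a. rec_nat (t a) (\<lambda>_ v. v - 1) (s a))"
    by (intro computable_at_rec assms computable_at_pred computable_atI[of _ "Comp Snd Snd"]) simp
  moreover have "rec_nat m (\<lambda>_ v. v - 1) n = m - n" for m n :: nat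
    by (induction n) auto
  ultimately show ?thesis by simp
qed

lemma computable_at_if_zero:
  assumes n: "computable_at P r i n"
    and t: "computable_at (\<lambda>a. P a \<and> n a = 0) r i t"
    and s: "computable_at (\<lambda>a. P a \<and> n a \<noteq> 0) r i s"
  shows "computable_at P r i (\<lambda>a. if n a = 0 then t a else s a)"
proof -
  obtain pt ps where p: "\<And>a. P a \<Longrightarrow> n a = 0 \<Longrightarrow> run pt (r a) (i a) = Some (t a)"
    "\<And>a. P a \<Longrightarrow> n a \<noteq> 0 \<Longrightarrow> run ps (r a) (i a) = Some (s a)"
    using t s unfolding computable_at_def by blast
  have 1: "computable_at P r i (\<lambda>a. 1 - n a)" and 2: "computable_at P r i (\<lambda>a. 1 - (1 - n a))"
    by (intro computable_at_diff computable_at_const n)+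
  obtain p1 p2 where q: "\<And>a. P a \<Longrightarrow> run p1 (r a) (i a) = Some (1 - n a)"
    "\<And>a. P a \<Longrightarrow> run p2 (r a) (i a) = Some (1 - (1 - n a))"
    using 1 2 unfolding computable_at_def by blast
  \<comment> \<open>A branch is iterated zero times or once, so that the other one need not converge.\<close>
  have "computable_at P r i (\<lambda>a. if n a = 0 then t a else 0)"
    by (rule computable_atI[of _ "Comp (PrimRec Zero (Comp pt Fst)) (Pair (Pair Fst Snd) p1)"])
       (auto simp: p q)
  moreover have "computable_at P r i (\<lambda>a. if n a = 0 then 0 else s a)"
    by (rule computable_atI[of _ "Comp (PrimRec Zero (Comp ps Fst)) (Pair (Pair Fst Snd) p2)"])
       (auto simp: p q)
  ultimately have "computable_at P r i (\<lambda>a. (if n a = 0 then t a else 0) + (if n a = 0 then 0 else s a))"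
    by (rule computable_at_add)
  then show ?thesis by (rule computable_at_cong) simp
qed

lemma computable_at_if_le:
  assumes "computable_at P r i n" "computable_at P r i m"
    and "computable_at P r i t" "computable_at P r i s"
  shows "computable_at P r i (\<lambda>a. if n a \<le> m a then t a else s a)"
proof -
  have "computable_at P r i (\<lambda>a. if n a - m a = 0 then t a else s a)"
    by (intro computable_at_if_zero computable_at_diff computable_at_mono[OF assms(3)]
        computable_at_mono[OF assms(4)] assms(1,2)) simp_all
  then show ?thesis by simp
qed

lemma computable_at_half [intro]:
  assumes t: "computable_at P r i t"
  shows "computable_at P r i (\<lambda>a. t a div 2)"
    and "computable_at P r i (\<lambda>a. t a mod 2)"
proof -
  \<comment> \<open>Division by two iterates the exchange \<open>(q, r) \<mapsto> (q + r, 1 - r)\<close>.\<close>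
  let ?f = "\<lambda>n. rec_nat (prod_encode (0, 0)) (\<lambda>_ v. prod_encode
       (fst (prod_decode v) + snd (prod_decode v), 1 - snd (prod_decode v))) n"
  have f: "?f n = prod_encode (n div 2, n mod 2)" for n
  proof (induction n)
    case (Suc n)
    have "n div 2 + n mod 2 = Suc n div 2" "1 - n mod 2 = Suc n mod 2" by presburger+
    with Suc show ?case by simp
  qed simp
  have "computable_at P r i (\<lambda>a. ?f (t a))"
    by (intro computable_at_rec t computable_at_const computable_at_pair computable_at_add
        computable_at_diff computable_at_fst computable_at_snd computable_atI[of _ "Comp Snd Snd"])
      simp_all
  then have "computable_at P r i (\<lambda>a. prod_encode (t a div 2, t a mod 2))"
    unfolding f .
  from computable_at_fst[OF this] computable_at_snd[OF this]
  show "computable_at P r i (\<lambda>a. t a div 2)" "computable_at P r i (\<lambda>a. t a mod 2)" by simp_all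
qed

section \<open>Composition of oracles\<close>

primrec substitute :: "prog \<Rightarrow> prog \<Rightarrow> prog" where
  "substitute q Zero = Zero"
| "substitute q Succ = Succ"
| "substitute q Fst = Fst"
| "substitute q Snd = Snd"
| "substitute q Oracle = q"
| "substitute q (Pair p p') = Pair (substitute q p) (substitute q p')"
| "substitute q (Comp p p') = Comp (substitute q p) (substitute q p')"
| "substitute q (PrimRec p p') = PrimRec (substitute q p) (substitute q p')"
| "substitute q (Search p) = Search (substitute q p)"

lemma run_substitute:
  assumes "\<And>n. run q f n = Some (g n)"
  shows "run (substitute q p) f = run p g"
  by (induction p) (auto simp: assms)

text \<open>With \<open>q = Zero\<close> this removes the oracle calls from a program that works for
  all oracles.\<close>

lemma oracle_free_substitute: "oracle_free q \<Longrightarrow> oracle_free (substitute q p)"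
  by (induction p) auto

definition computable_from :: "('a \<Rightarrow> bool) \<Rightarrow> ('a \<Rightarrow> nat \<Rightarrow> nat) \<Rightarrow> ('a \<Rightarrow> nat \<Rightarrow> nat) \<Rightarrow> bool" where
  "computable_from P f g \<longleftrightarrow> (\<exists>p. \<forall>a. P a \<longrightarrow> (\<forall>n. run p (f a) n = Some (g a n)))"

lemma computable_from_iff:
  "computable_from P f g \<longleftrightarrow>
    computable_at (\<lambda>x. P (fst x)) (\<lambda>x. f (fst x)) snd (\<lambda>x. g (fst x) (snd x))"
  unfolding computable_from_def computable_at_def by auto

lemma computable_at_call:
  assumes "computable_from P r g" "computable_at P r i t"
  shows "computable_at P r i (\<lambda>a. g a (t a))"
proof -
  from assms(1) obtain q where "\<And>a n. P a \<Longrightarrow> run q (r a) n = Some (g a n)"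
    unfolding computable_from_def by blast
  then have "computable_at P r t (\<lambda>a. g a (t a))"
    by (intro computable_atI[of _ q]) simp
  with assms(2) show ?thesis by (rule computable_at_trans)
qed

lemma computable_at_change_oracle:
  assumes "computable_from P r g" "computable_at P g i t"
  shows "computable_at P r i t"
proof -
  from assms obtain p q where "\<And>a n. P a \<Longrightarrow> run q (r a) n = Some (g a n)"
    and "\<And>a. P a \<Longrightarrow> run p (g a) (i a) = Some (t a)"
    unfolding computable_from_def computable_at_def by blast
  then show ?thesis
    by (intro computable_atI[of _ "substitute q p"]) (simp add: run_substitute)
qed

lemma computable_from_refl: "computable_from P r r"
  unfolding computable_from_iff by (intro computable_at_oracle computable_at_input)

lemma computable_from_trans:
  assumes "computable_from P f g" "computable_from P g h"
  shows "computable_from P f h"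
  using assms(2) unfolding computable_from_iff
  by (rule computable_at_change_oracle[rotated])
     (use assms(1) in \<open>auto simp: computable_from_def\<close>)

lemma computable_from_mono:
  "computable_from P f g \<Longrightarrow> (\<And>a. Q a \<Longrightarrow> P a) \<Longrightarrow> computable_from Q f g"
  unfolding computable_from_def by meson

lemma computable_from_reparam:
  assumes "computable_from P f g" "\<And>b. Q b \<Longrightarrow> P (\<phi> b)"
    "\<And>b. Q b \<Longrightarrow> f' b = f (\<phi> b)" "\<And>b. Q b \<Longrightarrow> g' b = g (\<phi> b)"
  shows "computable_from Q f' g'"
proof -
  obtain p where "\<And>a n. P a \<Longrightarrow> run p (f a) n = Some (g a n)"
    using assms(1) unfolding computable_from_def by blast
  then show ?thesis
    unfolding computable_from_def by (intro exI[of _ p]) (simp add: assms(2-))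
qed

text \<open>These discharge the side conditions of \<open>computable_at_rec\<close>: old data,
  counter and previous value are each read off the extended input.\<close>

lemma computable_at_step:
  fixes r :: "'a \<Rightarrow> nat \<Rightarrow> nat"
  shows "computable_at P r i t \<Longrightarrow> computable_at (\<lambda>x. P (fst x)) (\<lambda>x. r (fst x))
      (\<lambda>x. prod_encode (i (fst x), prod_encode (fst (snd x), snd (snd x)))) (\<lambda>x. t (fst x))"
    and "computable_at (\<lambda>x. P (fst x)) (\<lambda>x. r (fst x))
      (\<lambda>x. prod_encode (i (fst x), prod_encode (fst (snd x), snd (snd x)))) (\<lambda>x. fst (snd x))"
    and "computable_at (\<lambda>x. P (fst x)) (\<lambda>x. r (fst x))
      (\<lambda>x. prod_encode (i (fst x), prod_encode (fst (snd x), snd (snd x)))) (\<lambda>x. snd (snd x))"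
proof -
  assume "computable_at P r i t"
  then obtain p where "\<And>a. P a \<Longrightarrow> run p (r a) (i a) = Some (t a)"
    unfolding computable_at_def by blast
  then show "computable_at (\<lambda>x. P (fst x)) (\<lambda>x. r (fst x))
      (\<lambda>x. prod_encode (i (fst x), prod_encode (fst (snd x), snd (snd x)))) (\<lambda>x. t (fst x))"
    by (intro computable_atI[of _ "Comp p Fst"]) simp
next
  show "computable_at (\<lambda>x. P (fst x)) (\<lambda>x. r (fst x))
      (\<lambda>x. prod_encode (i (fst x), prod_encode (fst (snd x), snd (snd x)))) (\<lambda>x. fst (snd x))"
    by (rule computable_atI[of _ "Comp Fst Snd"]) simp
  show "computable_at (\<lambda>x. P (fst x)) (\<lambda>x. r (fst x))
      (\<lambda>x. prod_encode (i (fst x), prod_encode (fst (snd x), snd (snd x)))) (\<lambda>x. snd (snd x))"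
    by (rule computable_atI[of _ "Comp Snd Snd"]) simp
qed

lemma computable_at_trial:
  fixes r :: "'a \<Rightarrow> nat \<Rightarrow> nat"
  shows "computable_at P r i t \<Longrightarrow> computable_at (\<lambda>x. P (fst x)) (\<lambda>x. r (fst x))
      (\<lambda>x. prod_encode (i (fst x), snd x)) (\<lambda>x. t (fst x))"
    and "computable_at (\<lambda>x. P (fst x)) (\<lambda>x. r (fst x))
      (\<lambda>x. prod_encode (i (fst x), snd x)) (\<lambda>x. snd x)"
proof -
  assume "computable_at P r i t"
  then obtain p where "\<And>a. P a \<Longrightarrow> run p (r a) (i a) = Some (t a)"
    unfolding computable_at_def by blast
  then show "computable_at (\<lambda>x. P (fst x)) (\<lambda>x. r (fst x))
      (\<lambda>x. prod_encode (i (fst x), snd x)) (\<lambda>x. t (fst x))"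
    by (intro computable_atI[of _ "Comp p Fst"]) simp
next
  show "computable_at (\<lambda>x. P (fst x)) (\<lambda>x. r (fst x))
      (\<lambda>x. prod_encode (i (fst x), snd x)) (\<lambda>x. snd x)"
    by (rule computable_atI[of _ Snd]) simp
qed

lemma computable_at_if_zero_total:
  assumes "computable_at P r i n" "computable_at P r i t" "computable_at P r i s"
  shows "computable_at P r i (\<lambda>a. if n a = 0 then t a else s a)"
  by (intro computable_at_if_zero computable_at_mono[OF assms(2)]
        computable_at_mono[OF assms(3)] assms(1)) simp_all

section \<open>Numbers that depend on the parameter\<close>

text \<open>As a constant function, \<open>n a\<close> is available at every input, and its
  transport between oracles is an instance of the transitivity of
  \<open>computable_from\<close>.\<close>

definition number_from :: "('a \<Rightarrow> bool) \<Rightarrow> ('a \<Rightarrow> nat \<Rightarrow> nat) \<Rightarrow> ('a \<Rightarrow> nat) \<Rightarrow> bool" where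
  "number_from P e n \<longleftrightarrow> computable_from P e (\<lambda>a _. n a)"

lemma number_from_computable_at: "number_from P e n \<Longrightarrow> computable_at P e i n"
  unfolding number_from_def by (drule computable_at_call[OF _ computable_at_input])

lemma number_fromI:
  assumes "computable_at P e (\<lambda>_. 0) n"
  shows "number_from P e n"
proof -
  obtain p where "\<And>a. P a \<Longrightarrow> run p (e a) 0 = Some (n a)"
    using assms unfolding computable_at_def by blast
  then show ?thesis
    unfolding number_from_def computable_from_def by (intro exI[of _ "Comp p Zero"]) simp
qed

lemma number_from_lift:
  "number_from P e n \<Longrightarrow> computable_at (\<lambda>x. P (fst x)) (\<lambda>x. e (fst x)) i (\<lambda>x. n (fst x))"
  by (rule number_from_computable_at) (auto simp: number_from_def computable_from_def)

lemma number_from_const: "number_from P e (\<lambda>_. n)"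
  by (intro number_fromI computable_at_const)

lemma computable_from_lift:
  "computable_from P e f \<Longrightarrow> computable_from (\<lambda>x. P (fst x)) (\<lambda>x. e (fst x)) (\<lambda>x. f (fst x))"
  by (erule computable_from_reparam[where \<phi> = fst]) auto

section \<open>Joins and tagged functions\<close>

definition evens :: "(nat \<Rightarrow> nat) \<Rightarrow> nat \<Rightarrow> nat" where
  "evens f n = f (n + n)"

definition odds :: "(nat \<Rightarrow> nat) \<Rightarrow> nat \<Rightarrow> nat" where
  "odds f n = f (Suc (n + n))"

lemma evens_fjoin [simp]: "evens (fjoin f g) = f"
  by (simp add: fun_eq_iff evens_def fjoin_def flip: mult_2)

lemma odds_fjoin [simp]: "odds (fjoin f g) = g"
  by (simp add: fun_eq_iff odds_def fjoin_def flip: mult_2)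

lemma fjoin_evens_odds [simp]: "fjoin (evens f) (odds f) = f"
proof
  fix n
  show "fjoin (evens f) (odds f) n = f n"
    by (cases "even n") (auto simp: fjoin_def evens_def odds_def elim!: evenE oddE simp flip: mult_2)
qed

lemma mem_mjoin_iff: "f \<in> mjoin C D \<longleftrightarrow> evens f \<in> C \<and> odds f \<in> D"
proof
  assume "evens f \<in> C \<and> odds f \<in> D"
  then show "f \<in> mjoin C D"
    unfolding mjoin_def by (metis (mono_tags, lifting) fjoin_evens_odds mem_Collect_eq)
qed (auto simp: mjoin_def)

lemma computable_from_evens:
  assumes "computable_from P e f" shows "computable_from P e (\<lambda>a. evens (f a))"
  unfolding computable_from_iff evens_def
  by (intro computable_at_call[OF computable_from_lift[OF assms]] computable_at_add computable_at_input)

lemma computable_from_odds: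
  assumes "computable_from P e f" shows "computable_from P e (\<lambda>a. odds (f a))"
  unfolding computable_from_iff odds_def
  by (intro computable_at_call[OF computable_from_lift[OF assms]] computable_at_Suc computable_at_add
      computable_at_input)

lemma computable_from_fjoin:
  assumes "computable_from P e f" "computable_from P e g"
  shows "computable_from P e (\<lambda>a. fjoin (f a) (g a))"
  unfolding computable_from_iff fjoin_def even_iff_mod_2_eq_zero
  by (intro computable_at_if_zero_total computable_at_half computable_at_input
      computable_at_call[OF computable_from_lift[OF assms(1)]]
      computable_at_call[OF computable_from_lift[OF assms(2)]])

lemma computable_from_fjoinD:
  assumes "computable_from P e (\<lambda>a. fjoin (f a) (g a))"
  shows "computable_from P e f" and "computable_from P e g"
  using computable_from_evens[OF assms] computable_from_odds[OF assms] by simp_all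

lemma computable_from_prepend:
  assumes "number_from P e n" "computable_from P e g"
  shows "computable_from P e (\<lambda>a. prepend (n a) (g a))"
proof -
  have "prepend m f k = (if k = 0 then m else f (k - 1))" for m f k
    by (cases k) (auto simp: prepend_def)
  then show ?thesis
    unfolding computable_from_iff
    by (simp only:) (intro computable_at_if_zero_total computable_at_pred computable_at_input
        number_from_lift[OF assms(1)] computable_at_call[OF computable_from_lift[OF assms(2)]])
qed

lemma computable_from_prependD:
  assumes "computable_from P e (\<lambda>a. prepend (n a) (g a))"
  shows "number_from P e n" and "computable_from P e g"
proof -
  have "computable_at P e (\<lambda>_. 0) (\<lambda>a. prepend (n a) (g a) 0)"
    by (intro computable_at_call[OF assms] computable_at_const)
  then show "number_from P e n" by (intro number_fromI) (simp add: prepend_def)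
  have "computable_at (\<lambda>x. P (fst x)) (\<lambda>x. e (fst x)) snd
      (\<lambda>x. prepend (n (fst x)) (g (fst x)) (Suc (snd x)))"
    by (intro computable_at_call[OF computable_from_lift[OF assms]] computable_at_Suc computable_at_input)
  then show "computable_from P e g"
    unfolding computable_from_iff by (simp add: prepend_def)
qed

text \<open>Neither branch has to be computable in the case of the other. This is the situation in
  which a tag decides which of two problems a function solves.\<close>

lemma computable_from_if_zero:
  assumes n: "number_from P e n"
    and f: "computable_from (\<lambda>a. P a \<and> n a = 0) e f"
    and g: "computable_from (\<lambda>a. P a \<and> n a \<noteq> 0) e g"
  shows "computable_from P e (\<lambda>a. if n a = 0 then f a else g a)"
proof -
  have "computable_at (\<lambda>x. P (fst x)) (\<lambda>x. e (fst x)) snd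
      (\<lambda>x. if n (fst x) = 0 then f (fst x) (snd x) else g (fst x) (snd x))"
    by (intro computable_at_if_zero number_from_lift n)
      (use f g in \<open>simp_all add: computable_from_iff\<close>)
  then show ?thesis
    unfolding computable_from_iff by (rule computable_at_cong) simp
qed

section \<open>Kleene's second algebra\<close>

text \<open>The prefix is a stack with \<open>g (n - 1)\<close> on top and its height stored beside
  it. The stack alone does not show its height, because the empty one is \<open>0\<close>, which is
  also the code of a pair; \<open>approx\<close> moreover takes the height as a bound for
  searches.\<close>

definition prefix_code :: "(nat \<Rightarrow> nat) \<Rightarrow> nat \<Rightarrow> nat" where
  "prefix_code g n = prod_encode (n, rec_nat 0 (\<lambda>k s. prod_encode (g k, s)) n)"

text \<open>In a stack of height \<open>n\<close>, popping \<open>n - Suc k\<close> times brings the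
  entry \<open>k\<close> to the top.\<close>

definition prefix_nth :: "nat \<Rightarrow> nat \<Rightarrow> nat" where
  "prefix_nth \<sigma> k = fst (prod_decode (rec_nat (snd (prod_decode \<sigma>))
     (\<lambda>_ s. snd (prod_decode s)) (fst (prod_decode \<sigma>) - Suc k)))"

lemma length_prefix_code [simp]: "fst (prod_decode (prefix_code g n)) = n"
  by (simp add: prefix_code_def)

lemma prefix_nth_prefix_code:
  assumes "k < n"
  shows "prefix_nth (prefix_code g n) k = g k"
proof -
  define s where "s n = rec_nat 0 (\<lambda>k s. prod_encode (g k, s)) n" for n
  \<comment> \<open>Induction on the number of pops: after \<open>j\<close> of them the stack of
    height \<open>n - j\<close> is left.\<close>
  have "rec_nat (s n) (\<lambda>_ s. snd (prod_decode s)) j = s (n - j)" if "j \<le> n" for j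
    using that
  proof (induction j)
    case (Suc j)
    then have "n - j = Suc (n - Suc j)" by simp
    moreover have "snd (prod_decode (s (Suc m))) = s m" for m
      by (simp add: s_def)
    ultimately show ?case using Suc by simp
  qed simp
  from this[of "n - Suc k"] have "prefix_nth (prefix_code g n) k = fst (prod_decode (s (Suc k)))"
    using assms by (simp add: prefix_nth_def prefix_code_def s_def)
  then show ?thesis by (simp add: s_def)
qed

lemma computable_at_prefix_nth:
  assumes "computable_at P r i \<sigma>" "computable_at P r i k"
  shows "computable_at P r i (\<lambda>a. prefix_nth (\<sigma> a) (k a))"
  unfolding prefix_nth_def
  by (intro computable_at_fst computable_at_rec computable_at_diff computable_at_snd
      computable_at_Suc computable_at_step assms)

lemma computable_at_prefix_code:
  assumes "computable_from P r g" "computable_at P r i n"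
  shows "computable_at P r i (\<lambda>a. prefix_code (g a) (n a))"
  unfolding prefix_code_def
  by (intro computable_at_pair computable_at_rec computable_at_const assms(2) computable_at_step
      computable_at_call[OF computable_from_lift[OF assms(1)]])

text \<open>
  The run of a program on the oracle \<open>fjoin e g\<close>, where only the prefix of \<open>g\<close> coded by \<open>\<sigma>\<close> is known:
  \<open>Suc v\<close> is the result \<open>v\<close>, and \<open>0\<close> means that none is reached. The length of the prefix also limits
  the number of trials of a search, whose states are \<open>0\<close> (still searching), \<open>1\<close> (stuck) and
  \<open>Suc (Suc k)\<close> (found \<open>k\<close>).
\<close>

primrec approx :: "prog \<Rightarrow> (nat \<Rightarrow> nat) \<Rightarrow> nat \<Rightarrow> nat \<Rightarrow> nat" where
  "approx Zero e \<sigma> x = 1"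
| "approx Succ e \<sigma> x = Suc (Suc x)"
| "approx Fst e \<sigma> x = Suc (fst (prod_decode x))"
| "approx Snd e \<sigma> x = Suc (snd (prod_decode x))"
| "approx Oracle e \<sigma> x =
     (if x mod 2 = 0 then Suc (e (x div 2))
      else if Suc (x div 2) \<le> fst (prod_decode \<sigma>) then Suc (prefix_nth \<sigma> (x div 2)) else 0)"
| "approx (Pair p q) e \<sigma> x =
     (if approx p e \<sigma> x = 0 then 0 else if approx q e \<sigma> x = 0 then 0
      else Suc (prod_encode (approx p e \<sigma> x - 1, approx q e \<sigma> x - 1)))"
| "approx (Comp p q) e \<sigma> x =
     (if approx q e \<sigma> x = 0 then 0 else approx p e \<sigma> (approx q e \<sigma> x - 1))"
| "approx (PrimRec p q) e \<sigma> x =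
     rec_nat (approx p e \<sigma> (fst (prod_decode x)))
       (\<lambda>k v. if v = 0 then 0
              else approx q e \<sigma> (prod_encode (fst (prod_decode x), prod_encode (k, v - 1))))
       (snd (prod_decode x))"
| "approx (Search p) e \<sigma> x =
     rec_nat 0
       (\<lambda>k s. if s = 0 then
                (if approx p e \<sigma> (prod_encode (x, k)) = 0 then 1
                 else if approx p e \<sigma> (prod_encode (x, k)) - 1 = 0 then Suc (Suc k) else 0)
              else s)
       (fst (prod_decode \<sigma>)) - 1"

text \<open>Uniformity in the oracle is built in: the parameter is a triple of the oracle and the
  two arguments.\<close>

definition computable_binary :: "((nat \<Rightarrow> nat) \<Rightarrow> nat \<Rightarrow> nat \<Rightarrow> nat) \<Rightarrow> bool" where
  "computable_binary F \<longleftrightarrow>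
     computable_at (\<lambda>_. True) fst (\<lambda>a. prod_encode (snd a)) (\<lambda>a. F (fst a) (fst (snd a)) (snd (snd a)))"

lemma computable_binary_args:
  "computable_at P r (\<lambda>a. prod_encode (snd a)) (\<lambda>a. fst (snd a))"
  "computable_at P r (\<lambda>a. prod_encode (snd a)) (\<lambda>a. snd (snd a))"
  using computable_at_fst[OF computable_at_input, of P r "\<lambda>a. prod_encode (snd a)"]
    computable_at_snd[OF computable_at_input, of P r "\<lambda>a. prod_encode (snd a)"] by simp_all

lemma computable_at_binary:
  assumes "computable_binary F" "computable_at P r i s" "computable_at P r i t"
  shows "computable_at P r i (\<lambda>a. F (r a) (s a) (t a))"
  using computable_at_pair[OF assms(2,3)]
proof (rule computable_at_trans)
  show "computable_at P r (\<lambda>a. prod_encode (s a, t a)) (\<lambda>a. F (r a) (s a) (t a))"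
    using assms(1) unfolding computable_binary_def
    by (rule computable_at_reparam[where \<phi> = "\<lambda>a. (r a, s a, t a)"]) simp_all
qed

text \<open>All clauses of \<open>approx\<close> are total, the search being bounded by the length
  of the prefix. An associate is a total function, so an approximation that may diverge could not
  define one.\<close>

lemma computable_binary_approx: "computable_binary (approx p)"
proof (induction p)
  case (PrimRec p q)
  show ?case
    unfolding computable_binary_def approx.simps
    by (intro computable_at_rec computable_at_if_zero_total computable_at_binary[OF PrimRec.IH(1)]
        computable_at_binary[OF PrimRec.IH(2)] computable_at_fst computable_at_snd
        computable_at_pair computable_at_pred computable_at_const computable_at_step
        computable_binary_args)
next
  case (Search p)
  show ?case
    unfolding computable_binary_def approx.simps
    by (intro computable_at_rec computable_at_if_zero_total computable_at_binary[OF Search.IH]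
        computable_at_fst computable_at_Suc computable_at_pair computable_at_pred
        computable_at_const computable_at_step computable_binary_args)
next
  case Oracle
  show ?case
    unfolding computable_binary_def approx.simps
    by (intro computable_at_if_zero_total computable_at_if_le computable_at_Suc computable_at_half
        computable_at_fst computable_at_oracle computable_at_prefix_nth computable_at_const
        computable_binary_args)
next
  case (Pair p q)
  show ?case
    unfolding computable_binary_def approx.simps
    by (intro computable_at_if_zero_total computable_at_binary[OF Pair.IH(1)]
        computable_at_binary[OF Pair.IH(2)] computable_at_Suc computable_at_pair computable_at_pred
        computable_at_const computable_binary_args)
next
  case (Comp p q)
  show ?case
    unfolding computable_binary_def approx.simps
    by (intro computable_at_if_zero_total computable_at_binary[OF Comp.IH(1)]
        computable_at_binary[OF Comp.IH(2)] computable_at_pred computable_at_const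
        computable_binary_args)
qed (unfold computable_binary_def approx.simps,
    (intro computable_at_Suc computable_at_fst computable_at_snd computable_at_const
      computable_binary_args)+)

text \<open>Here \<open>h k\<close> is the approximate result of trial \<open>k\<close>:
  \<open>0\<close> is no result, \<open>1\<close> the value \<open>0\<close>, and anything larger a
  nonzero value. A state other than \<open>0\<close> is never left, so it records the first trial
  that does not return a nonzero value.\<close>

lemma approx_search_sound:
  fixes h :: "nat \<Rightarrow> nat"
  defines "st \<equiv> rec_nat 0 (\<lambda>k s. if s = 0 then (if h k = 0 then 1 else if h k - 1 = 0 then Suc (Suc k) else 0) else s)"
  shows "st n = 0 \<Longrightarrow> k < n \<Longrightarrow> 1 < h k"
    and "st n = Suc (Suc m) \<Longrightarrow> h m = 1 \<and> (\<forall>k<m. 1 < h k)"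
proof -
  have st: "st 0 = 0" "st (Suc n) = (if st n = 0 then (if h n = 0 then 1 else if h n - 1 = 0 then Suc (Suc n) else 0) else st n)" for n
    by (simp_all add: st_def)
  show A: "1 < h k" if "st n = 0" "k < n" for n k
    using that by (induction n) (auto simp: st less_Suc_eq split: if_splits)
  show "h m = 1 \<and> (\<forall>k<m. 1 < h k)" if "st n = Suc (Suc m)"
    using that
  proof (induction n)
    case (Suc n)
    then show ?case using A[of n] by (auto simp: st split: if_splits)
  qed (simp add: st)
qed

text \<open>Up to trial \<open>m\<close> the state stays \<open>0\<close>, from then on it is
  frozen; \<open>m < n\<close> ensures that trial \<open>m\<close> is made.\<close>

lemma approx_search_complete:
  fixes h :: "nat \<Rightarrow> nat"
  defines "st \<equiv> rec_nat 0 (\<lambda>k s. if s = 0 then (if h k = 0 then 1 else if h k - 1 = 0 then Suc (Suc k) else 0) else s)"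
  assumes "h m = 1" "\<forall>k<m. 1 < h k" "m < n"
  shows "st n = Suc (Suc m)"
proof -
  have st: "st 0 = 0" "st (Suc n) = (if st n = 0 then (if h n = 0 then 1 else if h n - 1 = 0 then Suc (Suc n) else 0) else st n)" for n
    by (simp_all add: st_def)
  have "st k = 0" if "k \<le> m" for k
    using that
  proof (induction k)
    case (Suc k)
    then have "1 < h k" using assms(3) by simp
    with Suc show ?case by (simp add: st)
  qed (simp add: st)
  then have "st (Suc m) = Suc (Suc m)" using assms(2) by (simp add: st)
  then have "st (Suc m + d) = Suc (Suc m)" for d
    by (induction d) (simp_all add: st)
  from this[of "n - Suc m"] show ?thesis using assms(4) by simp
qed

text \<open>Whatever is read of \<open>g\<close> comes from a genuine prefix, so a result reached
  with partial information is final. Therefore the first answer can be trusted.\<close>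

lemma approx_sound:
  "approx p e (prefix_code g n) x = Suc v \<Longrightarrow> run p (fjoin e g) x = Some v"
proof (induction p arbitrary: x v)
  case Oracle
  then show ?case
    by (auto simp: fjoin_def prefix_nth_prefix_code even_iff_mod_2_eq_zero split: if_splits)
next
  case (Pair p q)
  from Pair.prems obtain a b where "approx p e (prefix_code g n) x = Suc a"
    "approx q e (prefix_code g n) x = Suc b" "v = prod_encode (a, b)"
    by (cases "approx p e (prefix_code g n) x"; cases "approx q e (prefix_code g n) x") auto
  with Pair.IH show ?case by simp
next
  case (Comp p q)
  from Comp.prems obtain a where "approx q e (prefix_code g n) x = Suc a"
    "approx p e (prefix_code g n) a = Suc v"
    by (cases "approx q e (prefix_code g n) x") auto
  with Comp.IH show ?case by simp
next
  case (PrimRec p q)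
  define y where "y = fst (prod_decode x)"
  define F where "F = rec_nat (approx p e (prefix_code g n) y)
       (\<lambda>k v. if v = 0 then 0
              else approx q e (prefix_code g n) (prod_encode (y, prod_encode (k, v - 1))))"
  define G where "G = rec_nat (run p (fjoin e g) y) (\<lambda>k r. Option.bind r
     (\<lambda>v. run q (fjoin e g) (prod_encode (y, prod_encode (k, v)))))"
  have "F m = Suc w \<Longrightarrow> G m = Some w" for m w
  proof (induction m arbitrary: w)
    case 0
    then show ?case by (simp add: F_def G_def PrimRec.IH(1))
  next
    case (Suc m)
    have F: "F (Suc m) = (if F m = 0 then 0
              else approx q e (prefix_code g n) (prod_encode (y, prod_encode (m, F m - 1))))"
      and G: "G (Suc m) = Option.bind (G m) (\<lambda>v. run q (fjoin e g) (prod_encode (y, prod_encode (m, v))))"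
      by (simp_all add: F_def G_def)
    from Suc.prems F obtain u where u: "F m = Suc u"
      "approx q e (prefix_code g n) (prod_encode (y, prod_encode (m, u))) = Suc w"
      by (cases "F m") auto
    show ?case using Suc.IH[OF u(1)] PrimRec.IH(2)[OF u(2)] by (simp add: G)
  qed
  moreover have "F (snd (prod_decode x)) = Suc v" using PrimRec.prems unfolding F_def y_def by simp
  moreover have "run (PrimRec p q) (fjoin e g) x = G (snd (prod_decode x))"
    unfolding G_def y_def by simp
  ultimately show ?case by simp
next
  case (Search p)
  let ?h = "\<lambda>k. approx p e (prefix_code g n) (prod_encode (x, k))"
  have h: "?h v = 1 \<and> (\<forall>k<v. 1 < ?h k)"
    by (rule approx_search_sound(2)[where n = n]) (use Search.prems in simp)
  have 1: "run p (fjoin e g) (prod_encode (x, v)) = Some 0"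
    by (rule Search.IH) (use h in simp)
  have 2: "\<exists>u. run p (fjoin e g) (prod_encode (x, k)) = Some (Suc u)" if "k < v" for k
  proof -
    have "1 < ?h k" using that h by simp
    then obtain u where "?h k = Suc (Suc u)" by (metis One_nat_def less_imp_Suc_add plus_1_eq_Suc)
    then show ?thesis using Search.IH by blast
  qed
  have "(LEAST k. run p (fjoin e g) (prod_encode (x, k)) = Some 0) = v"
  proof (rule Least_equality)
    fix k assume "run p (fjoin e g) (prod_encode (x, k)) = Some 0"
    with 2[of k] show "v \<le> k" by (metis not_le option.inject nat.distinct(1))
  qed (fact 1)
  moreover have "\<forall>k<v. run p (fjoin e g) (prod_encode (x, k)) \<noteq> None"
    using 2 by force
  ultimately show ?case using 1 by auto
qed auto

text \<open>A converging run reads finitely many values of \<open>g\<close> and makes finitely many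
  trials. Properties that hold eventually are closed under finite conjunctions, which takes the
  place of explicit bounds on the prefix.\<close>

lemma approx_complete:
  "run p (fjoin e g) x = Some v \<Longrightarrow>
     \<forall>\<^sub>F n in sequentially. approx p e (prefix_code g n) x = Suc v"
proof (induction p arbitrary: x v)
  case Oracle
  have "\<forall>\<^sub>F n in sequentially. Suc (x div 2) \<le> n"
    by (rule eventually_ge_at_top)
  then show ?case
    by eventually_elim
      (use Oracle in \<open>auto simp: fjoin_def prefix_nth_prefix_code even_iff_mod_2_eq_zero split: if_splits\<close>)
next
  case (Pair p q)
  from Pair.prems obtain a b where ab: "run p (fjoin e g) x = Some a"
    "run q (fjoin e g) x = Some b" "v = prod_encode (a, b)"
    by (auto simp: bind_eq_Some_conv)
  from Pair.IH(1)[OF ab(1)] Pair.IH(2)[OF ab(2)] show ?case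
    by eventually_elim (simp add: ab(3))
next
  case (Comp p q)
  from Comp.prems obtain a where a: "run q (fjoin e g) x = Some a" "run p (fjoin e g) a = Some v"
    by (auto simp: bind_eq_Some_conv)
  from Comp.IH(1)[OF a(2)] Comp.IH(2)[OF a(1)] show ?case
    by eventually_elim simp
next
  case (PrimRec p q)
  define y where "y = fst (prod_decode x)"
  define F where "F n = rec_nat (approx p e (prefix_code g n) y)
       (\<lambda>k v. if v = 0 then 0
              else approx q e (prefix_code g n) (prod_encode (y, prod_encode (k, v - 1))))" for n
  define G where "G = rec_nat (run p (fjoin e g) y) (\<lambda>k r. Option.bind r
     (\<lambda>v. run q (fjoin e g) (prod_encode (y, prod_encode (k, v)))))"
  have "G m = Some w \<Longrightarrow> \<forall>\<^sub>F n in sequentially. F n m = Suc w" for m w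
  proof (induction m arbitrary: w)
    case 0
    then show ?case using PrimRec.IH(1) by (simp add: F_def G_def)
  next
    case (Suc m)
    have F: "F n (Suc m) = (if F n m = 0 then 0
              else approx q e (prefix_code g n) (prod_encode (y, prod_encode (m, F n m - 1))))" for n
      by (simp add: F_def)
    have G: "G (Suc m) = Option.bind (G m) (\<lambda>v. run q (fjoin e g) (prod_encode (y, prod_encode (m, v))))"
      by (simp add: G_def)
    from Suc.prems G obtain u where u: "G m = Some u"
      "run q (fjoin e g) (prod_encode (y, prod_encode (m, u))) = Some w"
      by (auto simp: bind_eq_Some_conv)
    from Suc.IH[OF u(1)] PrimRec.IH(2)[OF u(2)] show ?case
      by eventually_elim (simp add: F)
  qed
  moreover have "G (snd (prod_decode x)) = Some v" using PrimRec.prems unfolding G_def y_def by simp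
  moreover have "approx (PrimRec p q) e (prefix_code g n) x = F n (snd (prod_decode x))" for n
    unfolding F_def y_def by simp
  ultimately show ?case by simp
next
  case (Search p)
  let ?r = "\<lambda>k. run p (fjoin e g) (prod_encode (x, k))"
  from Search.prems obtain m where m: "?r m = Some 0" "\<forall>k<m. ?r k \<noteq> None"
    and v: "v = (LEAST k. ?r k = Some 0)"
    by (auto split: if_splits)
  have "?r v = Some 0" unfolding v using m(1) by (rule LeastI)
  from Search.IH[OF this]
  have 1: "\<forall>\<^sub>F n in sequentially. approx p e (prefix_code g n) (prod_encode (x, v)) = 1" by simp
  have "\<forall>\<^sub>F n in sequentially. 1 < approx p e (prefix_code g n) (prod_encode (x, k))" if "k < v" for k
  proof -
    have "v \<le> m" unfolding v using m(1) by (rule Least_le)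
    with that m(2) obtain u where u: "?r k = Some u" by fastforce
    moreover have "?r k \<noteq> Some 0" using that unfolding v by (rule not_less_Least)
    ultimately have "0 < u" by auto
    from Search.IH[OF u] show ?thesis by eventually_elim (use \<open>0 < u\<close> in simp)
  qed
  then have "\<forall>\<^sub>F n in sequentially. \<forall>k\<in>{..<v}. 1 < approx p e (prefix_code g n) (prod_encode (x, k))"
    by (intro eventually_ball_finite) auto
  moreover have "\<forall>\<^sub>F n in sequentially. v < n" by (rule eventually_gt_at_top)
  ultimately show ?case using 1
  proof eventually_elim
    case (elim n)
    then show ?case
      using approx_search_complete[of "\<lambda>k. approx p e (prefix_code g n) (prod_encode (x, k))" v n]
      by simp
  qed
qed auto

section \<open>Associates and abstraction\<close>

text \<open>The answer \<open>0\<close> asks for a longer prefix, and \<open>Suc v\<close> returns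
  \<open>v\<close>. Application is partial, hence a relation; there is at most one
  \<open>r\<close>.\<close>

definition applies :: "(nat \<Rightarrow> nat) \<Rightarrow> (nat \<Rightarrow> nat) \<Rightarrow> (nat \<Rightarrow> nat) \<Rightarrow> bool" where
  "applies h g r \<longleftrightarrow> (\<forall>x. \<exists>n. h (prod_encode (x, prefix_code g n)) = Suc (r x) \<and>
      (\<forall>m<n. h (prod_encode (x, prefix_code g m)) = 0))"

lemma computable_from_applies:
  assumes h: "computable_from P e h" and g: "computable_from P e g"
    and r: "\<And>a. P a \<Longrightarrow> applies (h a) (g a) (r a)"
  shows "computable_from P e r"
proof -
  define s where "s a x n = h a (prod_encode (x, prefix_code (g a) n))" for a x n
  \<comment> \<open>\<open>Search\<close> looks for a zero, and \<open>1 - s a x n\<close> vanishes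
    exactly at the positive answers.\<close>
  define N where "N a x = (LEAST n. 1 - s a x n = 0)" for a x
  have N: "s a x (N a x) = Suc (r a x)" if "P a" for a x
  proof -
    from r[OF that] obtain n where n: "s a x n = Suc (r a x)" "\<forall>m<n. s a x m = 0"
      unfolding applies_def s_def by blast
    have "N a x = n" unfolding N_def
      by (rule Least_equality) (use n in \<open>auto simp: not_le[symmetric]\<close>)
    with n show ?thesis by simp
  qed
  let ?P = "\<lambda>x. P (fst x)" and ?e = "\<lambda>x. e (fst x)"
  let ?P' = "\<lambda>x. P (fst (fst x))" and ?e' = "\<lambda>x. e (fst (fst x))"
  have "computable_at ?P ?e snd (\<lambda>x. N (fst x) (snd x))"
    unfolding N_def
  proof (rule computable_at_search)
    show "computable_at ?P' ?e' (\<lambda>x. prod_encode (snd (fst x), snd x))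
        (\<lambda>x. 1 - s (fst (fst x)) (snd (fst x)) (snd x))"
      unfolding s_def
      by (intro computable_at_diff computable_at_const computable_at_pair
          computable_at_call[OF computable_from_lift[OF computable_from_lift[OF h]]]
          computable_at_prefix_code computable_from_lift[OF computable_from_lift[OF g]]
          computable_at_trial computable_at_trial(1)[OF computable_at_input])
    show "\<exists>n. 1 - s (fst x) (snd x) n = 0" if "P (fst x)" for x
      using N[OF that, of "snd x"] by (intro exI[of _ "N (fst x) (snd x)"]) simp
  qed
  then have "computable_at ?P ?e snd (\<lambda>x. s (fst x) (snd x) (N (fst x) (snd x)) - 1)"
    unfolding s_def
    by (intro computable_at_pred computable_at_pair computable_at_input
        computable_at_call[OF computable_from_lift[OF h]]
        computable_at_prefix_code computable_from_lift[OF g])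
  then show ?thesis
    unfolding computable_from_iff by (rule computable_at_cong) (simp add: N)
qed

text \<open>Completeness gives a prefix with an answer. At the shortest one soundness identifies the
  answer with \<open>r x\<close>.\<close>

lemma applies_approx:
  assumes "\<And>x. run p (fjoin e g) x = Some (r x)"
  shows "applies (\<lambda>y. approx p e (snd (prod_decode y)) (fst (prod_decode y))) g r"
  unfolding applies_def
proof
  fix x
  let ?h = "\<lambda>n. approx p e (prefix_code g n) x"
  obtain N where "\<forall>n\<ge>N. ?h n = Suc (r x)"
    using approx_complete[OF assms, of x] unfolding eventually_sequentially by blast
  then have "\<exists>n. ?h n \<noteq> 0" by (intro exI[of _ N]) simp
  define n where "n = (LEAST n. ?h n \<noteq> 0)"
  have "?h n \<noteq> 0" unfolding n_def using \<open>\<exists>n. ?h n \<noteq> 0\<close> by (rule LeastI_ex)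
  then obtain v where "?h n = Suc v" using not0_implies_Suc by blast
  moreover from approx_sound[OF this] assms have "v = r x" by simp
  moreover have "\<forall>m<n. ?h m = 0" unfolding n_def using not_less_Least by blast
  ultimately show "\<exists>n. approx p e (snd (prod_decode (prod_encode (x, prefix_code g n))))
        (fst (prod_decode (prod_encode (x, prefix_code g n)))) = Suc (r x) \<and>
      (\<forall>m<n. approx p e (snd (prod_decode (prod_encode (x, prefix_code g m))))
        (fst (prod_decode (prod_encode (x, prefix_code g m)))) = 0)"
    by auto
qed

definition solvable_from :: "('a \<Rightarrow> bool) \<Rightarrow> ('a \<Rightarrow> nat \<Rightarrow> nat) \<Rightarrow> ('a \<Rightarrow> mass_problem) \<Rightarrow> bool" where
  "solvable_from P e M \<longleftrightarrow> (\<exists>g. computable_from P e g \<and> (\<forall>a. P a \<longrightarrow> g a \<in> M a))"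

lemma solvable_fromI:
  "computable_from P e g \<Longrightarrow> (\<And>a. P a \<Longrightarrow> g a \<in> M a) \<Longrightarrow> solvable_from P e M"
  unfolding solvable_from_def by blast

text \<open>Abstraction of an argument, in the role of the s-m-n theorem. The associate is computed
  from \<open>e\<close> alone, so one \<open>h (\<pi> b)\<close> serves all \<open>b\<close> over
  the same parameter. It is an instance of \<open>approx\<close> and thus computable for every
  parameter, whence the arbitrary \<open>P\<close>.\<close>

lemma solvable_from_abstract:
  assumes "solvable_from Q (\<lambda>b. fjoin (e (\<pi> b)) (\<gamma> b)) M"
  obtains h where "computable_from P e h"
    "\<And>b. Q b \<Longrightarrow> \<exists>r\<in>M b. applies (h (\<pi> b)) (\<gamma> b) r"
proof -
  obtain r where r: "computable_from Q (\<lambda>b. fjoin (e (\<pi> b)) (\<gamma> b)) r"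
    and M: "\<And>b. Q b \<Longrightarrow> r b \<in> M b"
    using assms unfolding solvable_from_def by blast
  from r obtain p where p: "\<And>b x. Q b \<Longrightarrow> run p (fjoin (e (\<pi> b)) (\<gamma> b)) x = Some (r b x)"
    unfolding computable_from_def by blast
  show thesis
  proof
    show "computable_from P e (\<lambda>a y. approx p (e a) (snd (prod_decode y)) (fst (prod_decode y)))"
      unfolding computable_from_iff
      by (intro computable_at_binary[OF computable_binary_approx] computable_at_fst
          computable_at_snd computable_at_input)
    show "\<exists>r\<in>M b. applies (\<lambda>y. approx p (e (\<pi> b)) (snd (prod_decode y)) (fst (prod_decode y))) (\<gamma> b) r"
      if "Q b" for b
      using applies_approx[OF p[OF that]] M[OF that] by blast
  qed
qed

section \<open>Uniform reducibility\<close>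

lemma solvable_from_mono:
  assumes "solvable_from P e M" "\<And>a. Q a \<Longrightarrow> P a" "\<And>a. Q a \<Longrightarrow> M a \<subseteq> N a"
  shows "solvable_from Q e N"
proof -
  obtain g where "computable_from P e g" "\<And>a. P a \<Longrightarrow> g a \<in> M a"
    using assms(1) unfolding solvable_from_def by blast
  then show ?thesis
    using assms(2,3) by (intro solvable_fromI[OF computable_from_mono]) blast+
qed

lemma solvable_from_mjoin:
  assumes "solvable_from P e M" "solvable_from P e N"
  shows "solvable_from P e (\<lambda>a. mjoin (M a) (N a))"
proof -
  obtain f g where fg: "computable_from P e f" "\<And>a. P a \<Longrightarrow> f a \<in> M a"
    "computable_from P e g" "\<And>a. P a \<Longrightarrow> g a \<in> N a"
    using assms unfolding solvable_from_def by blast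
  show ?thesis
    by (rule solvable_fromI[OF computable_from_fjoin[OF fg(1,3)]]) (simp add: mem_mjoin_iff fg)
qed

lemma solvable_from_mjoinD:
  assumes "solvable_from P e (\<lambda>a. mjoin (M a) (N a))"
  shows "solvable_from P e M" "solvable_from P e N"
proof -
  obtain f where f: "computable_from P e f" "\<And>a. P a \<Longrightarrow> f a \<in> mjoin (M a) (N a)"
    using assms unfolding solvable_from_def by blast
  show "solvable_from P e M"
    by (rule solvable_fromI[OF computable_from_evens[OF f(1)]]) (use f(2) mem_mjoin_iff in blast)
  show "solvable_from P e N"
    by (rule solvable_fromI[OF computable_from_odds[OF f(1)]]) (use f(2) mem_mjoin_iff in blast)
qed

lemma solvable_from_prepend:
  assumes "number_from P e n" "solvable_from P e M"
  shows "solvable_from P e (\<lambda>a. prepend (n a) ` M a)"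
proof -
  obtain f where f: "computable_from P e f" "\<And>a. P a \<Longrightarrow> f a \<in> M a"
    using assms(2) unfolding solvable_from_def by blast
  show ?thesis
    by (rule solvable_fromI[OF computable_from_prepend[OF assms(1) f(1)]]) (simp add: f)
qed

lemma solvable_from_if_zero:
  assumes "number_from P e n"
    and "solvable_from (\<lambda>a. P a \<and> n a = 0) e M" "solvable_from (\<lambda>a. P a \<and> n a \<noteq> 0) e M"
  shows "solvable_from P e M"
proof -
  obtain f g where fg: "computable_from (\<lambda>a. P a \<and> n a = 0) e f" "\<And>a. P a \<and> n a = 0 \<Longrightarrow> f a \<in> M a"
    "computable_from (\<lambda>a. P a \<and> n a \<noteq> 0) e g" "\<And>a. P a \<and> n a \<noteq> 0 \<Longrightarrow> g a \<in> M a"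
    using assms(2,3) unfolding solvable_from_def by blast
  show ?thesis
    by (rule solvable_fromI[OF computable_from_if_zero[OF assms(1) fg(1,3)]]) (simp add: fg)
qed

lemma number_from_mono:
  "number_from P e n \<Longrightarrow> (\<And>a. Q a \<Longrightarrow> P a) \<Longrightarrow> number_from Q e n"
  unfolding number_from_def by (rule computable_from_mono)

lemma number_from_head:
  assumes "computable_from P e g" shows "number_from P e (\<lambda>a. g a 0)"
  by (intro number_fromI computable_at_call[OF assms] computable_at_const)

lemma computable_from_tail:
  assumes "computable_from P e g" shows "computable_from P e (\<lambda>a k. g a (Suc k))"
  unfolding computable_from_iff
  by (intro computable_at_call[OF computable_from_lift[OF assms]] computable_at_Suc computable_at_input)

lemma turing_functional_eq_Some_iff:
  "turing_functional p f = Some g \<longleftrightarrow> (\<forall>n. run p f n = Some (g n))"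
proof
  assume "\<forall>n. run p f n = Some (g n)"
  then show "turing_functional p f = Some g" by (simp add: turing_functional_def)
next
  assume "turing_functional p f = Some g"
  then have "\<forall>n. run p f n \<noteq> None" "g = (\<lambda>n. the (run p f n))"
    unfolding turing_functional_def by (simp_all split: if_splits)
  then show "\<forall>n. run p f n = Some (g n)" by simp
qed

text \<open>A reduction is solvability in the generic context: the parameter is an index with a
  solution over it, and the oracle consists of the code of the index followed by that
  solution.\<close>

lemma uniform_le_iff:
  "uniform_le c I A B \<longleftrightarrow>
     solvable_from (\<lambda>x. fst x \<in> I \<and> snd x \<in> B (fst x)) (\<lambda>x. prepend (c (fst x)) (snd x)) (\<lambda>x. A (fst x))"
    (is "_ \<longleftrightarrow> solvable_from ?P ?e _")
proof
  assume "uniform_le c I A B"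
  then obtain p where p: "\<And>i f. i \<in> I \<Longrightarrow> f \<in> B i \<Longrightarrow>
      \<exists>g\<in>A i. turing_functional p (prepend (c i) f) = Some g"
    unfolding uniform_le_def reduces_def by blast
  define G where "G x = the (turing_functional p (?e x))" for x
  have "G x \<in> A (fst x)" "\<forall>n. run p (?e x) n = Some (G x n)" if "?P x" for x
    using p[of "fst x" "snd x"] that
    by (auto simp: G_def simp flip: turing_functional_eq_Some_iff)
  then show "solvable_from ?P ?e (\<lambda>x. A (fst x))"
    unfolding solvable_from_def computable_from_def by blast
next
  assume "solvable_from ?P ?e (\<lambda>x. A (fst x))"
  then obtain g p where gp: "\<And>x. ?P x \<Longrightarrow> g x \<in> A (fst x)"
    "\<And>x n. ?P x \<Longrightarrow> run p (?e x) n = Some (g x n)"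
    unfolding solvable_from_def computable_from_def by blast
  have "turing_functional p (prepend (c i) f) = Some (g (i, f)) \<and> g (i, f) \<in> A i"
    if "i \<in> I" "f \<in> B i" for i f
    using gp[of "(i, f)"] that by (simp add: turing_functional_eq_Some_iff)
  then show "uniform_le c I A B"
    unfolding uniform_le_def reduces_def by blast
qed

text \<open>The assumption is applied at the generic context, which fixes its parameter type, as an
  assumption cannot be polymorphic. Stating it for all \<open>P\<close>, \<open>e\<close> and
  \<open>i\<close> hides the concrete oracle from the arguments that use the rule.\<close>

lemma uniform_leI:
  assumes "\<And>P e (i :: 'i \<times> (nat \<Rightarrow> nat) \<Rightarrow> 'i).
     \<lbrakk>number_from P e (\<lambda>x. c (i x)); solvable_from P e (\<lambda>x. B (i x)); \<And>x. P x \<Longrightarrow> i x \<in> I\<rbrakk> \<Longrightarrow>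
       solvable_from P e (\<lambda>x. A (i x))"
  shows "uniform_le c I A B"
  unfolding uniform_le_iff
proof (rule assms)
  note * = computable_from_prependD[OF computable_from_refl, of _ "\<lambda>x. c (fst x)" snd]
  show "number_from (\<lambda>x. fst x \<in> I \<and> snd x \<in> B (fst x)) (\<lambda>x. prepend (c (fst x)) (snd x))
      (\<lambda>x. c (fst x))" by (rule *)
  show "solvable_from (\<lambda>x. fst x \<in> I \<and> snd x \<in> B (fst x)) (\<lambda>x. prepend (c (fst x)) (snd x))
      (\<lambda>x. B (fst x))" by (rule solvable_fromI, rule *) simp
qed simp

text \<open>Any context with a code and a solution maps to the generic one by
  \<open>\<lambda>a. (i a, g a)\<close>, and the reduction is transported along this map.\<close>

lemma solvable_from_reduce:
  assumes le: "uniform_le c I A B" and n: "number_from P e (\<lambda>a. c (i a))"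
    and B: "solvable_from P e (\<lambda>a. B (i a))" and i: "\<And>a. P a \<Longrightarrow> i a \<in> I"
  shows "solvable_from P e (\<lambda>a. A (i a))"
proof -
  obtain g where g: "computable_from P e g" "\<And>a. P a \<Longrightarrow> g a \<in> B (i a)"
    using B unfolding solvable_from_def by blast
  obtain G where G: "computable_from (\<lambda>x. fst x \<in> I \<and> snd x \<in> B (fst x))
      (\<lambda>x. prepend (c (fst x)) (snd x)) G"
    "\<And>x. fst x \<in> I \<Longrightarrow> snd x \<in> B (fst x) \<Longrightarrow> G x \<in> A (fst x)"
    using le unfolding uniform_le_iff solvable_from_def by blast
  have "computable_from P (\<lambda>a. prepend (c (i a)) (g a)) (\<lambda>a. G (i a, g a))"
    by (rule computable_from_reparam[OF G(1), where \<phi> = "\<lambda>a. (i a, g a)"]) (simp_all add: i g)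
  then show ?thesis
    using G(2) i g(2)
    by (intro solvable_fromI computable_from_trans[OF computable_from_prepend[OF n g(1)]]) fastforce+
qed

lemma uniform_le_refl: "uniform_le c I A A"
  by (rule uniform_leI)

lemma uniform_le_trans:
  assumes "uniform_le c I A B" "uniform_le c I B C"
  shows "uniform_le c I A C"
  by (rule uniform_leI)
    (intro solvable_from_reduce[OF assms(1)] solvable_from_reduce[OF assms(2)])

lemma uniform_le_cong:
  assumes "uniform_le c I A B" "\<And>i. i \<in> I \<Longrightarrow> A' i = A i" "\<And>i. i \<in> I \<Longrightarrow> B' i = B i"
  shows "uniform_le c I A' B'"
  using assms unfolding uniform_le_def by simp

lemma uniform_le_mjoin_iff:
  "uniform_le c I (\<lambda>i. mjoin (A i) (B i)) C \<longleftrightarrow> uniform_le c I A C \<and> uniform_le c I B C"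
  unfolding uniform_le_iff
  by (intro iffI conjI, erule solvable_from_mjoinD, erule solvable_from_mjoinD,
      erule conjE, rule solvable_from_mjoin)

lemma uniform_le_mjoinI:
  "uniform_le c I A B \<Longrightarrow> uniform_le c I A (\<lambda>i. mjoin (B i) (C i))"
  "uniform_le c I A C \<Longrightarrow> uniform_le c I A (\<lambda>i. mjoin (B i) (C i))"
proof -
  have "uniform_le c I B (\<lambda>i. mjoin (B i) (C i))" "uniform_le c I C (\<lambda>i. mjoin (B i) (C i))"
    using uniform_le_refl[of c I "\<lambda>i. mjoin (B i) (C i)"] unfolding uniform_le_mjoin_iff by simp_all
  then show "uniform_le c I A B \<Longrightarrow> uniform_le c I A (\<lambda>i. mjoin (B i) (C i))"
    "uniform_le c I A C \<Longrightarrow> uniform_le c I A (\<lambda>i. mjoin (B i) (C i))"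
    by (blast intro: uniform_le_trans)+
qed

definition mmeet :: "mass_problem \<Rightarrow> mass_problem \<Rightarrow> mass_problem" where
  "mmeet A B = prepend 0 ` A \<union> prepend 1 ` B"

lemma uniform_le_mmeet_iff:
  "uniform_le c I C (\<lambda>i. mmeet (A i) (B i)) \<longleftrightarrow> uniform_le c I C A \<and> uniform_le c I C B"
proof (intro iffI conjI)
  assume le: "uniform_le c I C (\<lambda>i. mmeet (A i) (B i))"
  show "uniform_le c I C A"
  proof (rule uniform_leI)
    fix P e and i :: "'a \<times> (nat \<Rightarrow> nat) \<Rightarrow> 'a"
    assume i: "number_from P e (\<lambda>x. c (i x))" "\<And>x. P x \<Longrightarrow> i x \<in> I"
      and "solvable_from P e (\<lambda>x. A (i x))"
    from solvable_from_prepend[OF number_from_const this(3), of 0]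
    have "solvable_from P e (\<lambda>x. mmeet (A (i x)) (B (i x)))"
      by (rule solvable_from_mono) (auto simp: mmeet_def)
    then show "solvable_from P e (\<lambda>x. C (i x))"
      using i by (intro solvable_from_reduce[OF le])
  qed
  show "uniform_le c I C B"
  proof (rule uniform_leI)
    fix P e and i :: "'a \<times> (nat \<Rightarrow> nat) \<Rightarrow> 'a"
    assume i: "number_from P e (\<lambda>x. c (i x))" "\<And>x. P x \<Longrightarrow> i x \<in> I"
      and "solvable_from P e (\<lambda>x. B (i x))"
    from solvable_from_prepend[OF number_from_const this(3), of 1]
    have "solvable_from P e (\<lambda>x. mmeet (A (i x)) (B (i x)))"
      by (rule solvable_from_mono) (auto simp: mmeet_def)
    then show "solvable_from P e (\<lambda>x. C (i x))"
      using i by (intro solvable_from_reduce[OF le])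
  qed
next
  assume le: "uniform_le c I C A \<and> uniform_le c I C B"
  show "uniform_le c I C (\<lambda>i. mmeet (A i) (B i))"
  proof (rule uniform_leI)
    fix P e and i :: "'a \<times> (nat \<Rightarrow> nat) \<Rightarrow> 'a"
    assume i: "number_from P e (\<lambda>x. c (i x))" "\<And>x. P x \<Longrightarrow> i x \<in> I"
      and "solvable_from P e (\<lambda>x. mmeet (A (i x)) (B (i x)))"
    then obtain g where g: "computable_from P e g" "\<And>x. P x \<Longrightarrow> g x \<in> mmeet (A (i x)) (B (i x))"
      unfolding solvable_from_def by blast
    \<comment> \<open>The tag \<open>g x 0\<close> selects the reduction. The tail is known to solve
      only the corresponding problem, so each reduction is applied on its own part of the
      parameters.\<close>
    have A: "solvable_from (\<lambda>x. P x \<and> g x 0 = 0) e (\<lambda>x. A (i x))"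
      by (rule solvable_fromI[OF computable_from_mono[OF computable_from_tail[OF g(1)]]])
        (use g(2) in \<open>fastforce simp: mmeet_def prepend_def\<close>)+
    have B: "solvable_from (\<lambda>x. P x \<and> g x 0 \<noteq> 0) e (\<lambda>x. B (i x))"
      by (rule solvable_fromI[OF computable_from_mono[OF computable_from_tail[OF g(1)]]])
        (use g(2) in \<open>fastforce simp: mmeet_def prepend_def\<close>)+
    show "solvable_from P e (\<lambda>x. C (i x))"
      by (rule solvable_from_if_zero[OF number_from_head[OF g(1)]];
          rule solvable_from_reduce[OF conjunct1[OF le] _ A] solvable_from_reduce[OF conjunct2[OF le] _ B])
        (use i in \<open>auto intro: number_from_mono\<close>)
  qed
qed

lemma solvable_from_medvedev:
  assumes "medvedev_le A B" "solvable_from P e (\<lambda>_. B)"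
  shows "solvable_from P e (\<lambda>_. A)"
proof -
  \<comment> \<open>Over a one-point index set, uniform reducibility is ordinary
    reducibility.\<close>
  have "uniform_le (\<lambda>_. 0) UNIV (\<lambda>_ :: unit. A) (\<lambda>_. B)"
  proof -
    obtain p where p: "\<forall>f\<in>B. \<exists>g\<in>A. turing_functional p f = Some g"
      using assms(1) unfolding medvedev_le_def reduces_def by blast
    let ?P = "\<lambda>x :: unit \<times> (nat \<Rightarrow> nat). fst x \<in> UNIV \<and> snd x \<in> B"
    let ?G = "\<lambda>x. the (turing_functional p (snd x))"
    have "?P x \<Longrightarrow> ?G x \<in> A" "?P x \<Longrightarrow> run p (snd x) n = Some (?G x n)" for x n
      using p turing_functional_eq_Some_iff by fastforce+
    then have "computable_from ?P snd ?G" "\<And>x. ?P x \<Longrightarrow> ?G x \<in> A"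
      unfolding computable_from_def by blast+
    then show ?thesis
      unfolding uniform_le_iff
      by (intro solvable_fromI computable_from_trans[OF computable_from_prependD(2)[OF computable_from_refl]])
  qed
  from solvable_from_reduce[OF this number_from_const assms(2)] show ?thesis by simp
qed

text \<open>Finitely many programs form a table that is looked up by the code; injectivity of
  \<open>c\<close> on \<open>I\<close> makes the code identify the index.\<close>

lemma uniform_le_finite:
  assumes "finite I" "inj_on c I" "\<And>i. i \<in> I \<Longrightarrow> medvedev_le (A i) (B i)"
  shows "uniform_le c I A B"
  using assms
proof (induction I)
  case empty
  show ?case by (simp add: uniform_le_def)
next
  case (insert j I)
  then have le: "uniform_le c I A B" by auto
  show ?case
  proof (rule uniform_leI)
    fix P e and i :: "'a \<times> (nat \<Rightarrow> nat) \<Rightarrow> 'a"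
    assume n: "number_from P e (\<lambda>x. c (i x))" and i: "\<And>x. P x \<Longrightarrow> i x \<in> insert j I"
      and B: "solvable_from P e (\<lambda>x. B (i x))"
    \<comment> \<open>The distance between the two codes, computed with truncated subtraction; it
      tests whether the index is \<open>j\<close>.\<close>
    let ?n = "\<lambda>x. (c (i x) - c j) + (c j - c (i x))"
    have eq: "i x = j" if "P x" "?n x = 0" for x
    proof -
      have "c (i x) = c j" using that(2) by simp
      then show ?thesis using inj_onD[OF insert.prems(1) _ i[OF that(1)]] by simp
    qed
    show "solvable_from P e (\<lambda>x. A (i x))"
    proof (rule solvable_from_if_zero)
      show "number_from P e ?n"
        by (intro number_fromI computable_at_add computable_at_diff computable_at_const
            number_from_computable_at[OF n])
      have "solvable_from (\<lambda>x. P x \<and> ?n x = 0) e (\<lambda>_. B j)"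
        by (rule solvable_from_mono[OF B]) (use eq in auto)
      then have "solvable_from (\<lambda>x. P x \<and> ?n x = 0) e (\<lambda>_. A j)"
        by (rule solvable_from_medvedev[rotated]) (use insert.prems(2) in simp)
      then show "solvable_from (\<lambda>x. P x \<and> ?n x = 0) e (\<lambda>x. A (i x))"
        by (rule solvable_from_mono) (use eq in auto)
      show "solvable_from (\<lambda>x. P x \<and> ?n x \<noteq> 0) e (\<lambda>x. A (i x))"
        by (rule solvable_from_reduce[OF le number_from_mono[OF n] solvable_from_mono[OF B]])
          (use i in force)+
    qed
  qed
qed

text \<open>A fixed index has a constant code, which a program can produce by itself.\<close>

lemma uniform_le_imp_medvedev_le:
  assumes "uniform_le c I A B" "i \<in> I"
  shows "medvedev_le (A i) (B i)"
proof -
  have "solvable_from (\<lambda>f. f \<in> B i) (\<lambda>f. f) (\<lambda>_. B i)"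
    by (rule solvable_fromI[OF computable_from_refl]) simp
  from solvable_from_reduce[OF assms(1) number_from_const this]
  have "solvable_from (\<lambda>f. f \<in> B i) (\<lambda>f. f) (\<lambda>_. A i)" using assms(2) by simp
  then obtain g p where gp: "\<And>f. f \<in> B i \<Longrightarrow> g f \<in> A i" "\<And>f n. f \<in> B i \<Longrightarrow> run p f n = Some (g f n)"
    unfolding solvable_from_def computable_from_def by blast
  then show ?thesis
    unfolding medvedev_le_def reduces_def by (intro exI[of _ p]) (auto simp: turing_functional_eq_Some_iff)
qed

text \<open>The oracle is the free second component of the parameter, so one program works for all
  oracles. Hence the value can be computed inside any other computation, and also by an oracle-free
  program.\<close>

definition code_computable :: "('i \<Rightarrow> nat) \<Rightarrow> 'i set \<Rightarrow> ('i \<Rightarrow> nat) \<Rightarrow> bool" where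
  "code_computable c I n \<longleftrightarrow> computable_at (\<lambda>x. fst x \<in> I) snd (\<lambda>x. c (fst x)) (\<lambda>x. n (fst x))"

lemma number_from_code_computable:
  assumes "code_computable c I n" "number_from P e (\<lambda>a. c (i a))" "\<And>a. P a \<Longrightarrow> i a \<in> I"
  shows "number_from P e (\<lambda>a. n (i a))"
proof (rule number_fromI)
  have "computable_at P e (\<lambda>a. c (i a)) (\<lambda>a. n (i a))"
    using assms(1) unfolding code_computable_def
    by (rule computable_at_reparam[where \<phi> = "\<lambda>a. (i a, e a)"]) (simp_all add: assms(3))
  then show "computable_at P e (\<lambda>_. 0) (\<lambda>a. n (i a))"
    by (rule computable_at_trans[OF number_from_computable_at[OF assms(2)]])
qed

lemma uniform_le_reindex:
  assumes "uniform_le d J A B" "code_computable c I (\<lambda>i. d (\<alpha> i))" "\<And>i. i \<in> I \<Longrightarrow> \<alpha> i \<in> J"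
  shows "uniform_le c I (\<lambda>i. A (\<alpha> i)) (\<lambda>i. B (\<alpha> i))"
  by (rule uniform_leI, rule solvable_from_reduce[OF assms(1)])
    (auto intro: number_from_code_computable[OF assms(2)] assms(3))

section \<open>Universal quantification along a map\<close>

text \<open>The argument of an associate is the code of a point in front of a solution of its bound.
  Supplying \<open>B i\<close> is what adjointness in the interval above \<open>B\<close> demands,
  since substitution joins with the bound.\<close>

definition forall_along ::
    "('i \<Rightarrow> nat) \<Rightarrow> 'i set \<Rightarrow> ('i \<Rightarrow> 'j) \<Rightarrow> ('i \<Rightarrow> mass_problem) \<Rightarrow> ('i \<Rightarrow> mass_problem) \<Rightarrow> 'j \<Rightarrow> mass_problem" where
  "forall_along c I \<alpha> B D j =
     {h. \<forall>i\<in>I. \<alpha> i = j \<longrightarrow> (\<forall>g\<in>B i. \<exists>r\<in>D i. applies h (prepend (c i) g) r)}"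

lemma solvable_from_apply:
  assumes h: "computable_from P e h" and n: "number_from P e n" and g: "computable_from P e g"
    and r: "\<And>a. P a \<Longrightarrow> \<exists>r\<in>M a. applies (h a) (prepend (n a) (g a)) r"
  shows "solvable_from P e M"
proof -
  obtain r where r: "\<And>a. P a \<Longrightarrow> r a \<in> M a" "\<And>a. P a \<Longrightarrow> applies (h a) (prepend (n a) (g a)) (r a)"
    using r by metis
  show ?thesis
    by (rule solvable_fromI[OF computable_from_applies[OF h computable_from_prepend[OF n g] r(2)] r(1)])
qed

lemma solvable_from_transfer:
  assumes "solvable_from P e M" "computable_from Q e' (\<lambda>b. e (x b))" "\<And>b. Q b \<Longrightarrow> P (x b)"
  shows "solvable_from Q e' (\<lambda>b. M (x b))"
proof -
  obtain g where g: "computable_from P e g" "\<And>a. P a \<Longrightarrow> g a \<in> M a"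
    using assms(1) unfolding solvable_from_def by blast
  have "computable_from Q (\<lambda>b. e (x b)) (\<lambda>b. g (x b))"
    by (rule computable_from_reparam[OF g(1), where \<phi> = x]) (simp_all add: assms(3))
  then show ?thesis
    by (rule solvable_fromI[OF computable_from_trans[OF assms(2)]]) (simp_all add: g assms(3))
qed

lemma number_from_transfer:
  assumes "number_from P e n" "computable_from Q e' (\<lambda>b. e (x b))" "\<And>b. Q b \<Longrightarrow> P (x b)"
  shows "number_from Q e' (\<lambda>b. n (x b))"
proof -
  have "computable_from Q (\<lambda>b. e (x b)) (\<lambda>b _. n (x b))"
    by (rule computable_from_reparam[OF assms(1)[unfolded number_from_def], where \<phi> = x])
      (simp_all add: assms(3))
  then show ?thesis unfolding number_from_def by (rule computable_from_trans[OF assms(2)])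
qed

lemma solvable_from_forall_along:
  fixes i :: "'b \<Rightarrow> 'i"
  assumes fa: "solvable_from P e (\<lambda>a. forall_along c I \<alpha> B D (\<alpha> (i a)))"
    and n: "number_from P e (\<lambda>a. c (i a))" and B: "solvable_from P e (\<lambda>a. B (i a))"
    and i: "\<And>a. P a \<Longrightarrow> i a \<in> I"
  shows "solvable_from P e (\<lambda>a. D (i a))"
proof -
  obtain h where h: "computable_from P e h" "\<And>a. P a \<Longrightarrow> h a \<in> forall_along c I \<alpha> B D (\<alpha> (i a))"
    using fa unfolding solvable_from_def by blast
  obtain g where g: "computable_from P e g" "\<And>a. P a \<Longrightarrow> g a \<in> B (i a)"
    using B unfolding solvable_from_def by blast
  show ?thesis
    by (rule solvable_from_apply[OF h(1) n g(1)]) (use h(2) g(2) i in \<open>auto simp: forall_along_def\<close>)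
qed

text \<open>The assumption ranges over the contexts that extend the given one by a point over
  \<open>j\<close> and a solution of its bound; \<open>x\<close> sends an extended parameter to the
  old one. In the generic extension the added data are joined to the old oracle, and abstracting
  them yields the associate.\<close>

lemma solvable_from_forall_alongI:
  fixes j :: "'a \<Rightarrow> 'j" and \<alpha> :: "'i \<Rightarrow> 'j"
  assumes "\<And>Q e' (x :: 'a \<times> 'i \<times> (nat \<Rightarrow> nat) \<Rightarrow> 'a) i.
    \<lbrakk>computable_from Q e' (\<lambda>b. e (x b)); number_from Q e' (\<lambda>b. c (i b));
      solvable_from Q e' (\<lambda>b. B (i b)); \<And>b. Q b \<Longrightarrow> P (x b); \<And>b. Q b \<Longrightarrow> i b \<in> I;
      \<And>b. Q b \<Longrightarrow> \<alpha> (i b) = j (x b)\<rbrakk> \<Longrightarrow> solvable_from Q e' (\<lambda>b. D (i b))"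
  shows "solvable_from P e (\<lambda>a. forall_along c I \<alpha> B D (j a))"
proof -
  let ?Q = "\<lambda>(x, i, g). P x \<and> i \<in> I \<and> \<alpha> i = j x \<and> g \<in> B i"
  let ?g = "\<lambda>b. prepend (c (fst (snd b))) (snd (snd b))"
  note e = computable_from_fjoinD[OF computable_from_refl, of ?Q "\<lambda>b. e (fst b)" ?g]
  have "solvable_from ?Q (\<lambda>b. fjoin (e (fst b)) (?g b)) (\<lambda>b. D (fst (snd b)))"
  proof (rule assms)
    show "solvable_from ?Q (\<lambda>b. fjoin (e (fst b)) (?g b)) (\<lambda>b. B (fst (snd b)))"
      by (rule solvable_fromI[OF computable_from_prependD(2)[OF e(2)]]) auto
  qed (use e(1) computable_from_prependD(1)[OF e(2)] in auto)
  then obtain h where h: "computable_from P e h"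
    "\<And>b. ?Q b \<Longrightarrow> \<exists>r\<in>D (fst (snd b)). applies (h (fst b)) (?g b) r"
    by (rule solvable_from_abstract[where \<pi> = fst and \<gamma> = ?g and e = e and P = P]) blast
  show ?thesis
  proof (rule solvable_fromI[OF h(1)])
    fix x assume "P x"
    then show "h x \<in> forall_along c I \<alpha> B D (j x)"
      unfolding forall_along_def using h(2)[of "(x, _, _)"] by auto
  qed
qed

text \<open>Currying: from left to right the associate is applied to the code and the bound of the
  given point, from right to left both are abstracted.\<close>

lemma uniform_le_forall_along_iff:
  assumes \<alpha>: "code_computable c I (\<lambda>i. d (\<alpha> i))" "\<And>i. i \<in> I \<Longrightarrow> \<alpha> i \<in> J"
  shows "uniform_le d J (forall_along c I \<alpha> B D) W \<longleftrightarrow>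
    uniform_le c I D (\<lambda>i. mjoin (B i) (W (\<alpha> i)))"
proof
  assume le: "uniform_le d J (forall_along c I \<alpha> B D) W"
  show "uniform_le c I D (\<lambda>i. mjoin (B i) (W (\<alpha> i)))"
  proof (rule uniform_leI)
    fix P e and i :: "'a \<times> (nat \<Rightarrow> nat) \<Rightarrow> 'a"
    assume n: "number_from P e (\<lambda>x. c (i x))" and i: "\<And>x. P x \<Longrightarrow> i x \<in> I"
      and s: "solvable_from P e (\<lambda>x. mjoin (B (i x)) (W (\<alpha> (i x))))"
    have "solvable_from P e (\<lambda>x. forall_along c I \<alpha> B D (\<alpha> (i x)))"
      by (rule solvable_from_reduce[OF le number_from_code_computable[OF \<alpha>(1) n]
            solvable_from_mjoinD(2)[OF s]]) (use i \<alpha>(2) in auto)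
    then show "solvable_from P e (\<lambda>x. D (i x))"
      by (rule solvable_from_forall_along[where i = i, OF _ n solvable_from_mjoinD(1)[OF s] i])
  qed
next
  assume le: "uniform_le c I D (\<lambda>i. mjoin (B i) (W (\<alpha> i)))"
  show "uniform_le d J (forall_along c I \<alpha> B D) W"
  proof (rule uniform_leI)
    fix P e and j :: "'b \<times> (nat \<Rightarrow> nat) \<Rightarrow> 'b"
    assume W: "solvable_from P e (\<lambda>x. W (j x))"
    show "solvable_from P e (\<lambda>x. forall_along c I \<alpha> B D (j x))"
    proof (rule solvable_from_forall_alongI)
      fix Q e' and x :: "('b \<times> (nat \<Rightarrow> nat)) \<times> 'a \<times> (nat \<Rightarrow> nat) \<Rightarrow> 'b \<times> (nat \<Rightarrow> nat)" and i
      assume e': "computable_from Q e' (\<lambda>b. e (x b))" and n: "number_from Q e' (\<lambda>b. c (i b))"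
        and B: "solvable_from Q e' (\<lambda>b. B (i b))" and x: "\<And>b. Q b \<Longrightarrow> P (x b)"
        and i: "\<And>b. Q b \<Longrightarrow> i b \<in> I" "\<And>b. Q b \<Longrightarrow> \<alpha> (i b) = j (x b)"
      from W e' x have "solvable_from Q e' (\<lambda>b. W (j (x b)))" by (rule solvable_from_transfer)
      then have "solvable_from Q e' (\<lambda>b. W (\<alpha> (i b)))"
        by (rule solvable_from_mono) (simp_all add: i)
      from solvable_from_mjoin[OF B this] show "solvable_from Q e' (\<lambda>b. D (i b))"
        by (rule solvable_from_reduce[OF le n]) (rule i)
    qed
  qed
qed

section \<open>Existential quantification along a map\<close>

text \<open>The codes are shifted by \<open>Suc\<close> to keep the head \<open>0\<close> free for
  the solutions of \<open>A\<close>.\<close>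

definition exists_along ::
    "('i \<Rightarrow> nat) \<Rightarrow> 'i set \<Rightarrow> ('i \<Rightarrow> 'j) \<Rightarrow> mass_problem \<Rightarrow> ('i \<Rightarrow> mass_problem) \<Rightarrow> 'j \<Rightarrow> mass_problem" where
  "exists_along c I \<alpha> A D j =
     prepend 0 ` A \<union> (\<Union>i\<in>{i\<in>I. \<alpha> i = j}. prepend (Suc (c i)) ` D i)"

lemma solvable_from_exists_alongI:
  assumes n: "number_from P e (\<lambda>a. c (i a))" and s: "solvable_from P e (\<lambda>a. D (i a))"
    and i: "\<And>a. P a \<Longrightarrow> i a \<in> I" "\<And>a. P a \<Longrightarrow> \<alpha> (i a) = j a"
  shows "solvable_from P e (\<lambda>a. exists_along c I \<alpha> A D (j a))"
proof -
  have "number_from P e (\<lambda>a. Suc (c (i a)))"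
    by (intro number_fromI computable_at_Suc number_from_computable_at[OF n])
  from solvable_from_prepend[OF this s] show ?thesis
    unfolding exists_along_def by (rule solvable_from_mono) (use i in blast)+
qed

lemma solvable_from_exists_along_top:
  assumes "solvable_from P e (\<lambda>_. A)"
  shows "solvable_from P e (\<lambda>a. exists_along c I \<alpha> A D (j a))"
  using solvable_from_prepend[OF number_from_const assms, of 0] unfolding exists_along_def
  by (rule solvable_from_mono) blast+

lemma solvable_from_exists_along_cases:
  fixes j :: "'a \<Rightarrow> 'j" and \<alpha> :: "'i \<Rightarrow> 'j"
  assumes ex: "solvable_from P e (\<lambda>a. exists_along c I \<alpha> A D (j a))"
    and top: "\<And>Q. \<lbrakk>\<And>a. Q a \<Longrightarrow> P a; solvable_from Q e (\<lambda>_. A)\<rbrakk> \<Longrightarrow> solvable_from Q e M"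
    and witness: "\<And>Q (i :: 'a \<Rightarrow> 'i).
      \<lbrakk>\<And>a. Q a \<Longrightarrow> P a; number_from Q e (\<lambda>a. c (i a)); solvable_from Q e (\<lambda>a. D (i a));
        \<And>a. Q a \<Longrightarrow> i a \<in> I; \<And>a. Q a \<Longrightarrow> \<alpha> (i a) = j a\<rbrakk> \<Longrightarrow> solvable_from Q e M"
  shows "solvable_from P e M"
proof -
  obtain g where g: "computable_from P e g" "\<And>x. P x \<Longrightarrow> g x \<in> exists_along c I \<alpha> A D (j x)"
    using ex unfolding solvable_from_def by blast
  let ?P0 = "\<lambda>x. P x \<and> g x 0 = 0" and ?P1 = "\<lambda>x. P x \<and> g x 0 \<noteq> 0"
  have "solvable_from ?P0 e (\<lambda>_. A)"
    by (rule solvable_fromI[OF computable_from_mono[OF computable_from_tail[OF g(1)]]])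
      (use g(2) in \<open>fastforce simp: exists_along_def prepend_def\<close>)+
  then have 0: "solvable_from ?P0 e M"
    by (rule top[rotated]) simp
  have "\<exists>i\<in>I. \<alpha> i = j x \<and> c i = g x 0 - 1 \<and> (\<lambda>k. g x (Suc k)) \<in> D i" if "?P1 x" for x
  proof -
    from g(2)[of x] that obtain i f where "i \<in> I" "\<alpha> i = j x" "f \<in> D i" "g x = prepend (Suc (c i)) f"
      unfolding exists_along_def by (auto simp: prepend_def)
    then show ?thesis by (intro bexI[of _ i]) (simp_all add: prepend_def)
  qed
  \<comment> \<open>The oracle reveals only the code of a point. The point itself is picked by
    choice, which is harmless because parameters are never computed.\<close>
  then have "\<forall>x. \<exists>i. ?P1 x \<longrightarrow>
      i \<in> I \<and> \<alpha> i = j x \<and> c i = g x 0 - 1 \<and> (\<lambda>k. g x (Suc k)) \<in> D i" by blast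
  from choice[OF this] obtain i where i: "\<And>x. ?P1 x \<Longrightarrow> i x \<in> I" "\<And>x. ?P1 x \<Longrightarrow> \<alpha> (i x) = j x"
    "\<And>x. ?P1 x \<Longrightarrow> c (i x) = g x 0 - 1" "\<And>x. ?P1 x \<Longrightarrow> (\<lambda>k. g x (Suc k)) \<in> D (i x)"
    by blast
  have D: "solvable_from ?P1 e (\<lambda>x. D (i x))"
    by (rule solvable_fromI[OF computable_from_mono[OF computable_from_tail[OF g(1)]]])
      (use i(4) in auto)
  have "number_from ?P1 e (\<lambda>x. g x 0 - 1)"
    by (intro number_fromI computable_at_pred
        number_from_computable_at[OF number_from_mono[OF number_from_head[OF g(1)]]]) simp
  then have n: "number_from ?P1 e (\<lambda>x. c (i x))"
    unfolding number_from_def by (rule computable_from_reparam[where \<phi> = id]) (auto simp: i(3))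
  have "solvable_from ?P1 e M"
    by (rule witness[OF _ n D]) (use i(1,2) in simp_all)
  then show ?thesis
    by (rule solvable_from_if_zero[OF number_from_head[OF g(1)] 0])
qed

text \<open>The second conjunct accounts for the solutions of \<open>A\<close>. For \<open>W\<close>
  below \<open>A\<close> the equivalence is the adjunction.\<close>

lemma uniform_le_exists_along_iff:
  assumes \<alpha>: "code_computable c I (\<lambda>i. d (\<alpha> i))" "\<And>i. i \<in> I \<Longrightarrow> \<alpha> i \<in> J"
  shows "uniform_le d J W (exists_along c I \<alpha> A D) \<longleftrightarrow>
    uniform_le c I (\<lambda>i. W (\<alpha> i)) D \<and> uniform_le d J W (\<lambda>_. A)"
proof (intro iffI conjI)
  assume le: "uniform_le d J W (exists_along c I \<alpha> A D)"
  show "uniform_le c I (\<lambda>i. W (\<alpha> i)) D"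
  proof (rule uniform_leI)
    fix P e and i :: "'a \<times> (nat \<Rightarrow> nat) \<Rightarrow> 'a"
    assume n: "number_from P e (\<lambda>x. c (i x))" and i: "\<And>x. P x \<Longrightarrow> i x \<in> I"
      and s: "solvable_from P e (\<lambda>x. D (i x))"
    from n s i have "solvable_from P e (\<lambda>x. exists_along c I \<alpha> A D (\<alpha> (i x)))"
      by (rule solvable_from_exists_alongI) simp_all
    then show "solvable_from P e (\<lambda>x. W (\<alpha> (i x)))"
      by (intro solvable_from_reduce[OF le] number_from_code_computable[OF \<alpha>(1) n])
        (use i \<alpha>(2) in auto)
  qed
  show "uniform_le d J W (\<lambda>_. A)"
    by (rule uniform_leI) (intro solvable_from_reduce[OF le] solvable_from_exists_along_top)
next
  assume le: "uniform_le c I (\<lambda>i. W (\<alpha> i)) D \<and> uniform_le d J W (\<lambda>_. A)"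
  show "uniform_le d J W (exists_along c I \<alpha> A D)"
  proof (rule uniform_leI)
    fix P e and j :: "'b \<times> (nat \<Rightarrow> nat) \<Rightarrow> 'b"
    assume n: "number_from P e (\<lambda>x. d (j x))" and j: "\<And>x. P x \<Longrightarrow> j x \<in> J"
      and "solvable_from P e (\<lambda>x. exists_along c I \<alpha> A D (j x))"
    from this(3) show "solvable_from P e (\<lambda>x. W (j x))"
    proof (rule solvable_from_exists_along_cases)
      fix Q assume Q: "\<And>x. Q x \<Longrightarrow> P x" and A: "solvable_from Q e (\<lambda>_. A)"
      show "solvable_from Q e (\<lambda>x. W (j x))"
        by (rule solvable_from_reduce[OF conjunct2[OF le] number_from_mono[OF n] A]) (simp_all add: Q j)
    next
      fix Q i assume c: "number_from Q e (\<lambda>x. c (i x))" and D: "solvable_from Q e (\<lambda>x. D (i x))"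
        and i: "\<And>x. Q x \<Longrightarrow> i x \<in> I" "\<And>x. Q x \<Longrightarrow> \<alpha> (i x) = j x"
      have "solvable_from Q e (\<lambda>x. W (\<alpha> (i x)))"
        by (rule solvable_from_reduce[OF conjunct1[OF le] c D]) (rule i)
      then show "solvable_from Q e (\<lambda>x. W (j x))"
        by (rule solvable_from_mono) (simp_all add: i)
    qed
  qed
qed

section \<open>Implication and tuples\<close>

text \<open>Families are only preordered, and an equation between degrees is a pair of inequalities.
  The laws that substitution needs are derived here from the adjunctions, without reference to
  computations.\<close>

locale brouwer_preorder =
  fixes le :: "'a \<Rightarrow> 'a \<Rightarrow> bool" (infix \<open>\<preceq>\<close> 50)
    and J M I :: "'a \<Rightarrow> 'a \<Rightarrow> 'a"
  assumes refl: "x \<preceq> x"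
    and trans: "x \<preceq> y \<Longrightarrow> y \<preceq> z \<Longrightarrow> x \<preceq> z"
    and join_iff: "J x y \<preceq> z \<longleftrightarrow> x \<preceq> z \<and> y \<preceq> z"
    and meet_iff: "z \<preceq> M x y \<longleftrightarrow> z \<preceq> x \<and> z \<preceq> y"
    and imp_iff: "I x z \<preceq> y \<longleftrightarrow> z \<preceq> J x y"
begin

lemma join_upper: "x \<preceq> J x y" "y \<preceq> J x y"
  using refl[of "J x y"] unfolding join_iff by simp_all

lemma meet_lower: "M x y \<preceq> x" "M x y \<preceq> y"
  using refl[of "M x y"] unfolding meet_iff by simp_all

lemma joinI1: "x \<preceq> y \<Longrightarrow> x \<preceq> J y z" and joinI2: "x \<preceq> z \<Longrightarrow> x \<preceq> J y z"
  using join_upper trans by blast+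

lemma meetI1: "x \<preceq> z \<Longrightarrow> M x y \<preceq> z"
  using meet_lower trans by blast

lemma join_mono: "x \<preceq> x' \<Longrightarrow> y \<preceq> y' \<Longrightarrow> J x y \<preceq> J x' y'"
  unfolding join_iff using joinI1 joinI2 by blast

lemma join_commute: "z \<preceq> J x y \<Longrightarrow> z \<preceq> J y x"
  by (meson join_iff join_upper trans)

lemma meet_join_distrib:
  "J (M x y) z \<preceq> M (J x z) (J y z)" "M (J x z) (J y z) \<preceq> J (M x y) z"
proof -
  show "J (M x y) z \<preceq> M (J x z) (J y z)"
    unfolding join_iff meet_iff using join_upper joinI1 meet_lower by blast
  \<comment> \<open>Distributivity comes from residuation: \<open>z\<close> is moved to the other
    side, where the meet can be split.\<close>
  have "I z (M (J x z) (J y z)) \<preceq> M x y"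
    unfolding meet_iff imp_iff by (meson join_commute meet_lower trans refl join_iff)
  then show "M (J x z) (J y z) \<preceq> J (M x y) z"
    unfolding imp_iff by (rule join_commute)
qed

lemma interval_imp_iff: "b \<preceq> y \<Longrightarrow> J (I x z) b \<preceq> y \<longleftrightarrow> z \<preceq> J x y"
  unfolding join_iff imp_iff by blast

text \<open>Preservation of implications under substitution: \<open>b'\<close> stands for the pulled
  back bound of the codomain and \<open>b\<close> for the bound of the domain. One side is joined
  with \<open>b\<close> after the implication is formed, the other is the implication between joined
  elements.\<close>

lemma interval_imp_join:
  assumes "b' \<preceq> b"
  shows "J (J (I x y) b') b \<preceq> J (I (J x b) (J y b)) b" (is "_ \<preceq> ?R")
    and "J (I (J x b) (J y b)) b \<preceq> J (J (I x y) b') b" (is "_ \<preceq> ?L")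
proof -
  have b: "b \<preceq> ?R" "b \<preceq> ?L" by (rule join_upper)+
  have "J y b \<preceq> J (J x b) ?R" using imp_iff join_upper by blast
  moreover have "J (J x b) ?R \<preceq> J x ?R"
    unfolding join_iff using b joinI2 join_upper by blast
  ultimately have "y \<preceq> J x ?R" using join_iff trans by blast
  then have "I x y \<preceq> ?R" unfolding imp_iff .
  then show "J (J (I x y) b') b \<preceq> ?R"
    using assms b trans unfolding join_iff by blast
  have "I x y \<preceq> ?L" using join_upper joinI1 by blast
  then have "y \<preceq> J x ?L" unfolding imp_iff .
  then have "J y b \<preceq> J (J x b) ?L"
    unfolding join_iff using b joinI2 join_mono join_upper refl trans by meson
  then show "J (I (J x b) (J y b)) b \<preceq> ?L"
    using b unfolding join_iff imp_iff by blast
qed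

end

definition mimp :: "mass_problem \<Rightarrow> mass_problem \<Rightarrow> mass_problem" where
  "mimp C D = {h. \<forall>g\<in>C. \<exists>r\<in>D. applies h g r}"

lemma uniform_le_mimp_iff:
  "uniform_le c I (\<lambda>i. mimp (C i) (D i)) W \<longleftrightarrow> uniform_le c I D (\<lambda>i. mjoin (C i) (W i))"
proof
  assume le: "uniform_le c I (\<lambda>i. mimp (C i) (D i)) W"
  show "uniform_le c I D (\<lambda>i. mjoin (C i) (W i))"
  proof (rule uniform_leI)
    fix P e and i :: "'a \<times> (nat \<Rightarrow> nat) \<Rightarrow> 'a"
    assume n: "number_from P e (\<lambda>x. c (i x))" and i: "\<And>x. P x \<Longrightarrow> i x \<in> I"
      and s: "solvable_from P e (\<lambda>x. mjoin (C (i x)) (W (i x)))"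
    have "solvable_from P e (\<lambda>x. mimp (C (i x)) (D (i x)))"
      by (rule solvable_from_reduce[OF le n solvable_from_mjoinD(2)[OF s]]) (rule i)
    then obtain h where h: "computable_from P e h" "\<And>x. P x \<Longrightarrow> h x \<in> mimp (C (i x)) (D (i x))"
      unfolding solvable_from_def by blast
    obtain g where g: "computable_from P e g" "\<And>x. P x \<Longrightarrow> g x \<in> C (i x)"
      using solvable_from_mjoinD(1)[OF s] unfolding solvable_from_def by blast
    have "\<forall>x. \<exists>r. P x \<longrightarrow> r \<in> D (i x) \<and> applies (h x) (g x) r"
      using h(2) g(2) unfolding mimp_def by blast
    from choice[OF this] obtain r where r: "\<And>x. P x \<Longrightarrow> r x \<in> D (i x)"
      "\<And>x. P x \<Longrightarrow> applies (h x) (g x) (r x)" by blast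
    show "solvable_from P e (\<lambda>x. D (i x))"
      by (rule solvable_fromI[OF computable_from_applies[OF h(1) g(1) r(2)] r(1)])
  qed
next
  assume le: "uniform_le c I D (\<lambda>i. mjoin (C i) (W i))"
  show "uniform_le c I (\<lambda>i. mimp (C i) (D i)) W"
  proof (rule uniform_leI)
    fix P e and i :: "'a \<times> (nat \<Rightarrow> nat) \<Rightarrow> 'a"
    assume n: "number_from P e (\<lambda>x. c (i x))" and i: "\<And>x. P x \<Longrightarrow> i x \<in> I"
      and W: "solvable_from P e (\<lambda>x. W (i x))"
    let ?Q = "\<lambda>b. P (fst b) \<and> snd b \<in> C (i (fst b))"
    let ?e = "\<lambda>b. fjoin (e (fst b)) (snd b)"
    note e = computable_from_fjoinD[OF computable_from_refl, of ?Q "\<lambda>b. e (fst b)" snd]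
    have W: "solvable_from ?Q ?e (\<lambda>b. W (i (fst b)))"
      by (rule solvable_from_transfer[OF W e(1)]) simp
    have "number_from ?Q ?e (\<lambda>b. c (i (fst b)))"
      by (rule number_from_transfer[OF n e(1)]) simp
    moreover have "solvable_from ?Q ?e (\<lambda>b. C (i (fst b)))"
      by (rule solvable_fromI[OF e(2)]) auto
    ultimately have "solvable_from ?Q ?e (\<lambda>b. D (i (fst b)))"
      using W i by (intro solvable_from_reduce[OF le] solvable_from_mjoin) auto
    then obtain h where h: "computable_from P e h" "\<And>b. ?Q b \<Longrightarrow>
        \<exists>r\<in>D (i (fst b)). applies (h (fst b)) (snd b) r"
      by (rule solvable_from_abstract[where \<pi> = fst and \<gamma> = snd and e = e and P = P]) blast
    show "solvable_from P e (\<lambda>x. mimp (C (i x)) (D (i x)))"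
    proof (rule solvable_fromI[OF h(1)])
      fix x assume "P x"
      then show "h x \<in> mimp (C (i x)) (D (i x))"
        unfolding mimp_def using h(2)[of "(x, _)"] by auto
    qed
  qed
qed

global_interpretation uniform: brouwer_preorder "uniform_le c I" "\<lambda>C D i. mjoin (C i) (D i)"
  "\<lambda>C D i. mmeet (C i) (D i)" "\<lambda>C D i. mimp (C i) (D i)" for c :: "'i \<Rightarrow> nat" and I
  by unfold_locales
    (simp_all add: uniform_le_refl uniform_le_mjoin_iff uniform_le_mmeet_iff uniform_le_mimp_iff,
      rule uniform_le_trans)

section \<open>Tuples and their bounds\<close>

text \<open>The code does not record the length and its last entry is stored bare, so only
  \<open>n\<close> tells whether a part of it is an entry or a pair. There is one program for each
  fixed \<open>n\<close> and \<open>j\<close>.\<close>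

lemma computable_at_nth:
  assumes "computable_at P r i (\<lambda>a. tuple_code (xs a))" "\<And>a. P a \<Longrightarrow> length (xs a) = n" "j < n"
  shows "computable_at P r i (\<lambda>a. xs a ! j)"
  using assms
proof (induction n arbitrary: xs j)
  case (Suc m)
  show ?case
  proof (cases m)
    case 0
    have "tuple_code (xs a) = xs a ! j" if "P a" for a
      using Suc.prems(2)[OF that] Suc.prems(3) 0 by (cases "xs a") auto
    then show ?thesis by (intro computable_at_cong[OF Suc.prems(1)]) simp
  next
    case (Suc k)
    have xs: "tuple_code (xs a) = prod_encode (xs a ! 0, tuple_code (tl (xs a)))" if "P a" for a
      using Suc.prems(2)[OF that] Suc by (cases "xs a" rule: tuple_code.cases) auto
    show ?thesis
    proof (cases j)
      case 0
      show ?thesis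
        by (rule computable_at_cong[OF computable_at_fst[OF Suc.prems(1)]]) (simp add: xs 0)
    next
      case (Suc l)
      have "computable_at P r i (\<lambda>a. tuple_code (tl (xs a)))"
        by (rule computable_at_cong[OF computable_at_snd[OF Suc.prems(1)]]) (simp add: xs)
      from Suc.IH[OF this, of l] have "computable_at P r i (\<lambda>a. tl (xs a) ! l)"
        using Suc.prems(2,3) \<open>j = Suc l\<close> by simp
      then show ?thesis
        by (rule computable_at_cong) (use Suc.prems(2,3) \<open>j = Suc l\<close> in \<open>simp add: nth_tl\<close>)
    qed
  qed
qed simp

lemma computable_at_tuple_code:
  assumes "\<And>a. P a \<Longrightarrow> length (xs a) = n" "\<And>j. j < n \<Longrightarrow> computable_at P r i (\<lambda>a. xs a ! j)"
  shows "computable_at P r i (\<lambda>a. tuple_code (xs a))"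
  using assms
proof (induction n arbitrary: xs)
  case 0
  then show ?case by (intro computable_at_cong[OF computable_at_const[of P r i 0]]) simp
next
  case (Suc m)
  show ?case
  proof (cases m)
    case 0
    have "tuple_code (xs a) = xs a ! 0" if "P a" for a
      using Suc.prems(1)[OF that] 0 by (cases "xs a") auto
    then show ?thesis by (intro computable_at_cong[OF Suc.prems(2)[of 0]]) simp_all
  next
    case (Suc k)
    have xs: "tuple_code (xs a) = prod_encode (xs a ! 0, tuple_code (tl (xs a)))" if "P a" for a
      using Suc.prems(1)[OF that] Suc by (cases "xs a" rule: tuple_code.cases) auto
    have "computable_at P r i (\<lambda>a. tuple_code (tl (xs a)))"
    proof (rule Suc.IH)
      fix j assume "j < m"
      then have "computable_at P r i (\<lambda>a. xs a ! Suc j)" by (intro Suc.prems(2)) simp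
      then show "computable_at P r i (\<lambda>a. tl (xs a) ! j)"
        by (rule computable_at_cong) (use Suc.prems(1) \<open>j < m\<close> in \<open>simp add: nth_tl\<close>)
    qed (simp add: Suc.prems(1))
    then have "computable_at P r i (\<lambda>a. prod_encode (xs a ! 0, tuple_code (tl (xs a))))"
      by (intro computable_at_pair Suc.prems(2)) simp
    then show ?thesis by (rule computable_at_cong) (simp add: xs)
  qed
qed

lemma tuple_code_inject:
  "length xs = length ys \<Longrightarrow> tuple_code xs = tuple_code ys \<Longrightarrow> xs = ys"
proof (induction xs arbitrary: ys rule: tuple_code.induct)
  case (3 a b xs)
  then obtain c d zs where "ys = c # d # zs" by (metis length_Suc_conv)
  with "3.IH"[of "d # zs"] "3.prems" show ?case by simp
next
  case (2 a)
  then obtain c where "ys = [c]" by (metis length_0_conv length_Suc_conv)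
  with 2 show ?case by simp
qed simp

lemma tuple_code_surj: "\<exists>xs. length xs = Suc n \<and> tuple_code xs = k"
proof (induction n arbitrary: k)
  case 0
  show ?case by (rule exI[of _ "[k]"]) simp
next
  case (Suc n)
  obtain xs where xs: "length xs = Suc n" "tuple_code xs = snd (prod_decode k)"
    using Suc by blast
  then obtain b ys where "xs = b # ys" by (metis length_Suc_conv)
  with xs show ?case by (intro exI[of _ "fst (prod_decode k) # xs"]) simp
qed

lemma inj_on_tuple_code: "inj_on tuple_code (tuples S n)"
  by (auto simp: tuples_def intro!: inj_onI tuple_code_inject)

lemma bij_betw_tuple_code:
  assumes "n \<noteq> 0" shows "bij_betw tuple_code (tuples UNIV n) UNIV"
proof -
  have "k \<in> tuple_code ` tuples UNIV n" for k
    using tuple_code_surj[of "n - 1" k] assms by (auto simp: tuples_def image_iff)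
  then show ?thesis unfolding bij_betw_def using inj_on_tuple_code by blast
qed

lemma solvable_from_nth:
  assumes "solvable_from P e (\<lambda>a. tuple_bound B (xs a))" "\<And>a. P a \<Longrightarrow> length (xs a) = n" "j < n"
  shows "solvable_from P e (\<lambda>a. B (int (xs a ! j)))"
  using assms
proof (induction n arbitrary: xs j)
  case (Suc m)
  show ?case
  proof (cases m)
    case 0
    have "tuple_bound B (xs a) = B (int (xs a ! j))" if "P a" for a
      using Suc.prems(2)[OF that] Suc.prems(3) 0 by (cases "xs a") auto
    then show ?thesis using solvable_from_mono[OF Suc.prems(1)] by simp
  next
    case (Suc k)
    have xs: "tuple_bound B (xs a) = mjoin (B (int (xs a ! 0))) (tuple_bound B (tl (xs a)))" if "P a" for a
      using Suc.prems(2)[OF that] Suc by (cases "xs a" rule: tuple_code.cases) auto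
    have "solvable_from P e (\<lambda>a. mjoin (B (int (xs a ! 0))) (tuple_bound B (tl (xs a))))"
      by (rule solvable_from_mono[OF Suc.prems(1)]) (simp_all add: xs)
    note * = solvable_from_mjoinD[OF this]
    show ?thesis
    proof (cases j)
      case (Suc l)
      from Suc.IH[OF *(2), of l] have "solvable_from P e (\<lambda>a. B (int (tl (xs a) ! l)))"
        using Suc.prems(2,3) \<open>j = Suc l\<close> by simp
      then show ?thesis
        by (rule solvable_from_mono) (use Suc.prems(2,3) \<open>j = Suc l\<close> in \<open>simp_all add: nth_tl\<close>)
    qed (use *(1) in simp)
  qed
qed simp

text \<open>The problem \<open>B (-1)\<close> is the bound of the empty tuple and serves the case
  \<open>n = 0\<close>; a longer tuple gets its bound from its entries.\<close>

lemma solvable_from_tuple_bound: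
  assumes "\<And>a. P a \<Longrightarrow> length (xs a) = n" "solvable_from P e (\<lambda>_. B (-1))"
    "\<And>j. j < n \<Longrightarrow> solvable_from P e (\<lambda>a. B (int (xs a ! j)))"
  shows "solvable_from P e (\<lambda>a. tuple_bound B (xs a))"
  using assms(1,3)
proof (induction n arbitrary: xs)
  case 0
  then show ?case by (intro solvable_from_mono[OF assms(2)]) simp_all
next
  case (Suc m)
  show ?case
  proof (cases m)
    case 0
    have "tuple_bound B (xs a) = B (int (xs a ! 0))" if "P a" for a
      using Suc.prems(1)[OF that] 0 by (cases "xs a") auto
    then show ?thesis by (intro solvable_from_mono[OF Suc.prems(2)[of 0]]) simp_all
  next
    case (Suc k)
    have xs: "tuple_bound B (xs a) = mjoin (B (int (xs a ! 0))) (tuple_bound B (tl (xs a)))" if "P a" for a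
      using Suc.prems(1)[OF that] Suc by (cases "xs a" rule: tuple_code.cases) auto
    have "solvable_from P e (\<lambda>a. tuple_bound B (tl (xs a)))"
    proof (rule Suc.IH)
      fix j assume "j < m"
      then have "solvable_from P e (\<lambda>a. B (int (xs a ! Suc j)))" by (intro Suc.prems(2)) simp
      then show "solvable_from P e (\<lambda>a. B (int (tl (xs a) ! j)))"
        by (rule solvable_from_mono) (use Suc.prems(1) \<open>j < m\<close> in \<open>simp_all add: nth_tl\<close>)
    qed (simp add: Suc.prems(1))
    then have "solvable_from P e (\<lambda>a. mjoin (B (int (xs a ! 0))) (tuple_bound B (tl (xs a))))"
      by (intro solvable_from_mjoin Suc.prems(2)) simp
    then show ?thesis by (rule solvable_from_mono) (simp_all add: xs)
  qed
qed

lemma base_objects_iff: "Y \<in> base_objects \<longleftrightarrow> (\<exists>S n. Y = tuples S n \<and> (S = UNIV \<or> (\<exists>m. S = {1..m})))"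
proof
  assume "\<exists>S n. Y = tuples S n \<and> (S = UNIV \<or> (\<exists>m. S = {1..m}))"
  then obtain S n where Y: "Y = tuples S n" and S: "S = UNIV \<or> (\<exists>m. S = {1..m})" by blast
  show "Y \<in> base_objects"
  proof (cases "n = 0")
    case True
    \<comment> \<open>The exponent \<open>0\<close> gives the one-point object for every
      \<open>S\<close>; it is listed among the finite objects.\<close>
    then have "Y = tuples {1..0} 0" unfolding Y tuples_def by auto
    then show ?thesis unfolding base_objects_def by blast
  next
    case False
    then have "1 \<le> n" by simp
    then show ?thesis using S unfolding Y base_objects_def by blast
  qed
qed (auto simp: base_objects_def)

lemma base_objects_cases:
  assumes "Y \<in> base_objects"
  obtains "finite Y" "inj_on tuple_code Y" | "infinite Y" "bij_betw tuple_code Y UNIV"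
proof -
  obtain S n where Y: "Y = tuples S n" and S: "S = UNIV \<or> (\<exists>m. S = {1..m})"
    using assms base_objects_iff by blast
  have fin: "finite (tuples S n)" if "finite S" for S :: "nat set"
    using finite_lists_length_eq[OF that, of n] unfolding tuples_def
    by (rule rev_finite_subset) auto
  show thesis
  proof (cases "finite Y")
    case True
    then show thesis using that(1) inj_on_tuple_code unfolding Y by blast
  next
    case False
    then have "S = UNIV" using S fin Y by blast
    moreover have "n \<noteq> 0" using False unfolding Y tuples_def by (cases n) auto
    ultimately show thesis using that(2)[OF False] bij_betw_tuple_code unfolding Y by blast
  qed
qed

text \<open>Over a finite object the finitely many reductions are combined into one. Over an
  infinite object \<open>tuple_code\<close> is a bijection onto the numbers, so quantifying over
  codes or over tuples is the same.\<close>

lemma family_le_iff: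
  assumes "Y \<in> base_objects"
  shows "family_le Y C D \<longleftrightarrow> uniform_le tuple_code Y C D"
  using assms
proof (cases rule: base_objects_cases)
  case 1
  then show ?thesis
    unfolding family_le_def
    by (auto intro: uniform_le_finite uniform_le_imp_medvedev_le)
next
  case 2
  let ?d = "the_inv_into Y tuple_code"
  have inj: "inj_on tuple_code Y" and im: "tuple_code ` Y = UNIV"
    using 2(2) unfolding bij_betw_def by blast+
  have *: "(\<forall>k. Q k (?d k)) \<longleftrightarrow> (\<forall>y\<in>Y. Q (tuple_code y) y)" for Q
  proof
    assume Q: "\<forall>k. Q k (?d k)"
    show "\<forall>y\<in>Y. Q (tuple_code y) y"
      using Q the_inv_into_f_f[OF inj] by metis
  next
    assume Q: "\<forall>y\<in>Y. Q (tuple_code y) y"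
    show "\<forall>k. Q k (?d k)"
    proof
      fix k
      have "k \<in> tuple_code ` Y" using im by simp
      then show "Q k (?d k)" using Q the_inv_into_f_f[OF inj] by fastforce
    qed
  qed
  show ?thesis
    unfolding family_le_def medvedev_omega_le_def uniform_le_def
    using 2(1) *[of "\<lambda>k y. reduces p (prepend k ` D y) (C y)" for p] by simp
qed

section \<open>The fibres\<close>

text \<open>The lattice operations are defined by choice; in a partial order least and greatest
  bounds are unique, so any such bound is their value.\<close>

lemma (in partial_order) join_equality: "least L s (Upper L {x, y}) \<Longrightarrow> x \<squnion> y = s"
  unfolding join_def sup_def by (blast intro: some_equality least_unique)

lemma (in partial_order) meet_equality: "greatest L s (Lower L {x, y}) \<Longrightarrow> x \<sqinter> y = s"
  unfolding meet_def inf_def by (blast intro: some_equality greatest_unique)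

lemma (in partial_order) bottom_equality: "least L s (carrier L) \<Longrightarrow> \<bottom> = s"
  unfolding bottom_def by (blast intro: some_equality least_unique)

lemma (in partial_order) top_equality: "greatest L s (carrier L) \<Longrightarrow> \<top> = s"
  unfolding top_def by (blast intro: some_equality greatest_unique)

text \<open>A program that works for all oracles becomes oracle-free when its oracle calls are
  answered by \<open>0\<close>.\<close>

lemma code_computable_tuple_code_iff:
  "computable_tuple_map Y \<alpha> \<longleftrightarrow> code_computable tuple_code Y (\<lambda>y. tuple_code (\<alpha> y))"
proof
  assume "code_computable tuple_code Y (\<lambda>y. tuple_code (\<alpha> y))"
  then obtain p where p: "\<And>y f. y \<in> Y \<Longrightarrow> run p f (tuple_code y) = Some (tuple_code (\<alpha> y))"
    unfolding code_computable_def computable_at_def by auto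
  have "run (substitute Zero p) f = run p (\<lambda>_. 0)" for f
    by (rule run_substitute) simp
  then show "computable_tuple_map Y \<alpha>"
    unfolding computable_tuple_map_def
    by (intro exI[of _ "substitute Zero p"]) (simp add: p oracle_free_substitute)
qed (auto simp: computable_tuple_map_def code_computable_def computable_at_def)

locale bounded_family =
  fixes A :: mass_problem and B :: "int \<Rightarrow> mass_problem"
  assumes family_le_top: "medvedev_omega_le (\<lambda>n. B (int n)) (\<lambda>n. A)"
    and bottom_le_family: "medvedev_omega_le (\<lambda>n. B (- 1)) (\<lambda>n. B (int n))"
begin

abbreviation le :: "nat list set \<Rightarrow> (nat list \<Rightarrow> mass_problem) \<Rightarrow> (nat list \<Rightarrow> mass_problem) \<Rightarrow> bool" where
  "le \<equiv> uniform_le tuple_code"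

abbreviation "bound \<equiv> tuple_bound B"
abbreviation "\<C> \<equiv> base_category B"
abbreviation "\<P> \<equiv> interval_fibre B A"
abbreviation "pull \<equiv> interval_pull B"
abbreviation "deg \<equiv> family_degree"

definition in_interval :: "nat list set \<Rightarrow> (nat list \<Rightarrow> mass_problem) \<Rightarrow> bool" where
  "in_interval Y C \<longleftrightarrow> le Y bound C \<and> le Y C (\<lambda>_. A)"

text \<open>The first entry of a nonempty tuple is read from the code and its problem is solved by a
  part of the bound; from there \<open>B (-1)\<close> is reached uniformly. For the empty tuple the
  bound is \<open>B (-1)\<close> itself.\<close>

lemma solvable_from_bottom:
  assumes "number_from P e (\<lambda>a. tuple_code (xs a))" "solvable_from P e (\<lambda>a. bound (xs a))"
    "\<And>a. P a \<Longrightarrow> length (xs a) = n"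
  shows "solvable_from P e (\<lambda>_. B (- 1))"
proof (cases "n = 0")
  case True
  then show ?thesis using assms(3) by (intro solvable_from_mono[OF assms(2)]) simp_all
next
  case False
  then have n: "0 < n" by simp
  have "number_from P e (\<lambda>a. xs a ! 0)"
    by (rule number_fromI[OF computable_at_nth[OF number_from_computable_at[OF assms(1)] assms(3) n]])
  from solvable_from_reduce[OF bottom_le_family[unfolded medvedev_omega_le_def] this
      solvable_from_nth[OF assms(2,3) n]]
  show ?thesis by simp
qed

lemma base_objectsE:
  assumes "Y \<in> base_objects"
  obtains S n where "Y = tuples S n" "\<And>k. tuples S k \<in> base_objects" "\<And>y. y \<in> Y \<Longrightarrow> length y = n"
proof -
  obtain S n where *: "Y = tuples S n" "S = UNIV \<or> (\<exists>m. S = {1..m})"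
    using assms base_objects_iff by blast
  show thesis by (rule that[OF *(1)]) (use * base_objects_iff tuples_def in auto)
qed

lemma bound_le_top:
  assumes "Y \<in> base_objects" shows "le Y bound (\<lambda>_. A)"
proof (rule uniform_leI)
  obtain n where n: "\<And>y. y \<in> Y \<Longrightarrow> length y = n" by (metis base_objectsE[OF assms])
  fix P e and i :: "nat list \<times> (nat \<Rightarrow> nat) \<Rightarrow> nat list"
  assume code: "number_from P e (\<lambda>x. tuple_code (i x))" and i: "\<And>x. P x \<Longrightarrow> i x \<in> Y"
    and A: "solvable_from P e (\<lambda>_. A)"
  note top = solvable_from_reduce[OF family_le_top[unfolded medvedev_omega_le_def] _ A]
  note len = n[OF i]
  \<comment> \<open>Some index is needed to get from \<open>A\<close> down to \<open>B (-1)\<close>,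
    even for the empty tuple, which has no entries; \<open>0\<close> serves.\<close>
  have "solvable_from P e (\<lambda>a. B (int 0))"
    by (rule top[OF number_from_const]) simp
  from solvable_from_reduce[OF bottom_le_family[unfolded medvedev_omega_le_def] number_from_const this]
  have bot: "solvable_from P e (\<lambda>_. B (- 1))" by simp
  show "solvable_from P e (\<lambda>x. bound (i x))"
  proof (rule solvable_from_tuple_bound[where P = P and B = B and xs = i and n = n, OF _ bot])
    fix j assume "j < n"
    from computable_at_nth[where xs = i, OF number_from_computable_at[OF code] len this]
    show "solvable_from P e (\<lambda>x. B (int (i x ! j)))"
      by (intro top number_fromI) simp_all
  qed (rule len)
qed

lemma degree_self: "C \<in> deg Y C"
proof -
  have "family_le Y C C"
    unfolding family_le_def medvedev_omega_le_def
    using uniform_le_refl uniform_le_imp_medvedev_le[OF uniform_le_refl UNIV_I, of _ "\<lambda>_. C y" for y]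
    by auto
  then show ?thesis by (simp add: family_degree_def)
qed

lemma mem_degree_iff: "Y \<in> base_objects \<Longrightarrow> D \<in> deg Y C \<longleftrightarrow> le Y C D \<and> le Y D C"
  by (simp add: family_degree_def family_le_iff)

lemma degree_eq_iff:
  assumes "Y \<in> base_objects" shows "deg Y C = deg Y D \<longleftrightarrow> le Y C D \<and> le Y D C"
  using mem_degree_iff[OF assms] degree_self[of D Y] degree_self[of C Y] uniform.trans
  by (metis (no_types, lifting) subsetI subset_antisym)

lemma carrier_fibre:
  "Y \<in> base_objects \<Longrightarrow> carrier (\<P> Y) = {deg Y C |C. in_interval Y C}"
  by (simp add: interval_fibre_def family_le_iff in_interval_def)

lemma le_fibre_iff:
  assumes "Y \<in> base_objects" shows "deg Y C \<sqsubseteq>\<^bsub>\<P> Y\<^esub> deg Y D \<longleftrightarrow> le Y C D"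
proof -
  have "deg Y C \<sqsubseteq>\<^bsub>\<P> Y\<^esub> deg Y D \<longleftrightarrow> (\<exists>C'\<in>deg Y C. \<exists>D'\<in>deg Y D. le Y C' D')"
    by (simp add: interval_fibre_def family_le_iff[OF assms])
  then show ?thesis
    using mem_degree_iff[OF assms] degree_self uniform.trans by meson
qed

lemma partial_order_fibre:
  assumes "Y \<in> base_objects" shows "partial_order (\<P> Y)"
proof -
  have eq: "(.=\<^bsub>\<P> Y\<^esub>) = (=)" by (simp add: interval_fibre_def)
  show ?thesis
    by unfold_locales
      (auto simp: eq carrier_fibre[OF assms] le_fibre_iff[OF assms]
        intro: uniform.refl uniform.trans intro!: degree_eq_iff[OF assms, THEN iffD2])
qed

lemma in_intervalI_bound: "Y \<in> base_objects \<Longrightarrow> in_interval Y bound"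
  and in_intervalI_top: "Y \<in> base_objects \<Longrightarrow> in_interval Y (\<lambda>_. A)"
  using bound_le_top uniform.refl unfolding in_interval_def by blast+

lemma in_interval_join:
  "le Y C (\<lambda>_. A) \<Longrightarrow> in_interval Y D \<Longrightarrow> in_interval Y (\<lambda>y. mjoin (C y) (D y))"
  unfolding in_interval_def uniform_le_mjoin_iff using uniform_le_mjoinI(2) by blast

lemma in_interval_meet:
  "in_interval Y C \<Longrightarrow> in_interval Y D \<Longrightarrow> in_interval Y (\<lambda>y. mmeet (C y) (D y))"
  unfolding in_interval_def uniform_le_mmeet_iff using uniform.meetI1 by blast

abbreviation "imp C D \<equiv> (\<lambda>y. mjoin (mimp (C y) (D y)) (bound y))"

lemma in_interval_imp:
  assumes "Y \<in> base_objects" "in_interval Y D"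
  shows "in_interval Y (imp C D)"
proof (rule in_interval_join[OF _ in_intervalI_bound[OF assms(1)]])
  show "le Y (\<lambda>y. mimp (C y) (D y)) (\<lambda>_. A)"
    unfolding uniform_le_mimp_iff
    by (rule uniform_le_mjoinI(2)) (use assms(2) in_interval_def in blast)
qed

section \<open>The operations of a fixed fibre\<close>

context
  fixes Y assumes Y: "Y \<in> base_objects"
begin

interpretation partial_order "\<P> Y" by (rule partial_order_fibre[OF Y])

lemma least_bound: "least (\<P> Y) (deg Y bound) (carrier (\<P> Y))"
  using in_intervalI_bound[OF Y]
  by (auto simp: least_def carrier_fibre[OF Y] le_fibre_iff[OF Y]) (simp add: in_interval_def)

lemma greatest_top: "greatest (\<P> Y) (deg Y (\<lambda>_. A)) (carrier (\<P> Y))"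
  using in_intervalI_top[OF Y]
  by (auto simp: greatest_def carrier_fibre[OF Y] le_fibre_iff[OF Y]) (simp add: in_interval_def)

lemma least_join:
  assumes "in_interval Y C" "in_interval Y D"
  shows "least (\<P> Y) (deg Y (\<lambda>y. mjoin (C y) (D y))) (Upper (\<P> Y) {deg Y C, deg Y D})"
proof (rule least_UpperI)
  have J: "in_interval Y (\<lambda>y. mjoin (C y) (D y))"
    using in_interval_join[OF _ assms(2)] assms(1) unfolding in_interval_def by blast
  then show "deg Y (\<lambda>y. mjoin (C y) (D y)) \<in> carrier (\<P> Y)"
    and sub: "{deg Y C, deg Y D} \<subseteq> carrier (\<P> Y)"
    using assms carrier_fibre[OF Y] by blast+
  show "x \<sqsubseteq>\<^bsub>\<P> Y\<^esub> deg Y (\<lambda>y. mjoin (C y) (D y))" if "x \<in> {deg Y C, deg Y D}" for x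
    using that by (elim insertE emptyE) (simp_all only: le_fibre_iff[OF Y] uniform.join_upper)
  show "deg Y (\<lambda>y. mjoin (C y) (D y)) \<sqsubseteq>\<^bsub>\<P> Y\<^esub> x" if "x \<in> Upper (\<P> Y) {deg Y C, deg Y D}" for x
  proof -
    have "x \<in> carrier (\<P> Y)" using that by (rule Upper_closed[THEN subsetD])
    then obtain E where E: "x = deg Y E" using carrier_fibre[OF Y] by blast
    have "deg Y C \<sqsubseteq>\<^bsub>\<P> Y\<^esub> x" "deg Y D \<sqsubseteq>\<^bsub>\<P> Y\<^esub> x"
      using Upper_memD[OF that _ sub] by simp_all
    then show ?thesis unfolding E le_fibre_iff[OF Y] uniform_le_mjoin_iff by blast
  qed
qed

lemma greatest_meet:
  assumes "in_interval Y C" "in_interval Y D"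
  shows "greatest (\<P> Y) (deg Y (\<lambda>y. mmeet (C y) (D y))) (Lower (\<P> Y) {deg Y C, deg Y D})"
proof (rule greatest_LowerI)
  show "deg Y (\<lambda>y. mmeet (C y) (D y)) \<in> carrier (\<P> Y)"
    and sub: "{deg Y C, deg Y D} \<subseteq> carrier (\<P> Y)"
    using assms in_interval_meet[OF assms] carrier_fibre[OF Y] by blast+
  show "deg Y (\<lambda>y. mmeet (C y) (D y)) \<sqsubseteq>\<^bsub>\<P> Y\<^esub> x" if "x \<in> {deg Y C, deg Y D}" for x
    using that by (elim insertE emptyE) (simp_all only: le_fibre_iff[OF Y] uniform.meet_lower)
  show "x \<sqsubseteq>\<^bsub>\<P> Y\<^esub> deg Y (\<lambda>y. mmeet (C y) (D y))" if "x \<in> Lower (\<P> Y) {deg Y C, deg Y D}" for x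
  proof -
    have "x \<in> carrier (\<P> Y)" using that by (rule Lower_closed[THEN subsetD])
    then obtain E where E: "x = deg Y E" using carrier_fibre[OF Y] by blast
    have "x \<sqsubseteq>\<^bsub>\<P> Y\<^esub> deg Y C" "x \<sqsubseteq>\<^bsub>\<P> Y\<^esub> deg Y D"
      using Lower_memD[OF that _ sub] by simp_all
    then show ?thesis unfolding E le_fibre_iff[OF Y] uniform_le_mmeet_iff by blast
  qed
qed

lemmas bottom_fibre = bottom_equality[OF least_bound]
lemmas top_fibre = top_equality[OF greatest_top]
lemmas join_fibre = join_equality[OF least_join]
lemmas meet_fibre = meet_equality[OF greatest_meet]

lemma imp_fibre:
  assumes "in_interval Y C" "in_interval Y D" "in_interval Y W"
  shows "deg Y D \<sqsubseteq>\<^bsub>\<P> Y\<^esub> deg Y C \<squnion>\<^bsub>\<P> Y\<^esub> deg Y W \<longleftrightarrow> deg Y (imp C D) \<sqsubseteq>\<^bsub>\<P> Y\<^esub> deg Y W"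
  using uniform.interval_imp_iff[of tuple_code Y bound W C D] assms
  by (simp add: join_fibre le_fibre_iff[OF Y] in_interval_def)

lemma imp_fibre_adjoint:
  assumes "in_interval Y C" "in_interval Y D" "y \<in> carrier (\<P> Y)"
  shows "deg Y D \<sqsubseteq>\<^bsub>\<P> Y\<^esub> deg Y C \<squnion>\<^bsub>\<P> Y\<^esub> y \<longleftrightarrow> deg Y (imp C D) \<sqsubseteq>\<^bsub>\<P> Y\<^esub> y"
proof -
  obtain W where "y = deg Y W" "in_interval Y W"
    using assms(3) carrier_fibre[OF Y] by blast
  then show ?thesis using imp_fibre[OF assms(1,2)] by blast
qed

lemma imp_in_carrier: "in_interval Y D \<Longrightarrow> deg Y (imp C D) \<in> carrier (\<P> Y)"
  using in_interval_imp[OF Y] carrier_fibre[OF Y] by blast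

lemma implication_fibre:
  assumes "in_interval Y C" "in_interval Y D"
  shows "implication (\<P> Y) (deg Y C) (deg Y D) = deg Y (imp C D)"
  unfolding implication_def
proof (rule the_equality)
  note mem = imp_in_carrier[OF assms(2), of C]
  show "deg Y (imp C D) \<in> carrier (\<P> Y) \<and> (\<forall>y\<in>carrier (\<P> Y).
      deg Y D \<sqsubseteq>\<^bsub>\<P> Y\<^esub> deg Y C \<squnion>\<^bsub>\<P> Y\<^esub> y \<longleftrightarrow> deg Y (imp C D) \<sqsubseteq>\<^bsub>\<P> Y\<^esub> y)"
    using mem imp_fibre_adjoint[OF assms] by blast
  fix w assume w: "w \<in> carrier (\<P> Y) \<and> (\<forall>y\<in>carrier (\<P> Y).
      deg Y D \<sqsubseteq>\<^bsub>\<P> Y\<^esub> deg Y C \<squnion>\<^bsub>\<P> Y\<^esub> y \<longleftrightarrow> w \<sqsubseteq>\<^bsub>\<P> Y\<^esub> y)"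
  then have "w \<sqsubseteq>\<^bsub>\<P> Y\<^esub> deg Y (imp C D)"
    using imp_fibre_adjoint[OF assms mem] le_refl[OF mem] mem by blast
  moreover have "deg Y (imp C D) \<sqsubseteq>\<^bsub>\<P> Y\<^esub> w"
    using imp_fibre_adjoint[OF assms, of w] w le_refl[of w] by blast
  ultimately have "w .=\<^bsub>\<P> Y\<^esub> deg Y (imp C D)"
    using w mem by (intro weak_le_antisym) simp_all
  then show "w = deg Y (imp C D)" unfolding eq_is_equal .
qed

lemma brouwer_algebra_fibre: "brouwer_algebra (\<P> Y)"
proof unfold_locales
  fix x z assume "x \<in> carrier (\<P> Y)" "z \<in> carrier (\<P> Y)"
  then obtain C D where CD: "x = deg Y C" "in_interval Y C" "z = deg Y D" "in_interval Y D"
    unfolding carrier_fibre[OF Y] by blast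
  show "\<exists>s. least (\<P> Y) s (Upper (\<P> Y) {x, z})"
    using least_join[OF CD(2,4)] unfolding CD by blast
  show "\<exists>s. greatest (\<P> Y) s (Lower (\<P> Y) {x, z})"
    using greatest_meet[OF CD(2,4)] unfolding CD by blast
  show "\<exists>w\<in>carrier (\<P> Y). \<forall>y\<in>carrier (\<P> Y). z \<sqsubseteq>\<^bsub>\<P> Y\<^esub> x \<squnion>\<^bsub>\<P> Y\<^esub> y \<longleftrightarrow> w \<sqsubseteq>\<^bsub>\<P> Y\<^esub> y"
    unfolding CD
    by (rule bexI[OF _ imp_in_carrier[OF CD(4)]], rule ballI, rule imp_fibre_adjoint[OF CD(2,4)])
next
  show "\<exists>s. least (\<P> Y) s (carrier (\<P> Y))" by (rule exI, rule least_bound)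
  show "\<exists>s. greatest (\<P> Y) s (carrier (\<P> Y))" by (rule exI, rule greatest_top)
qed

end

end

section \<open>The base category and the adjoints\<close>

lemma code_computable_comp:
  assumes "code_computable c X (\<lambda>x. d (\<alpha> x))" "code_computable d Y n" "\<And>x. x \<in> X \<Longrightarrow> \<alpha> x \<in> Y"
  shows "code_computable c X (\<lambda>x. n (\<alpha> x))"
  unfolding code_computable_def
proof (rule computable_at_trans[OF assms(1)[unfolded code_computable_def]])
  show "computable_at (\<lambda>x. fst x \<in> X) snd (\<lambda>x. d (\<alpha> (fst x))) (\<lambda>x. n (\<alpha> (fst x)))"
    by (rule computable_at_reparam[OF assms(2)[unfolded code_computable_def],
          where \<phi> = "\<lambda>x. (\<alpha> (fst x), snd x)"]) (simp_all add: assms(3))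
qed

lemma code_computable_cong:
  "code_computable c X n \<Longrightarrow> (\<And>x. x \<in> X \<Longrightarrow> m x = n x) \<Longrightarrow> code_computable c X m"
  unfolding code_computable_def by (erule computable_at_cong) simp

lemma code_computable_id: "code_computable c X c"
  unfolding code_computable_def by (rule computable_at_input)

text \<open>Adjoints between posets are unique already at a single argument. This lets the arbitrary
  adjoints in the Beck--Chevalley conditions be replaced by the constructed ones.\<close>

lemma is_right_adjoint_equality:
  assumes "is_right_adjoint L M h E" "partial_order L" "x \<in> carrier L" "b \<in> carrier M"
    and "\<And>a. a \<in> carrier L \<Longrightarrow> h a \<sqsubseteq>\<^bsub>M\<^esub> b \<longleftrightarrow> a \<sqsubseteq>\<^bsub>L\<^esub> x"
  shows "E b = x"
proof -
  interpret partial_order L by fact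
  have E: "E b \<in> carrier L" "\<And>a. a \<in> carrier L \<Longrightarrow> h a \<sqsubseteq>\<^bsub>M\<^esub> b \<longleftrightarrow> a \<sqsubseteq>\<^bsub>L\<^esub> E b"
    using assms(1,4) unfolding is_right_adjoint_def by auto
  have "E b \<sqsubseteq>\<^bsub>L\<^esub> x" "x \<sqsubseteq>\<^bsub>L\<^esub> E b"
    using E(2)[OF E(1)] E(2)[OF assms(3)] assms(5)[OF E(1)] assms(5)[OF assms(3)]
      le_refl[OF E(1)] le_refl[OF assms(3)] by simp_all
  then have "E b .=\<^bsub>L\<^esub> x" using E(1) assms(3) by (intro weak_le_antisym)
  then show ?thesis unfolding eq_is_equal .
qed

lemma is_left_adjoint_equality:
  assumes "is_left_adjoint L M h F" "partial_order L" "x \<in> carrier L" "b \<in> carrier M"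
    and "\<And>a. a \<in> carrier L \<Longrightarrow> b \<sqsubseteq>\<^bsub>M\<^esub> h a \<longleftrightarrow> x \<sqsubseteq>\<^bsub>L\<^esub> a"
  shows "F b = x"
proof -
  interpret partial_order L by fact
  have F: "F b \<in> carrier L" "\<And>a. a \<in> carrier L \<Longrightarrow> b \<sqsubseteq>\<^bsub>M\<^esub> h a \<longleftrightarrow> F b \<sqsubseteq>\<^bsub>L\<^esub> a"
    using assms(1,4) unfolding is_left_adjoint_def by auto
  have "F b \<sqsubseteq>\<^bsub>L\<^esub> x" "x \<sqsubseteq>\<^bsub>L\<^esub> F b"
    using F(2)[OF F(1)] F(2)[OF assms(3)] assms(5)[OF F(1)] assms(5)[OF assms(3)]
      le_refl[OF F(1)] le_refl[OF assms(3)] by simp_all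
  then have "F b .=\<^bsub>L\<^esub> x" using F(1) assms(3) by (intro weak_le_antisym)
  then show ?thesis unfolding eq_is_equal .
qed

context bounded_family
begin

lemma Obj_base [simp]: "Obj \<C> = base_objects"
  and Cmp_base: "Cmp \<C> X Y Z \<beta> \<alpha> = compose X \<beta> \<alpha>"
  and Idt_base: "Idt \<C> Y = restrict id Y"
  by (simp_all add: base_category_def)

lemma mem_Hom_iff:
  "\<alpha> \<in> Hom \<C> Y Z \<longleftrightarrow> \<alpha> \<in> Y \<rightarrow>\<^sub>E Z \<and> code_computable tuple_code Y (\<lambda>y. tuple_code (\<alpha> y)) \<and>
     le Y (\<lambda>y. bound (\<alpha> y)) bound"
  by (simp add: base_category_def code_computable_tuple_code_iff)

lemma HomD:
  assumes "\<alpha> \<in> Hom \<C> Y Z"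
  shows "\<And>y. y \<in> Y \<Longrightarrow> \<alpha> y \<in> Z" "code_computable tuple_code Y (\<lambda>y. tuple_code (\<alpha> y))"
    "le Y (\<lambda>y. bound (\<alpha> y)) bound"
  using assms unfolding mem_Hom_iff by auto

lemma Hom_restrictI:
  assumes "\<And>y. y \<in> Y \<Longrightarrow> \<alpha> y \<in> Z" "code_computable tuple_code Y (\<lambda>y. tuple_code (\<alpha> y))"
    "le Y (\<lambda>y. bound (\<alpha> y)) bound"
  shows "restrict \<alpha> Y \<in> Hom \<C> Y Z"
  unfolding mem_Hom_iff
  by (intro conjI code_computable_cong[OF assms(2)] uniform_le_cong[OF assms(3)])
    (simp_all add: assms(1))

lemma le_reindex:
  "le Z C D \<Longrightarrow> \<alpha> \<in> Hom \<C> Y Z \<Longrightarrow> le Y (\<lambda>y. C (\<alpha> y)) (\<lambda>y. D (\<alpha> y))"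
  by (rule uniform_le_reindex[of tuple_code Z]) (auto simp: HomD)

lemma Idt_Hom: "Idt \<C> X \<in> Hom \<C> X X"
  unfolding Idt_base
  by (rule Hom_restrictI) (simp_all add: code_computable_id uniform.refl)

lemma Cmp_Hom:
  assumes f: "f \<in> Hom \<C> X Y" and g: "g \<in> Hom \<C> Y Z"
  shows "Cmp \<C> X Y Z g f \<in> Hom \<C> X Z"
  unfolding Cmp_base compose_def
proof (rule Hom_restrictI)
  show "code_computable tuple_code X (\<lambda>x. tuple_code (g (f x)))"
    by (rule code_computable_comp[OF HomD(2)[OF f] HomD(2)[OF g] HomD(1)[OF f]])
  show "le X (\<lambda>x. bound (g (f x))) bound"
    by (rule uniform.trans[OF le_reindex[OF HomD(3)[OF g] f] HomD(3)[OF f]])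
qed (simp add: HomD(1)[OF f] HomD(1)[OF g])

lemma Cmp_apply: "x \<in> X \<Longrightarrow> Cmp \<C> X Y Z g f x = g (f x)"
  by (simp add: Cmp_base compose_def)

lemma category_base: "category \<C>"
proof
  fix X Y f assume f: "f \<in> Hom \<C> X Y"
  then have "f \<in> extensional X" "\<And>x. x \<in> X \<Longrightarrow> f x \<in> Y" by (auto simp: mem_Hom_iff PiE_def)
  then show "Cmp \<C> X Y Y (Idt \<C> Y) f = f" "Cmp \<C> X X Y f (Idt \<C> X) = f"
    by (auto simp: Cmp_base Idt_base compose_def extensional_def)
next
  fix W X Y Z f g h assume "f \<in> Hom \<C> W X"
  then show "Cmp \<C> W Y Z h (Cmp \<C> W X Y g f) = Cmp \<C> W X Z (Cmp \<C> X Y Z h g) f"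
    by (auto simp: Cmp_base compose_def fun_eq_iff HomD(1))
qed (simp_all add: Idt_Hom Cmp_Hom)

lemma degree_cong:
  assumes "Y \<in> base_objects" "\<And>y. y \<in> Y \<Longrightarrow> C y = D y"
  shows "deg Y C = deg Y D"
  unfolding degree_eq_iff[OF assms(1)]
  by (intro conjI uniform_le_cong[OF uniform_le_refl[of _ _ C]]) (simp_all add: assms(2))

text \<open>The union in \<open>interval_pull\<close> runs over all representatives. They all yield
  the same degree, because reindexing and joining preserve reductions.\<close>

lemma pull_degree:
  assumes "Y \<in> base_objects" "Z \<in> base_objects" "\<alpha> \<in> Hom \<C> Y Z"
  shows "pull Y Z \<alpha> (deg Z C) = deg Y (\<lambda>y. mjoin (C (\<alpha> y)) (bound y))"
proof -
  have "deg Y (\<lambda>y. mjoin (D (\<alpha> y)) (bound y)) = deg Y (\<lambda>y. mjoin (C (\<alpha> y)) (bound y))"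
    if "D \<in> deg Z C" for D
    using that le_reindex[OF _ assms(3)] uniform.join_mono[OF _ uniform.refl]
    unfolding mem_degree_iff[OF assms(2)] degree_eq_iff[OF assms(1)] by blast
  then show ?thesis
    unfolding interval_pull_def using degree_self[of C Z] by blast
qed

lemma in_interval_pull:
  assumes "Y \<in> base_objects" "\<alpha> \<in> Hom \<C> Y Z" "in_interval Z C"
  shows "in_interval Y (\<lambda>y. mjoin (C (\<alpha> y)) (bound y))"
  by (rule in_interval_join[OF _ in_intervalI_bound[OF assms(1)]])
    (use assms le_reindex[of Z C "\<lambda>_. A"] in \<open>simp add: in_interval_def\<close>)

text \<open>The bottom is preserved because \<open>bound (\<alpha> y)\<close> reduces to
  \<open>bound y\<close> for a morphism. Meets need distributivity, since the bound is joined after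
  pulling back.\<close>

lemma brouwer_hom_pull:
  assumes Y: "Y \<in> base_objects" and Z: "Z \<in> base_objects" and \<alpha>: "\<alpha> \<in> Hom \<C> Y Z"
  shows "brouwer_hom (\<P> Z) (\<P> Y) (pull Y Z \<alpha>)"
  unfolding brouwer_hom_def
proof (intro conjI ballI)
  note pull = pull_degree[OF Y Z \<alpha>] and int = in_interval_pull[OF Y \<alpha>]
  show "pull Y Z \<alpha> \<in> carrier (\<P> Z) \<rightarrow> carrier (\<P> Y)"
    using int by (auto simp: carrier_fibre Y Z pull)
  show "pull Y Z \<alpha> \<bottom>\<^bsub>\<P> Z\<^esub> = \<bottom>\<^bsub>\<P> Y\<^esub>"
    unfolding bottom_fibre[OF Y] bottom_fibre[OF Z] pull degree_eq_iff[OF Y] uniform_le_mjoin_iff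
    using HomD(3)[OF \<alpha>] uniform.refl uniform.join_upper(2) by (intro conjI)
  show "pull Y Z \<alpha> \<top>\<^bsub>\<P> Z\<^esub> = \<top>\<^bsub>\<P> Y\<^esub>"
    unfolding top_fibre[OF Y] top_fibre[OF Z] pull degree_eq_iff[OF Y] uniform_le_mjoin_iff
    using bound_le_top[OF Y] uniform.refl uniform.join_upper(1) by (intro conjI)
  fix x y assume "x \<in> carrier (\<P> Z)" "y \<in> carrier (\<P> Z)"
  then obtain C D where x: "x = deg Z C" "in_interval Z C" and y: "y = deg Z D" "in_interval Z D"
    unfolding carrier_fibre[OF Z] by blast
  show "pull Y Z \<alpha> (x \<squnion>\<^bsub>\<P> Z\<^esub> y) = pull Y Z \<alpha> x \<squnion>\<^bsub>\<P> Y\<^esub> pull Y Z \<alpha> y"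
    unfolding x(1) y(1) join_fibre[OF Z x(2) y(2)] pull join_fibre[OF Y int[OF x(2)] int[OF y(2)]]
      degree_eq_iff[OF Y] uniform_le_mjoin_iff
    by (intro conjI uniform.join_upper uniform.joinI1[OF uniform.join_upper(1)]
        uniform.joinI1[OF uniform.join_upper(2)] uniform.joinI2[OF uniform.join_upper(1)])
  show "pull Y Z \<alpha> (x \<sqinter>\<^bsub>\<P> Z\<^esub> y) = pull Y Z \<alpha> x \<sqinter>\<^bsub>\<P> Y\<^esub> pull Y Z \<alpha> y"
    unfolding x(1) y(1) meet_fibre[OF Z x(2) y(2)] pull meet_fibre[OF Y int[OF x(2)] int[OF y(2)]]
      degree_eq_iff[OF Y]
    by (intro conjI uniform.meet_join_distrib)
  show "pull Y Z \<alpha> (implication (\<P> Z) x y) = implication (\<P> Y) (pull Y Z \<alpha> x) (pull Y Z \<alpha> y)"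
    unfolding x(1) y(1) implication_fibre[OF Z x(2) y(2)] pull
      implication_fibre[OF Y int[OF x(2)] int[OF y(2)]] degree_eq_iff[OF Y]
    by (intro conjI uniform.interval_imp_join HomD(3)[OF \<alpha>])
qed

lemma pull_Idt_base:
  assumes X: "X \<in> base_objects" and a: "a \<in> carrier (\<P> X)"
  shows "pull X X (Idt \<C> X) a = a"
proof -
  obtain C where C: "a = deg X C" "in_interval X C" using a unfolding carrier_fibre[OF X] by blast
  have "deg X (\<lambda>x. mjoin (C (Idt \<C> X x)) (bound x)) = deg X (\<lambda>x. mjoin (C x) (bound x))"
    by (rule degree_cong[OF X]) (simp add: Idt_base)
  also have "\<dots> = deg X C"
    unfolding degree_eq_iff[OF X] uniform_le_mjoin_iff
    using C(2) uniform.refl uniform.join_upper(1) unfolding in_interval_def by (intro conjI) simp_all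
  finally show ?thesis by (simp add: C pull_degree[OF X X Idt_Hom])
qed

text \<open>The bound at \<open>f x\<close>, which substituting in two stages adds, is absorbed by
  the bound at \<open>x\<close>.\<close>

lemma pull_Cmp_base:
  assumes X: "X \<in> base_objects" and Y: "Y \<in> base_objects" and Z: "Z \<in> base_objects"
    and f: "f \<in> Hom \<C> X Y" and g: "g \<in> Hom \<C> Y Z" and a: "a \<in> carrier (\<P> Z)"
  shows "pull X Z (Cmp \<C> X Y Z g f) a = pull X Y f (pull Y Z g a)"
proof -
  obtain C where C: "a = deg Z C" using a unfolding carrier_fibre[OF Z] by blast
  have "deg X (\<lambda>x. mjoin (C (Cmp \<C> X Y Z g f x)) (bound x)) = deg X (\<lambda>x. mjoin (C (g (f x))) (bound x))"
    by (rule degree_cong[OF X]) (simp add: Cmp_apply)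
  also have "\<dots> = deg X (\<lambda>x. mjoin (mjoin (C (g (f x))) (bound (f x))) (bound x))"
    unfolding degree_eq_iff[OF X] uniform_le_mjoin_iff
    by (intro conjI uniform.join_upper uniform.joinI1[OF uniform.join_upper(1)]
        uniform.joinI2[OF HomD(3)[OF f]])
  finally show ?thesis
    by (simp add: C pull_degree[OF X Z Cmp_Hom[OF f g]] pull_degree[OF Y Z g] pull_degree[OF X Y f])
qed

abbreviation "ex_along Y \<alpha> D \<equiv> exists_along tuple_code Y \<alpha> A D"

abbreviation "all_along Y \<alpha> D \<equiv> (\<lambda>z. mjoin (forall_along tuple_code Y \<alpha> bound D z) (bound z))"

section \<open>Adjoints of substitution along an arbitrary morphism\<close>

context
  fixes Y Z \<alpha>
  assumes Y: "Y \<in> base_objects" and Z: "Z \<in> base_objects" and \<alpha>: "\<alpha> \<in> Hom \<C> Y Z"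
begin

lemma le_ex_along_iff:
  "le Z W (ex_along Y \<alpha> D) \<longleftrightarrow> le Y (\<lambda>y. W (\<alpha> y)) D \<and> le Z W (\<lambda>_. A)"
  by (rule uniform_le_exists_along_iff) (simp_all add: HomD[OF \<alpha>])

lemma forall_along_le_iff:
  "le Z (forall_along tuple_code Y \<alpha> bound D) W \<longleftrightarrow> le Y D (\<lambda>y. mjoin (bound y) (W (\<alpha> y)))"
  by (rule uniform_le_forall_along_iff) (simp_all add: HomD[OF \<alpha>])

lemma in_interval_ex_along:
  assumes "in_interval Y D" shows "in_interval Z (ex_along Y \<alpha> D)"
  unfolding in_interval_def
proof
  show "le Z bound (ex_along Y \<alpha> D)"
    unfolding le_ex_along_iff
    using assms uniform.trans[OF HomD(3)[OF \<alpha>]] bound_le_top[OF Z] unfolding in_interval_def by blast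
  show "le Z (ex_along Y \<alpha> D) (\<lambda>_. A)"
    using uniform.refl le_ex_along_iff by blast
qed

text \<open>Joining with the bound is absorbed because \<open>D\<close> lies above it, and the
  second condition of \<open>le_ex_along_iff\<close> holds because \<open>C\<close> lies below
  \<open>A\<close>.\<close>

lemma pull_le_iff:
  assumes "in_interval Z C" "in_interval Y D"
  shows "pull Y Z \<alpha> (deg Z C) \<sqsubseteq>\<^bsub>\<P> Y\<^esub> deg Y D \<longleftrightarrow> deg Z C \<sqsubseteq>\<^bsub>\<P> Z\<^esub> deg Z (ex_along Y \<alpha> D)"
  unfolding pull_degree[OF Y Z \<alpha>] le_fibre_iff[OF Y] le_fibre_iff[OF Z] le_ex_along_iff uniform_le_mjoin_iff
  using assms unfolding in_interval_def by blast

lemma in_interval_all_along: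
  assumes "in_interval Y D" shows "in_interval Z (all_along Y \<alpha> D)"
proof (rule in_interval_join[OF _ in_intervalI_bound[OF Z]])
  show "le Z (forall_along tuple_code Y \<alpha> bound D) (\<lambda>_. A)"
    unfolding forall_along_le_iff
    by (rule uniform_le_mjoinI(2)) (use assms in \<open>simp add: in_interval_def\<close>)
qed

text \<open>Joining the quantifier with the bound of \<open>z\<close> moves it into the interval and
  keeps the equivalence, since \<open>C\<close> lies above that bound.\<close>

lemma le_pull_iff:
  assumes "in_interval Z C"
  shows "deg Y D \<sqsubseteq>\<^bsub>\<P> Y\<^esub> pull Y Z \<alpha> (deg Z C) \<longleftrightarrow> deg Z (all_along Y \<alpha> D) \<sqsubseteq>\<^bsub>\<P> Z\<^esub> deg Z C"
  unfolding pull_degree[OF Y Z \<alpha>] le_fibre_iff[OF Y] le_fibre_iff[OF Z] uniform_le_mjoin_iff forall_along_le_iff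
  using assms uniform.join_commute[of tuple_code Y D bound "\<lambda>y. C (\<alpha> y)"]
    uniform.join_commute[of tuple_code Y D "\<lambda>y. C (\<alpha> y)" bound]
  unfolding in_interval_def by blast

lemma right_adjoint_degree:
  assumes "is_right_adjoint (\<P> Z) (\<P> Y) (pull Y Z \<alpha>) E" "in_interval Y D"
  shows "E (deg Y D) = deg Z (ex_along Y \<alpha> D)"
  using assms(1) partial_order_fibre[OF Z]
proof (rule is_right_adjoint_equality)
  fix a assume "a \<in> carrier (\<P> Z)"
  then show "pull Y Z \<alpha> a \<sqsubseteq>\<^bsub>\<P> Y\<^esub> deg Y D \<longleftrightarrow> a \<sqsubseteq>\<^bsub>\<P> Z\<^esub> deg Z (ex_along Y \<alpha> D)"
    unfolding carrier_fibre[OF Z] using pull_le_iff[OF _ assms(2)] by blast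
qed (use assms(2) in_interval_ex_along carrier_fibre Y Z in blast)+

lemma left_adjoint_degree:
  assumes "is_left_adjoint (\<P> Z) (\<P> Y) (pull Y Z \<alpha>) F" "in_interval Y D"
  shows "F (deg Y D) = deg Z (all_along Y \<alpha> D)"
  using assms(1) partial_order_fibre[OF Z]
proof (rule is_left_adjoint_equality)
  fix a assume "a \<in> carrier (\<P> Z)"
  then show "deg Y D \<sqsubseteq>\<^bsub>\<P> Y\<^esub> pull Y Z \<alpha> a \<longleftrightarrow> deg Z (all_along Y \<alpha> D) \<sqsubseteq>\<^bsub>\<P> Z\<^esub> a"
    unfolding carrier_fibre[OF Z] using le_pull_iff by blast
qed (use assms(2) in_interval_all_along carrier_fibre Y Z in blast)+

lemma right_adjoint_exists: "\<exists>E. is_right_adjoint (\<P> Z) (\<P> Y) (pull Y Z \<alpha>) E"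
proof -
  \<comment> \<open>An adjoint acts on degrees, so a representative in the interval is chosen for
    each of them.\<close>
  have "\<forall>b. \<exists>D. b \<in> carrier (\<P> Y) \<longrightarrow> b = deg Y D \<and> in_interval Y D"
    unfolding carrier_fibre[OF Y] by blast
  from choice[OF this] obtain R where R: "\<And>b. b \<in> carrier (\<P> Y) \<Longrightarrow> b = deg Y (R b)"
    "\<And>b. b \<in> carrier (\<P> Y) \<Longrightarrow> in_interval Y (R b)" by blast
  have adj: "is_right_adjoint (\<P> Z) (\<P> Y) (pull Y Z \<alpha>) (\<lambda>b. deg Z (ex_along Y \<alpha> (R b)))"
    unfolding is_right_adjoint_def
  proof (intro conjI ballI Pi_I)
    fix b assume b: "b \<in> carrier (\<P> Y)"
    show "deg Z (ex_along Y \<alpha> (R b)) \<in> carrier (\<P> Z)"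
      using in_interval_ex_along[OF R(2)[OF b]] unfolding carrier_fibre[OF Z] by blast
    fix a assume "a \<in> carrier (\<P> Z)"
    then obtain C where "a = deg Z C" "in_interval Z C" unfolding carrier_fibre[OF Z] by blast
    then show "pull Y Z \<alpha> a \<sqsubseteq>\<^bsub>\<P> Y\<^esub> b \<longleftrightarrow> a \<sqsubseteq>\<^bsub>\<P> Z\<^esub> deg Z (ex_along Y \<alpha> (R b))"
      using pull_le_iff[OF _ R(2)[OF b]] R(1)[OF b] by simp
  qed
  show ?thesis by (rule exI, rule adj)
qed

lemma left_adjoint_exists: "\<exists>F. is_left_adjoint (\<P> Z) (\<P> Y) (pull Y Z \<alpha>) F"
proof -
  have "\<forall>b. \<exists>D. b \<in> carrier (\<P> Y) \<longrightarrow> b = deg Y D \<and> in_interval Y D"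
    unfolding carrier_fibre[OF Y] by blast
  from choice[OF this] obtain R where R: "\<And>b. b \<in> carrier (\<P> Y) \<Longrightarrow> b = deg Y (R b)"
    "\<And>b. b \<in> carrier (\<P> Y) \<Longrightarrow> in_interval Y (R b)" by blast
  have adj: "is_left_adjoint (\<P> Z) (\<P> Y) (pull Y Z \<alpha>) (\<lambda>b. deg Z (all_along Y \<alpha> (R b)))"
    unfolding is_left_adjoint_def
  proof (intro conjI ballI Pi_I)
    fix b assume b: "b \<in> carrier (\<P> Y)"
    show "deg Z (all_along Y \<alpha> (R b)) \<in> carrier (\<P> Z)"
      using in_interval_all_along[OF R(2)[OF b]] unfolding carrier_fibre[OF Z] by blast
    fix a assume "a \<in> carrier (\<P> Z)"
    then obtain C where "a = deg Z C" "in_interval Z C" unfolding carrier_fibre[OF Z] by blast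
    then show "deg Z (all_along Y \<alpha> (R b)) \<sqsubseteq>\<^bsub>\<P> Z\<^esub> a \<longleftrightarrow> b \<sqsubseteq>\<^bsub>\<P> Y\<^esub> pull Y Z \<alpha> a"
      using le_pull_iff[of C "R b"] R(1)[OF b] by simp
  qed
  show ?thesis by (rule exI, rule adj)
qed

lemma equality_exists:
  "\<exists>e\<in>carrier (\<P> Z). \<forall>a\<in>carrier (\<P> Z). pull Y Z \<alpha> a \<sqsubseteq>\<^bsub>\<P> Y\<^esub> \<bottom>\<^bsub>\<P> Y\<^esub> \<longleftrightarrow> a \<sqsubseteq>\<^bsub>\<P> Z\<^esub> e"
proof (intro bexI ballI)
  note int = in_intervalI_bound[OF Y]
  show "deg Z (ex_along Y \<alpha> bound) \<in> carrier (\<P> Z)"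
    using in_interval_ex_along[OF int] unfolding carrier_fibre[OF Z] by blast
  fix a assume "a \<in> carrier (\<P> Z)"
  then obtain C where "a = deg Z C" "in_interval Z C" unfolding carrier_fibre[OF Z] by blast
  then show "pull Y Z \<alpha> a \<sqsubseteq>\<^bsub>\<P> Y\<^esub> \<bottom>\<^bsub>\<P> Y\<^esub> \<longleftrightarrow> a \<sqsubseteq>\<^bsub>\<P> Z\<^esub> deg Z (ex_along Y \<alpha> bound)"
    using pull_le_iff[OF _ int] unfolding bottom_fibre[OF Y] by simp
qed

end

end

section \<open>Finite powers\<close>

lemma is_powerD:
  assumes "is_power C X n Q pr"
  shows "Q \<in> Obj C" "\<And>i. i < n \<Longrightarrow> pr i \<in> Hom C Q X"
    and "\<And>T t. T \<in> Obj C \<Longrightarrow> (\<And>i. i < n \<Longrightarrow> t i \<in> Hom C T X) \<Longrightarrow>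
      \<exists>!u. u \<in> Hom C T Q \<and> (\<forall>i<n. Cmp C T Q X (pr i) u = t i)"
  using assms unfolding is_power_def by simp_all

lemma is_productD:
  assumes "is_product C \<Gamma> X Q p q"
  shows "\<Gamma> \<in> Obj C" "X \<in> Obj C" "Q \<in> Obj C" "p \<in> Hom C Q \<Gamma>" "q \<in> Hom C Q X"
    and "\<And>T f g. T \<in> Obj C \<Longrightarrow> f \<in> Hom C T \<Gamma> \<Longrightarrow> g \<in> Hom C T X \<Longrightarrow>
      \<exists>!u. u \<in> Hom C T Q \<and> Cmp C T Q \<Gamma> p u = f \<and> Cmp C T Q X q u = g"
  using assms unfolding is_product_def by simp_all

context bounded_family
begin

lemma tuple_entry:
  assumes "j < n"
  shows "code_computable tuple_code (tuples S n) (\<lambda>y. y ! j)"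
    and "le (tuples S n) (\<lambda>y. B (int (y ! j))) bound"
proof -
  have len: "\<And>y. y \<in> tuples S n \<Longrightarrow> length y = n" by (simp add: tuples_def)
  show "code_computable tuple_code (tuples S n) (\<lambda>y. y ! j)"
    unfolding code_computable_def
    by (rule computable_at_nth[where xs = fst and n = n, OF computable_at_input]) (simp_all add: assms len)
  show "le (tuples S n) (\<lambda>y. B (int (y ! j))) bound"
  proof (rule uniform_leI)
    fix P e and i :: "nat list \<times> (nat \<Rightarrow> nat) \<Rightarrow> nat list"
    assume "solvable_from P e (\<lambda>x. bound (i x))" "\<And>x. P x \<Longrightarrow> i x \<in> tuples S n"
    then show "solvable_from P e (\<lambda>x. B (int (i x ! j)))"
      using assms len by (intro solvable_from_nth[where xs = i and n = n]) simp_all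
  qed
qed

lemma Hom_entry:
  assumes "\<alpha> \<in> Hom \<C> Y (tuples S m)" "j < m"
  shows "code_computable tuple_code Y (\<lambda>y. \<alpha> y ! j)" and "le Y (\<lambda>y. B (int (\<alpha> y ! j))) bound"
proof -
  note entry = tuple_entry[where S = S, OF assms(2)]
  show "code_computable tuple_code Y (\<lambda>y. \<alpha> y ! j)"
    by (rule code_computable_comp[OF HomD(2)[OF assms(1)] entry(1)]) (rule HomD(1)[OF assms(1)])
  show "le Y (\<lambda>y. B (int (\<alpha> y ! j))) bound"
    by (rule uniform.trans[OF le_reindex[OF entry(2) assms(1)] HomD(3)[OF assms(1)]])
qed

text \<open>A morphism into a concrete power is given by its entries. If \<open>m = 0\<close> there
  are none, and the bound of the empty tuple comes from that of \<open>y\<close> through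
  \<open>solvable_from_bottom\<close>.\<close>

lemma Hom_tuplesI:
  assumes Y: "Y \<in> base_objects" and \<alpha>: "\<And>y. y \<in> Y \<Longrightarrow> \<alpha> y \<in> tuples S m"
    and entry: "\<And>j. j < m \<Longrightarrow> code_computable tuple_code Y (\<lambda>y. \<alpha> y ! j)"
      "\<And>j. j < m \<Longrightarrow> le Y (\<lambda>y. B (int (\<alpha> y ! j))) bound"
  shows "restrict \<alpha> Y \<in> Hom \<C> Y (tuples S m)"
proof (rule Hom_restrictI)
  have len: "\<And>y. y \<in> Y \<Longrightarrow> length (\<alpha> y) = m" using \<alpha> by (simp add: tuples_def)
  show "code_computable tuple_code Y (\<lambda>y. tuple_code (\<alpha> y))"
    unfolding code_computable_def
    by (rule computable_at_tuple_code[where n = m])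
      (use entry(1) len in \<open>simp_all add: code_computable_def\<close>)
  obtain n where n: "\<And>y. y \<in> Y \<Longrightarrow> length y = n" by (metis base_objectsE[OF Y])
  show "le Y (\<lambda>y. bound (\<alpha> y)) bound"
  proof (rule uniform_leI)
    fix P e and i :: "nat list \<times> (nat \<Rightarrow> nat) \<Rightarrow> nat list"
    assume i: "number_from P e (\<lambda>x. tuple_code (i x))" "solvable_from P e (\<lambda>x. bound (i x))"
      "\<And>x. P x \<Longrightarrow> i x \<in> Y"
    show "solvable_from P e (\<lambda>x. bound (\<alpha> (i x)))"
    proof (rule solvable_from_tuple_bound)
      show "solvable_from P e (\<lambda>_. B (- 1))"
        by (rule solvable_from_bottom[OF i(1,2)]) (simp add: n i(3))
      show "solvable_from P e (\<lambda>x. B (int (\<alpha> (i x) ! j)))" if "j < m" for j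
        by (rule solvable_from_reduce[OF entry(2)[OF that] i])
    qed (simp add: len i(3))
  qed
qed (rule \<alpha>)

text \<open>The \<open>n\<close>-th power of the tuples of length \<open>k\<close> consists of the
  tuples of length \<open>k * n\<close>, and \<open>block k i\<close> is its projection with index
  \<open>i\<close>.\<close>

definition block :: "nat \<Rightarrow> nat \<Rightarrow> nat list \<Rightarrow> nat list" where
  "block k i y = map (\<lambda>l. y ! (i * k + l)) [0..<k]"

lemma block_index: "i < n \<Longrightarrow> l < k \<Longrightarrow> i * k + l < k * (n :: nat)"
proof -
  assume "i < n" "l < k"
  then have "i * k + l < Suc i * k" by simp
  also have "\<dots> \<le> n * k" using \<open>i < n\<close> by (intro mult_le_mono1) simp
  finally show ?thesis by (simp add: mult.commute)
qed

lemma restrict_block_Hom: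
  assumes base: "\<And>k. tuples S k \<in> base_objects" and "i < n"
  shows "restrict (block k i) (tuples S (k * n)) \<in> Hom \<C> (tuples S (k * n)) (tuples S k)"
proof (rule Hom_tuplesI[OF base])
  fix y assume y: "y \<in> tuples S (k * n)"
  have "y ! (i * k + l) \<in> S" if "l < k" for l
    using y block_index[OF assms(2) that] unfolding tuples_def by (auto dest: nth_mem)
  then show "block k i y \<in> tuples S k"
    by (auto simp: tuples_def block_def)
next
  fix j assume j: "j < k"
  note entry = tuple_entry[where S = S, OF block_index[OF assms(2) j]]
  show "code_computable tuple_code (tuples S (k * n)) (\<lambda>y. block k i y ! j)"
    "le (tuples S (k * n)) (\<lambda>y. B (int (block k i y ! j))) bound"
    using entry j by (simp_all add: block_def)
qed

lemma is_power_tuples: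
  assumes base: "\<And>k. tuples S k \<in> base_objects"
  shows "is_power \<C> (tuples S k) n (tuples S (k * n)) (\<lambda>i. restrict (block k i) (tuples S (k * n)))"
  unfolding is_power_def Obj_base
proof (intro conjI allI impI ballI base)
  show "restrict (block k i) (tuples S (k * n)) \<in> Hom \<C> (tuples S (k * n)) (tuples S k)" if "i < n" for i
    by (rule restrict_block_Hom[OF base that])
  fix T t assume T: "T \<in> base_objects" and t: "\<forall>i<n. t i \<in> Hom \<C> T (tuples S k)"
  let ?Q = "tuples S (k * n)"
  \<comment> \<open>Concatenation: position \<open>l\<close> lies in the block
    \<open>l div k\<close> at offset \<open>l mod k\<close>.\<close>
  let ?u = "\<lambda>y. map (\<lambda>l. t (l div k) y ! (l mod k)) [0..<k * n]"
  have div: "l div k < n" "l mod k < k" if "l < k * n" for l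
  proof -
    show "l div k < n" using that by (simp add: less_mult_imp_div_less mult.commute)
    show "l mod k < k" using that by (cases k) simp_all
  qed
  show "\<exists>!u. u \<in> Hom \<C> T ?Q \<and> (\<forall>i<n. Cmp \<C> T ?Q (tuples S k) (restrict (block k i) ?Q) u = t i)"
  proof (rule ex1I)
    have u: "?u y \<in> ?Q" if "y \<in> T" for y
    proof -
      have "t (l div k) y ! (l mod k) \<in> S" if "l < k * n" for l
        using HomD(1)[OF t[rule_format, OF div(1)[OF that]] \<open>y \<in> T\<close>] div(2)[OF that]
        unfolding tuples_def by (auto dest: nth_mem)
      then show ?thesis by (auto simp: tuples_def)
    qed
    have "restrict ?u T \<in> Hom \<C> T ?Q"
    proof (rule Hom_tuplesI[OF T u])
      fix j assume j: "j < k * n"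
      note entry = Hom_entry[OF t[rule_format, OF div(1)[OF j]] div(2)[OF j]]
      show "code_computable tuple_code T (\<lambda>y. ?u y ! j)" "le T (\<lambda>y. B (int (?u y ! j))) bound"
        using entry j by simp_all
    qed
    moreover have "Cmp \<C> T ?Q (tuples S k) (restrict (block k i) ?Q) (restrict ?u T) = t i" if i: "i < n" for i
    proof (rule extensionalityI[where A = T])
      fix y assume y: "y \<in> T"
      have "length (t i y) = k" using HomD(1)[OF t[rule_format, OF i] y] by (simp add: tuples_def)
      moreover have "?u y ! (i * k + l) = t i y ! l" if "l < k" for l
        using block_index[OF i that] that by simp
      ultimately have "block k i (?u y) = t i y"
        unfolding block_def by (intro nth_equalityI) simp_all
      then show "Cmp \<C> T ?Q (tuples S k) (restrict (block k i) ?Q) (restrict ?u T) y = t i y"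
        using y u[OF y] by (simp add: Cmp_base compose_def)
    qed (use t[rule_format, OF i] in \<open>simp_all add: Cmp_base compose_def mem_Hom_iff PiE_def\<close>)
    ultimately show "restrict ?u T \<in> Hom \<C> T ?Q \<and>
        (\<forall>i<n. Cmp \<C> T ?Q (tuples S k) (restrict (block k i) ?Q) (restrict ?u T) = t i)" by blast
  next
    fix u assume u: "u \<in> Hom \<C> T ?Q \<and>
        (\<forall>i<n. Cmp \<C> T ?Q (tuples S k) (restrict (block k i) ?Q) u = t i)"
    show "u = restrict ?u T"
    proof (rule extensionalityI[where A = T])
      fix y assume y: "y \<in> T"
      have uy: "u y \<in> ?Q" using u HomD(1) y by blast
      have "u y ! l = t (l div k) y ! (l mod k)" if "l < k * n" for l
      proof -
        have "t (l div k) y =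
            Cmp \<C> T ?Q (tuples S k) (restrict (block k (l div k)) ?Q) u y"
          using u div(1)[OF that] by simp
        also have "\<dots> = block k (l div k) (u y)"
          using uy y by (simp add: Cmp_base compose_def)
        finally show ?thesis using div(2)[OF that] by (simp add: block_def)
      qed
      then show "u y = restrict ?u T y"
        using uy y by (auto simp: tuples_def intro!: nth_equalityI)
    qed (use u in \<open>simp_all add: mem_Hom_iff PiE_def\<close>)
  qed
qed

lemma finite_powers_base:
  assumes "X \<in> base_objects" shows "\<exists>Q pr. is_power \<C> X n Q pr"
proof -
  obtain S k where "X = tuples S k" "\<And>k. tuples S k \<in> base_objects"
    by (metis base_objectsE[OF assms])
  then show ?thesis using is_power_tuples by blast
qed

text \<open>Here \<open>f\<close> and \<open>g\<close> are the comparison morphisms between two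
  powers. Their composite on \<open>Q\<close> respects all projections and is the identity by
  uniqueness.\<close>

lemma power_retract:
  assumes base: "\<And>k. tuples S k \<in> base_objects" and power: "is_power \<C> (tuples S k) n Q pr"
  obtains f g where "f \<in> Hom \<C> Q (tuples S (k * n))" "g \<in> Hom \<C> (tuples S (k * n)) Q"
    "\<And>x. x \<in> Q \<Longrightarrow> g (f x) = x"
proof -
  let ?X = "tuples S k" and ?R = "tuples S (k * n)"
  let ?pr = "\<lambda>i. restrict (block k i) ?R"
  note power' = is_power_tuples[OF base, of k n]
  have Q: "Q \<in> base_objects" and pr: "\<And>i. i < n \<Longrightarrow> pr i \<in> Hom \<C> Q ?X"
    using is_powerD(1,2)[OF power] by simp_all
  have "\<exists>!f. f \<in> Hom \<C> Q ?R \<and> (\<forall>i<n. Cmp \<C> Q ?R ?X (?pr i) f = pr i)"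
    by (rule is_powerD(3)[OF power']) (simp_all add: Q pr)
  then obtain f where f: "f \<in> Hom \<C> Q ?R" "\<And>i. i < n \<Longrightarrow> Cmp \<C> Q ?R ?X (?pr i) f = pr i"
    by blast
  have "\<exists>!g. g \<in> Hom \<C> ?R Q \<and> (\<forall>i<n. Cmp \<C> ?R Q ?X (pr i) g = ?pr i)"
    by (rule is_powerD(3)[OF power]) (simp_all add: base is_powerD(2)[OF power'])
  then obtain g where g: "g \<in> Hom \<C> ?R Q" "\<And>i. i < n \<Longrightarrow> Cmp \<C> ?R Q ?X (pr i) g = ?pr i"
    by blast
  have "pr i (g (f x)) = pr i x" if "i < n" "x \<in> Q" for i x
    using Cmp_apply[OF HomD(1)[OF f(1) that(2)], of Q ?X "pr i" g] g(2)[OF that(1)]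
      Cmp_apply[OF that(2), of ?R ?X "?pr i" f] f(2)[OF that(1)] by simp
  then have 1: "Cmp \<C> Q Q ?X (pr i) (Cmp \<C> Q ?R Q g f) = pr i" if "i < n" for i
    using that pr[OF that]
    by (intro extensionalityI[where A = Q])
      (simp_all add: Cmp_base compose_def mem_Hom_iff PiE_def)
  have 2: "Cmp \<C> Q Q ?X (pr i) (Idt \<C> Q) = pr i" if "i < n" for i
    using category.Cmp_Idt_right[OF category_base _ _ pr[OF that]] Q base by simp
  have "\<exists>!u. u \<in> Hom \<C> Q Q \<and> (\<forall>i<n. Cmp \<C> Q Q ?X (pr i) u = pr i)"
    by (rule is_powerD(3)[OF power]) (simp_all add: Q pr)
  then have "Cmp \<C> Q ?R Q g f = Idt \<C> Q"
    by (rule ex1E) (use 1 2 Cmp_Hom[OF f(1) g(1)] Idt_Hom[of Q] in metis)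
  then have "g (f x) = x" if "x \<in> Q" for x
    using Cmp_apply[OF that, of ?R Q g f] that by (simp add: Idt_base)
  with f(1) g(1) show thesis by (rule that)
qed

end

text \<open>Pairs of tuples are indexed directly, since a set of pairs is not an object of the base
  category.\<close>

definition pair_code :: "nat list \<times> nat list \<Rightarrow> nat" where
  "pair_code a = prod_encode (tuple_code (fst a), tuple_code (snd a))"

lemma code_computable_pair_code:
  "code_computable pair_code I (\<lambda>a. tuple_code (fst a))"
  "code_computable pair_code I (\<lambda>a. tuple_code (snd a))"
  using computable_at_fst[OF computable_at_input, of "\<lambda>x. fst x \<in> I" snd "\<lambda>x. pair_code (fst x)"]
    computable_at_snd[OF computable_at_input, of "\<lambda>x. fst x \<in> I" snd "\<lambda>x. pair_code (fst x)"]
  unfolding code_computable_def by (simp_all add: pair_code_def)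

lemma code_computable_append:
  assumes xs: "code_computable c I (\<lambda>a. tuple_code (xs a))" "\<And>a. a \<in> I \<Longrightarrow> length (xs a) = m"
    and ys: "code_computable c I (\<lambda>a. tuple_code (ys a))" "\<And>a. a \<in> I \<Longrightarrow> length (ys a) = n"
  shows "code_computable c I (\<lambda>a. tuple_code (xs a @ ys a))"
  unfolding code_computable_def
proof (rule computable_at_tuple_code)
  fix j assume j: "j < m + n"
  show "computable_at (\<lambda>x. fst x \<in> I) snd (\<lambda>x. c (fst x)) (\<lambda>x. (xs (fst x) @ ys (fst x)) ! j)"
  proof (cases "j < m")
    case True
    have "computable_at (\<lambda>x. fst x \<in> I) snd (\<lambda>x. c (fst x)) (\<lambda>x. xs (fst x) ! j)"
      by (rule computable_at_nth[OF xs(1)[unfolded code_computable_def] _ True]) (rule xs(2))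
    then show ?thesis by (rule computable_at_cong) (use True xs(2) in \<open>simp add: nth_append\<close>)
  next
    case False
    with j have "j - m < n" by simp
    have "computable_at (\<lambda>x. fst x \<in> I) snd (\<lambda>x. c (fst x)) (\<lambda>x. ys (fst x) ! (j - m))"
      by (rule computable_at_nth[OF ys(1)[unfolded code_computable_def] _ \<open>j - m < n\<close>]) (rule ys(2))
    then show ?thesis by (rule computable_at_cong) (use False xs(2) in \<open>simp add: nth_append\<close>)
  qed
qed (simp add: xs(2) ys(2))

lemma solvable_from_append:
  assumes bot: "solvable_from P e (\<lambda>_. B (- 1))"
    and xs: "solvable_from P e (\<lambda>a. tuple_bound B (xs a))" "\<And>a. P a \<Longrightarrow> length (xs a) = m"
    and ys: "solvable_from P e (\<lambda>a. tuple_bound B (ys a))" "\<And>a. P a \<Longrightarrow> length (ys a) = n"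
  shows "solvable_from P e (\<lambda>a. tuple_bound B (xs a @ ys a))"
proof (rule solvable_from_tuple_bound)
  fix j assume j: "j < m + n"
  show "solvable_from P e (\<lambda>a. B (int ((xs a @ ys a) ! j)))"
  proof (cases "j < m")
    case True
    have "solvable_from P e (\<lambda>a. B (int (xs a ! j)))"
      by (rule solvable_from_nth[OF xs(1) _ True]) (rule xs(2))
    then show ?thesis by (rule solvable_from_mono) (use True xs(2) in \<open>simp_all add: nth_append\<close>)
  next
    case False
    with j have "j - m < n" by simp
    have "solvable_from P e (\<lambda>a. B (int (ys a ! (j - m))))"
      by (rule solvable_from_nth[OF ys(1) _ \<open>j - m < n\<close>]) (rule ys(2))
    then show ?thesis by (rule solvable_from_mono) (use False xs(2) in \<open>simp_all add: nth_append\<close>)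
  qed
qed (simp_all add: bot xs(2) ys(2))

context bounded_family
begin

text \<open>What matters is the common \<open>S\<close>: images of points of \<open>\<Gamma>\<close>
  and \<open>X\<close> can be concatenated to a tuple over \<open>S\<close>, and such tuples form an
  object.\<close>

lemma powers_of_common_objectE:
  assumes "powers_of_common_object \<C> \<Gamma> X"
  obtains S k l f g f' g' where "\<And>k. tuples S k \<in> base_objects"
    "f \<in> Hom \<C> \<Gamma> (tuples S k)" "g \<in> Hom \<C> (tuples S k) \<Gamma>" "\<And>\<gamma>. \<gamma> \<in> \<Gamma> \<Longrightarrow> g (f \<gamma>) = \<gamma>"
    "f' \<in> Hom \<C> X (tuples S l)" "g' \<in> Hom \<C> (tuples S l) X" "\<And>x. x \<in> X \<Longrightarrow> g' (f' x) = x"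
proof -
  obtain Z m n pr pr' where Z: "is_power \<C> Z m \<Gamma> pr" "is_power \<C> Z n X pr'"
    using assms unfolding powers_of_common_object_def by blast
  have "Z \<in> base_objects" using Z(1) unfolding is_power_def by simp
  then obtain S k where S: "Z = tuples S k" "\<And>k. tuples S k \<in> base_objects"
    by (metis base_objectsE)
  obtain f g where "f \<in> Hom \<C> \<Gamma> (tuples S (k * m))" "g \<in> Hom \<C> (tuples S (k * m)) \<Gamma>"
    "\<And>\<gamma>. \<gamma> \<in> \<Gamma> \<Longrightarrow> g (f \<gamma>) = \<gamma>"
    using power_retract[OF S(2) Z(1)[unfolded S(1)]] by blast
  moreover obtain f' g' where "f' \<in> Hom \<C> X (tuples S (k * n))" "g' \<in> Hom \<C> (tuples S (k * n)) X"
    "\<And>x. x \<in> X \<Longrightarrow> g' (f' x) = x"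
    using power_retract[OF S(2) Z(2)[unfolded S(1)]] by blast
  ultimately show thesis using that[OF S(2)] by blast
qed

lemma restrict_take_drop_Hom:
  assumes base: "\<And>k. tuples S k \<in> base_objects"
  shows "restrict (take k) (tuples S (k + l)) \<in> Hom \<C> (tuples S (k + l)) (tuples S k)"
    and "restrict (drop k) (tuples S (k + l)) \<in> Hom \<C> (tuples S (k + l)) (tuples S l)"
proof -
  have *: "j < k + l \<Longrightarrow> code_computable tuple_code (tuples S (k + l)) (\<lambda>y. y ! j)"
    "j < k + l \<Longrightarrow> le (tuples S (k + l)) (\<lambda>y. B (int (y ! j))) bound" for j
    by (rule tuple_entry; simp)+
  show "restrict (take k) (tuples S (k + l)) \<in> Hom \<C> (tuples S (k + l)) (tuples S k)"
  proof (rule Hom_tuplesI[OF base])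
    show "take k y \<in> tuples S k" if "y \<in> tuples S (k + l)" for y
      using that by (auto simp: tuples_def dest: in_set_takeD)
    show "code_computable tuple_code (tuples S (k + l)) (\<lambda>y. take k y ! j)"
      "le (tuples S (k + l)) (\<lambda>y. B (int (take k y ! j))) bound" if "j < k" for j
      using *[of j] that by simp_all
  qed
  show "restrict (drop k) (tuples S (k + l)) \<in> Hom \<C> (tuples S (k + l)) (tuples S l)"
  proof (rule Hom_tuplesI[OF base])
    show "drop k y \<in> tuples S l" if "y \<in> tuples S (k + l)" for y
      using that by (auto simp: tuples_def dest: in_set_dropD)
    show "code_computable tuple_code (tuples S (k + l)) (\<lambda>y. drop k y ! j)"
      "le (tuples S (k + l)) (\<lambda>y. B (int (drop k y ! j))) bound" if "j < l" for j
    proof -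
      have "drop k y ! j = y ! (k + j)" if "y \<in> tuples S (k + l)" for y
        using that by (simp add: tuples_def)
      then show "code_computable tuple_code (tuples S (k + l)) (\<lambda>y. drop k y ! j)"
        "le (tuples S (k + l)) (\<lambda>y. B (int (drop k y ! j))) bound"
        using *[of "k + j"] that
        by (auto elim: code_computable_cong uniform_le_cong)
    qed
  qed
qed

text \<open>\<open>\<pi>\<close> is obtained from concatenation in the isomorphic concrete power of the common object.\<close>

lemma product_pairing:
  assumes powers: "powers_of_common_object \<C> \<Gamma> X" and product: "is_product \<C> \<Gamma> X Q p q"
  obtains \<pi> where "\<And>a. a \<in> \<Gamma> \<times> X \<Longrightarrow> \<pi> a \<in> Q"
    "\<And>a. a \<in> \<Gamma> \<times> X \<Longrightarrow> p (\<pi> a) = fst a" "\<And>a. a \<in> \<Gamma> \<times> X \<Longrightarrow> q (\<pi> a) = snd a"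
    "\<And>z. z \<in> Q \<Longrightarrow> \<pi> (p z, q z) = z"
    "code_computable pair_code (\<Gamma> \<times> X) (\<lambda>a. tuple_code (\<pi> a))"
    "uniform_le pair_code (\<Gamma> \<times> X) (\<lambda>a. bound (\<pi> a)) (\<lambda>a. mjoin (bound (fst a)) (bound (snd a)))"
proof -
  obtain S k l f g f' g' where base: "\<And>k. tuples S k \<in> base_objects"
    and f: "f \<in> Hom \<C> \<Gamma> (tuples S k)" and g: "g \<in> Hom \<C> (tuples S k) \<Gamma>"
    and gf: "\<And>\<gamma>. \<gamma> \<in> \<Gamma> \<Longrightarrow> g (f \<gamma>) = \<gamma>"
    and f': "f' \<in> Hom \<C> X (tuples S l)" and g': "g' \<in> Hom \<C> (tuples S l) X"
    and gf': "\<And>x. x \<in> X \<Longrightarrow> g' (f' x) = x"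
    by (rule powers_of_common_objectE[OF powers]) blast
  let ?R = "tuples S (k + l)"
  let ?p = "restrict (take k) ?R" and ?q = "restrict (drop k) ?R"
  note pq = restrict_take_drop_Hom[OF base, of k l]
  have \<Gamma>: "\<Gamma> \<in> base_objects" and Q: "Q \<in> base_objects"
    and p: "p \<in> Hom \<C> Q \<Gamma>" and q: "q \<in> Hom \<C> Q X"
    using is_productD[OF product] by simp_all
  \<comment> \<open>The two halves of a concrete tuple determine a mediating morphism into the given
    product; it sends concatenations to points of \<open>Q\<close>.\<close>
  have "\<exists>!v. v \<in> Hom \<C> ?R Q \<and> Cmp \<C> ?R Q \<Gamma> p v = Cmp \<C> ?R (tuples S k) \<Gamma> g ?p \<and>
      Cmp \<C> ?R Q X q v = Cmp \<C> ?R (tuples S l) X g' ?q"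
    by (rule is_productD(6)[OF product]) (simp_all add: base Cmp_Hom[OF pq(1) g] Cmp_Hom[OF pq(2) g'])
  then obtain v where v: "v \<in> Hom \<C> ?R Q"
    "Cmp \<C> ?R Q \<Gamma> p v = Cmp \<C> ?R (tuples S k) \<Gamma> g ?p"
    "Cmp \<C> ?R Q X q v = Cmp \<C> ?R (tuples S l) X g' ?q" by blast
  have pv: "p (v y) = g (take k y)" and qv: "q (v y) = g' (drop k y)" if "y \<in> ?R" for y
    using fun_cong[OF v(2), of y] fun_cong[OF v(3), of y] that by (simp_all add: Cmp_apply)
  let ?w = "\<lambda>a. f (fst a) @ f' (snd a)"
  have len: "length (f \<gamma>) = k" if "\<gamma> \<in> \<Gamma>" for \<gamma>
    using HomD(1)[OF f that] by (simp add: tuples_def)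
  have len': "length (f' x) = l" if "x \<in> X" for x
    using HomD(1)[OF f' that] by (simp add: tuples_def)
  have w: "?w a \<in> ?R" if "a \<in> \<Gamma> \<times> X" for a
    using HomD(1)[OF f, of "fst a"] HomD(1)[OF f', of "snd a"] that by (auto simp: tuples_def)
  define \<pi> where "\<pi> a = v (?w a)" for a
  have 1: "\<pi> a \<in> Q" "p (\<pi> a) = fst a" "q (\<pi> a) = snd a" if "a \<in> \<Gamma> \<times> X" for a
    unfolding \<pi>_def using HomD(1)[OF v(1) w[OF that]] pv[OF w[OF that]] qv[OF w[OF that]]
      gf gf' len len' that by auto
  have code: "code_computable pair_code (\<Gamma> \<times> X) (\<lambda>a. tuple_code (?w a))"
  proof (rule code_computable_append)
    show "code_computable pair_code (\<Gamma> \<times> X) (\<lambda>a. tuple_code (f (fst a)))"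
      by (rule code_computable_comp[OF code_computable_pair_code(1) HomD(2)[OF f]]) auto
    show "code_computable pair_code (\<Gamma> \<times> X) (\<lambda>a. tuple_code (f' (snd a)))"
      by (rule code_computable_comp[OF code_computable_pair_code(2) HomD(2)[OF f']]) auto
  qed (use len len' in auto)
  have 2: "code_computable pair_code (\<Gamma> \<times> X) (\<lambda>a. tuple_code (\<pi> a))"
    unfolding \<pi>_def by (rule code_computable_comp[OF code HomD(2)[OF v(1)] w])
  obtain n where n: "\<And>\<gamma>. \<gamma> \<in> \<Gamma> \<Longrightarrow> length \<gamma> = n" by (metis base_objectsE[OF \<Gamma>])
  have 3: "uniform_le pair_code (\<Gamma> \<times> X) (\<lambda>a. bound (\<pi> a)) (\<lambda>a. mjoin (bound (fst a)) (bound (snd a)))"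
  proof (rule uniform_leI)
    fix P e and i :: "(nat list \<times> nat list) \<times> (nat \<Rightarrow> nat) \<Rightarrow> nat list \<times> nat list"
    assume c: "number_from P e (\<lambda>x. pair_code (i x))" and i: "\<And>x. P x \<Longrightarrow> i x \<in> \<Gamma> \<times> X"
      and s: "solvable_from P e (\<lambda>x. mjoin (bound (fst (i x))) (bound (snd (i x))))"
    have i': "P x \<Longrightarrow> fst (i x) \<in> \<Gamma>" "P x \<Longrightarrow> snd (i x) \<in> X" for x using i[of x] by auto
    note s = solvable_from_mjoinD[OF s]
    have c1: "number_from P e (\<lambda>x. tuple_code (fst (i x)))"
      by (rule number_from_code_computable[OF code_computable_pair_code(1) c i])
    have c2: "number_from P e (\<lambda>x. tuple_code (snd (i x)))"
      by (rule number_from_code_computable[OF code_computable_pair_code(2) c i])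
    have "solvable_from P e (\<lambda>x. bound (?w (i x)))"
    proof (rule solvable_from_append)
      \<comment> \<open>Both tuples may be empty, and then their concatenation has the bound
        \<open>B (-1)\<close>.\<close>
      show "solvable_from P e (\<lambda>_. B (- 1))"
        by (rule solvable_from_bottom[OF c1 s(1)]) (use i' n in simp)
      show "solvable_from P e (\<lambda>x. bound (f (fst (i x))))"
        by (rule solvable_from_reduce[OF HomD(3)[OF f] c1 s(1) i'(1)])
      show "solvable_from P e (\<lambda>x. bound (f' (snd (i x))))"
        by (rule solvable_from_reduce[OF HomD(3)[OF f'] c2 s(2) i'(2)])
    qed (use len len' i' in auto)
    moreover have "number_from P e (\<lambda>x. tuple_code (?w (i x)))"
      by (rule number_from_code_computable[OF code c i])
    ultimately have "solvable_from P e (\<lambda>x. bound (v (?w (i x))))"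
      by (intro solvable_from_reduce[OF HomD(3)[OF v(1)], where i = "\<lambda>x. ?w (i x)"] w i)
    then show "solvable_from P e (\<lambda>x. bound (\<pi> (i x)))" unfolding \<pi>_def .
  qed
  \<comment> \<open>The map \<open>\<lambda>z. \<pi> (p z, q z)\<close> is a morphism on
    \<open>Q\<close>, because \<open>f\<close> after \<open>p\<close> and \<open>f'\<close> after
    \<open>q\<close> supply the entries of the concatenation. It respects both projections, so
    uniqueness makes it the identity.\<close>
  have 4: "\<pi> (p z, q z) = z" if z: "z \<in> Q" for z
  proof -
    let ?w' = "restrict (\<lambda>z. f (p z) @ f' (q z)) Q"
    have pqz: "(p z, q z) \<in> \<Gamma> \<times> X" if "z \<in> Q" for z
      using HomD(1)[OF p that] HomD(1)[OF q that] by simp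
    have w': "?w' \<in> Hom \<C> Q ?R"
    proof (rule Hom_tuplesI[OF Q])
      show "f (p z) @ f' (q z) \<in> ?R" if "z \<in> Q" for z using w[OF pqz[OF that]] by simp
      note F = Cmp_Hom[OF p f] and F' = Cmp_Hom[OF q f']
      fix j assume j: "j < k + l"
      have eq: "(f (p z) @ f' (q z)) ! j =
          (if j < k then Cmp \<C> Q \<Gamma> (tuples S k) f p z ! j
           else Cmp \<C> Q X (tuples S l) f' q z ! (j - k))" if "z \<in> Q" for z
        using len[OF HomD(1)[OF p that]] that by (simp add: nth_append Cmp_apply)
      show "code_computable tuple_code Q (\<lambda>z. (f (p z) @ f' (q z)) ! j)"
      proof (cases "j < k")
        case True
        show ?thesis by (rule code_computable_cong[OF Hom_entry(1)[OF F True]]) (simp add: eq True)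
      next
        case False
        with j have "j - k < l" by simp
        show ?thesis
          by (rule code_computable_cong[OF Hom_entry(1)[OF F' \<open>j - k < l\<close>]]) (simp add: eq False)
      qed
      show "le Q (\<lambda>z. B (int ((f (p z) @ f' (q z)) ! j))) bound"
      proof (cases "j < k")
        case True
        show ?thesis by (rule uniform_le_cong[OF Hom_entry(2)[OF F True]]) (simp_all add: eq True)
      next
        case False
        with j have "j - k < l" by simp
        show ?thesis
          by (rule uniform_le_cong[OF Hom_entry(2)[OF F' \<open>j - k < l\<close>]]) (simp_all add: eq False)
      qed
    qed
    let ?vw = "Cmp \<C> Q ?R Q v ?w'"
    have vw: "?vw z = \<pi> (p z, q z)" if "z \<in> Q" for z
      using that by (simp add: Cmp_apply \<pi>_def)
    have "Cmp \<C> Q Q \<Gamma> p ?vw = p"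
      by (rule extensionalityI[where A = Q])
        (use p 1(2)[OF pqz, unfolded \<pi>_def] in
          \<open>simp_all add: Cmp_base compose_def mem_Hom_iff PiE_def\<close>)
    moreover have "Cmp \<C> Q Q X q ?vw = q"
      by (rule extensionalityI[where A = Q])
        (use q 1(3)[OF pqz, unfolded \<pi>_def] in
          \<open>simp_all add: Cmp_base compose_def mem_Hom_iff PiE_def\<close>)
    moreover have "Cmp \<C> Q Q \<Gamma> p (Idt \<C> Q) = p" "Cmp \<C> Q Q X q (Idt \<C> Q) = q"
      using category.Cmp_Idt_right[OF category_base _ _ p] category.Cmp_Idt_right[OF category_base _ _ q]
        is_productD(1-3)[OF product] by simp_all
    moreover have "\<exists>!u. u \<in> Hom \<C> Q Q \<and> Cmp \<C> Q Q \<Gamma> p u = p \<and> Cmp \<C> Q Q X q u = q"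
      by (rule is_productD(6)[OF product]) (simp_all add: Q p q)
    ultimately have "?vw = Idt \<C> Q"
      using Cmp_Hom[OF w' v(1)] Idt_Hom[of Q] by blast
    then show ?thesis using vw[OF z] z by (simp add: Idt_base)
  qed
  show thesis by (rule that[OF 1 4 2 3])
qed

end

section \<open>The Beck--Chevalley conditions\<close>

context bounded_family
begin

context
  fixes \<Gamma> X Q p q \<Gamma>' Q' p' q' s u
  assumes powers: "powers_of_common_object \<C> \<Gamma> X" and product: "is_product \<C> \<Gamma> X Q p q"
    and powers': "powers_of_common_object \<C> \<Gamma>' X" and product': "is_product \<C> \<Gamma>' X Q' p' q'"
    and s: "s \<in> Hom \<C> \<Gamma> \<Gamma>'" and u: "u \<in> Hom \<C> Q Q'"
    and pu: "Cmp \<C> Q Q' \<Gamma>' p' u = Cmp \<C> Q \<Gamma> \<Gamma>' s p" and qu: "Cmp \<C> Q Q' X q' u = q"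
begin

lemma square_objects: "\<Gamma> \<in> base_objects" "\<Gamma>' \<in> base_objects" "Q \<in> base_objects" "Q' \<in> base_objects"
  and square_projections: "p \<in> Hom \<C> Q \<Gamma>" "q \<in> Hom \<C> Q X" "p' \<in> Hom \<C> Q' \<Gamma>'" "q' \<in> Hom \<C> Q' X"
  using is_productD[OF product] is_productD[OF product'] by simp_all

lemma square_commutes: "z \<in> Q \<Longrightarrow> p' (u z) = s (p z)" "z \<in> Q \<Longrightarrow> q' (u z) = q z"
  using fun_cong[OF pu, of z] fun_cong[OF qu, of z] by (simp_all add: Cmp_apply)

text \<open>
  The square formed by \<open>u\<close>, \<open>s\<close> and the projections is a pullback: \<open>\<sigma> (\<gamma>, z')\<close> is the point
  over \<open>\<gamma>\<close> with image \<open>z'\<close>, and its bound is computed from those of \<open>\<gamma>\<close> and \<open>z'\<close>.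
\<close>

lemma pullback_section:
  obtains \<sigma> where "\<And>\<gamma> z'. \<gamma> \<in> \<Gamma> \<Longrightarrow> z' \<in> Q' \<Longrightarrow> p' z' = s \<gamma> \<Longrightarrow> \<sigma> (\<gamma>, z') \<in> Q"
    "\<And>\<gamma> z'. \<gamma> \<in> \<Gamma> \<Longrightarrow> z' \<in> Q' \<Longrightarrow> p' z' = s \<gamma> \<Longrightarrow> p (\<sigma> (\<gamma>, z')) = \<gamma>"
    "\<And>\<gamma> z'. \<gamma> \<in> \<Gamma> \<Longrightarrow> z' \<in> Q' \<Longrightarrow> p' z' = s \<gamma> \<Longrightarrow> u (\<sigma> (\<gamma>, z')) = z'"
    "code_computable pair_code (\<Gamma> \<times> Q') (\<lambda>a. tuple_code (\<sigma> a))"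
    "uniform_le pair_code (\<Gamma> \<times> Q') (\<lambda>a. bound (\<sigma> a)) (\<lambda>a. mjoin (bound (fst a)) (bound (snd a)))"
proof -
  obtain \<pi> where \<pi>: "\<And>a. a \<in> \<Gamma> \<times> X \<Longrightarrow> \<pi> a \<in> Q"
    "\<And>a. a \<in> \<Gamma> \<times> X \<Longrightarrow> p (\<pi> a) = fst a" "\<And>a. a \<in> \<Gamma> \<times> X \<Longrightarrow> q (\<pi> a) = snd a"
    and code: "code_computable pair_code (\<Gamma> \<times> X) (\<lambda>a. tuple_code (\<pi> a))"
    and le: "uniform_le pair_code (\<Gamma> \<times> X) (\<lambda>a. bound (\<pi> a)) (\<lambda>a. mjoin (bound (fst a)) (bound (snd a)))"
    by (rule product_pairing[OF powers product]) blast
  \<comment> \<open>Of the second pairing one fact is kept: a point of \<open>Q'\<close> is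
    determined by its projections.\<close>
  obtain \<pi>' where \<pi>': "\<And>z. z \<in> Q' \<Longrightarrow> \<pi>' (p' z, q' z) = z"
    by (rule product_pairing[OF powers' product']) blast
  \<comment> \<open>The point \<open>z'\<close> is replaced by its component in \<open>X\<close>;
    its component in \<open>\<Gamma>'\<close> is \<open>s \<gamma>\<close> when it lies over
    it.\<close>
  define \<tau> where "\<tau> a = (fst a, q' (snd a))" for a :: "nat list \<times> nat list"
  have \<tau>: "\<tau> a \<in> \<Gamma> \<times> X" if "a \<in> \<Gamma> \<times> Q'" for a
    using that HomD(1)[OF square_projections(4)] by (auto simp: \<tau>_def)
  have "code_computable pair_code (\<Gamma> \<times> Q') (\<lambda>a. tuple_code (q' (snd a)))"
    by (rule code_computable_comp[OF code_computable_pair_code(2) HomD(2)[OF square_projections(4)]]) auto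
  then have \<tau>_code: "code_computable pair_code (\<Gamma> \<times> Q') (\<lambda>a. pair_code (\<tau> a))"
    using code_computable_pair_code(1)[of "\<Gamma> \<times> Q'"]
    unfolding code_computable_def pair_code_def \<tau>_def by (simp add: computable_at_pair)
  show thesis
  proof (rule that[of "\<lambda>a. \<pi> (\<tau> a)"])
    fix \<gamma> z' assume *: "\<gamma> \<in> \<Gamma>" "z' \<in> Q'" "p' z' = s \<gamma>"
    then have a: "\<tau> (\<gamma>, z') \<in> \<Gamma> \<times> X" by (intro \<tau>) simp
    show Q: "\<pi> (\<tau> (\<gamma>, z')) \<in> Q" and p: "p (\<pi> (\<tau> (\<gamma>, z'))) = \<gamma>"
      using \<pi>[OF a] by (simp_all add: \<tau>_def)
    have "p' (u (\<pi> (\<tau> (\<gamma>, z')))) = p' z'" "q' (u (\<pi> (\<tau> (\<gamma>, z')))) = q' z'"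
      using square_commutes[OF Q] p \<pi>(3)[OF a] *(3) by (simp_all add: \<tau>_def)
    then show "u (\<pi> (\<tau> (\<gamma>, z'))) = z'"
      using \<pi>'[OF HomD(1)[OF u Q]] \<pi>'[OF *(2)] by metis
  next
    show "code_computable pair_code (\<Gamma> \<times> Q') (\<lambda>a. tuple_code (\<pi> (\<tau> a)))"
      by (rule code_computable_comp[OF \<tau>_code code \<tau>])
    have "uniform_le pair_code (\<Gamma> \<times> Q') (\<lambda>a. bound (q' (snd a))) (\<lambda>a. bound (snd a))"
      by (rule uniform_le_reindex[OF HomD(3)[OF square_projections(4)] code_computable_pair_code(2)]) auto
    then have "uniform_le pair_code (\<Gamma> \<times> Q') (\<lambda>a. mjoin (bound (fst (\<tau> a))) (bound (snd (\<tau> a))))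
        (\<lambda>a. mjoin (bound (fst a)) (bound (snd a)))"
      unfolding \<tau>_def fst_conv snd_conv by (rule uniform.join_mono[OF uniform.refl])
    moreover have "uniform_le pair_code (\<Gamma> \<times> Q') (\<lambda>a. bound (\<pi> (\<tau> a)))
        (\<lambda>a. mjoin (bound (fst (\<tau> a))) (bound (snd (\<tau> a))))"
      by (rule uniform_le_reindex[OF le \<tau>_code \<tau>])
    ultimately show "uniform_le pair_code (\<Gamma> \<times> Q') (\<lambda>a. bound (\<pi> (\<tau> a)))
        (\<lambda>a. mjoin (bound (fst a)) (bound (snd a)))"
      using uniform.trans by blast
  qed
qed

text \<open>That the right-hand side reduces to the left-hand side follows from the adjunction and
  the commuting square. For the converse, a witness \<open>z'\<close> over \<open>s \<gamma>\<close>
  is lifted to the witness \<open>\<sigma> (\<gamma>, z')\<close> over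
  \<open>\<gamma>\<close>.\<close>

lemma ex_along_beck_chevalley:
  assumes D: "in_interval Q' D"
  shows "deg \<Gamma> (ex_along Q p (\<lambda>z. mjoin (D (u z)) (bound z))) =
    deg \<Gamma> (\<lambda>\<gamma>. mjoin (ex_along Q' p' D (s \<gamma>)) (bound \<gamma>))" (is "deg \<Gamma> (ex_along Q p ?D) = _")
  unfolding degree_eq_iff[OF square_objects(1)]
proof
  have D': "in_interval Q ?D" by (rule in_interval_pull[OF square_objects(3) u D])
  have ex: "le Q' (\<lambda>z. ex_along Q' p' D (p' z)) D"
    using uniform.refl le_ex_along_iff[OF square_objects(4,2) square_projections(3)] by blast
  have "le Q (\<lambda>z. ex_along Q' p' D (s (p z))) (\<lambda>z. D (u z))"
    by (rule uniform_le_cong[OF le_reindex[OF ex u]]) (simp_all add: square_commutes)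
  then have "le Q (\<lambda>z. ex_along Q' p' D (s (p z))) ?D"
    by (rule uniform_le_mjoinI(1))
  moreover have "le \<Gamma> (\<lambda>\<gamma>. ex_along Q' p' D (s \<gamma>)) (\<lambda>_. A)"
    using in_interval_ex_along[OF square_objects(4,2) square_projections(3) D] le_reindex[OF _ s]
    unfolding in_interval_def by blast
  ultimately have "le \<Gamma> (\<lambda>\<gamma>. ex_along Q' p' D (s \<gamma>)) (ex_along Q p ?D)"
    unfolding le_ex_along_iff[OF square_objects(3,1) square_projections(1)] by blast
  then show "le \<Gamma> (\<lambda>\<gamma>. mjoin (ex_along Q' p' D (s \<gamma>)) (bound \<gamma>)) (ex_along Q p ?D)"
    using in_interval_ex_along[OF square_objects(3,1) square_projections(1) D']
    unfolding uniform_le_mjoin_iff in_interval_def by blast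
next
  obtain \<sigma> where \<sigma>: "\<And>\<gamma> z'. \<gamma> \<in> \<Gamma> \<Longrightarrow> z' \<in> Q' \<Longrightarrow> p' z' = s \<gamma> \<Longrightarrow> \<sigma> (\<gamma>, z') \<in> Q"
    "\<And>\<gamma> z'. \<gamma> \<in> \<Gamma> \<Longrightarrow> z' \<in> Q' \<Longrightarrow> p' z' = s \<gamma> \<Longrightarrow> p (\<sigma> (\<gamma>, z')) = \<gamma>"
    "\<And>\<gamma> z'. \<gamma> \<in> \<Gamma> \<Longrightarrow> z' \<in> Q' \<Longrightarrow> p' z' = s \<gamma> \<Longrightarrow> u (\<sigma> (\<gamma>, z')) = z'"
    and \<sigma>_code: "code_computable pair_code (\<Gamma> \<times> Q') (\<lambda>a. tuple_code (\<sigma> a))"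
    and \<sigma>_le: "uniform_le pair_code (\<Gamma> \<times> Q') (\<lambda>a. bound (\<sigma> a)) (\<lambda>a. mjoin (bound (fst a)) (bound (snd a)))"
    by (rule pullback_section) blast
  show "le \<Gamma> (ex_along Q p ?D) (\<lambda>\<gamma>. mjoin (ex_along Q' p' D (s \<gamma>)) (bound \<gamma>))"
  proof (rule uniform_leI)
    fix P e and \<gamma> :: "nat list \<times> (nat \<Rightarrow> nat) \<Rightarrow> nat list"
    assume c: "number_from P e (\<lambda>x. tuple_code (\<gamma> x))" and \<gamma>: "\<And>x. P x \<Longrightarrow> \<gamma> x \<in> \<Gamma>"
      and S: "solvable_from P e (\<lambda>x. mjoin (ex_along Q' p' D (s (\<gamma> x))) (bound (\<gamma> x)))"
    from solvable_from_mjoinD(1)[OF S]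
    show "solvable_from P e (\<lambda>x. ex_along Q p ?D (\<gamma> x))"
    proof (rule solvable_from_exists_along_cases)
      fix R assume "solvable_from R e (\<lambda>_. A)"
      then show "solvable_from R e (\<lambda>x. ex_along Q p ?D (\<gamma> x))"
        by (rule solvable_from_exists_along_top)
    next
      fix R z assume R: "\<And>x. R x \<Longrightarrow> P x" and cz: "number_from R e (\<lambda>x. tuple_code (z x))"
        and Dz: "solvable_from R e (\<lambda>x. D (z x))"
        and z: "\<And>x. R x \<Longrightarrow> z x \<in> Q'" "\<And>x. R x \<Longrightarrow> p' (z x) = s (\<gamma> x)"
      let ?a = "\<lambda>x. (\<gamma> x, z x)"
      have a: "R x \<Longrightarrow> ?a x \<in> \<Gamma> \<times> Q'" for x using R \<gamma> z by simp
      have \<sigma>': "R x \<Longrightarrow> \<sigma> (?a x) \<in> Q" "R x \<Longrightarrow> p (\<sigma> (?a x)) = \<gamma> x" "R x \<Longrightarrow> u (\<sigma> (?a x)) = z x" for x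
        using \<sigma>[OF \<gamma>[OF R] z] by simp_all
      have c\<gamma>: "number_from R e (\<lambda>x. tuple_code (\<gamma> x))" by (rule number_from_mono[OF c R])
      have ca: "number_from R e (\<lambda>x. pair_code (?a x))"
        unfolding pair_code_def fst_conv snd_conv
        by (intro number_fromI computable_at_pair number_from_computable_at[OF c\<gamma>]
            number_from_computable_at[OF cz])
      \<comment> \<open>Since \<open>D\<close> lies above the bounds, a solution of it at a point
        computes the bound there.\<close>
      have "solvable_from R e (\<lambda>x. bound (z x))"
        by (rule solvable_from_reduce[OF _ cz Dz z(1)]) (use D in \<open>simp add: in_interval_def\<close>)
      moreover have "solvable_from R e (\<lambda>x. bound (\<gamma> x))"
        by (rule solvable_from_mono[OF solvable_from_mjoinD(2)[OF S]]) (simp_all add: R)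
      ultimately have "solvable_from R e (\<lambda>x. mjoin (bound (fst (?a x))) (bound (snd (?a x))))"
        unfolding fst_conv snd_conv by (intro solvable_from_mjoin)
      then have "solvable_from R e (\<lambda>x. bound (\<sigma> (?a x)))"
        by (rule solvable_from_reduce[where i = ?a, OF \<sigma>_le ca _ a])
      moreover have "solvable_from R e (\<lambda>x. D (u (\<sigma> (?a x))))"
        by (rule solvable_from_mono[OF Dz]) (simp_all add: \<sigma>')
      ultimately have "solvable_from R e (\<lambda>x. ?D (\<sigma> (?a x)))"
        by (intro solvable_from_mjoin)
      moreover have "number_from R e (\<lambda>x. tuple_code (\<sigma> (?a x)))"
        by (rule number_from_code_computable[OF \<sigma>_code ca a])
      ultimately show "solvable_from R e (\<lambda>x. ex_along Q p ?D (\<gamma> x))"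
        by (intro solvable_from_exists_alongI[where i = "\<lambda>x. \<sigma> (?a x)"]) (simp_all add: \<sigma>')
    qed
  qed
qed

text \<open>That the left-hand side reduces to the right-hand side is formal. For the converse, an
  associate over \<open>\<gamma>\<close> is turned into one over \<open>s \<gamma>\<close>: given a
  point \<open>z'\<close> there and a solution of its bound, the former is applied at
  \<open>\<sigma> (\<gamma>, z')\<close>.\<close>

lemma all_along_beck_chevalley:
  assumes D: "in_interval Q' D"
  shows "deg \<Gamma> (all_along Q p (\<lambda>z. mjoin (D (u z)) (bound z))) =
    deg \<Gamma> (\<lambda>\<gamma>. mjoin (all_along Q' p' D (s \<gamma>)) (bound \<gamma>))" (is "deg \<Gamma> (all_along Q p ?D) = deg \<Gamma> ?W")
  unfolding degree_eq_iff[OF square_objects(1)]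
proof
  let ?F = "forall_along tuple_code Q' p' bound D"
  have "le Q' D (\<lambda>z. mjoin (bound z) (?F (p' z)))"
    using uniform.refl forall_along_le_iff[OF square_objects(4,2) square_projections(3)] by blast
  from le_reindex[OF this u]
  have 1: "le Q (\<lambda>z. D (u z)) (\<lambda>z. mjoin (bound (u z)) (?F (s (p z))))"
    by (rule uniform_le_cong) (simp_all add: square_commutes)
  have 2: "le Q (\<lambda>z. mjoin (bound (u z)) (?F (s (p z)))) (\<lambda>z. mjoin (bound z) (?W (p z)))"
    by (rule uniform.join_mono[OF HomD(3)[OF u]])
      (intro uniform.joinI1[OF uniform.join_upper(1)])
  have "le Q ?D (\<lambda>z. mjoin (bound z) (?W (p z)))"
    by (rule uniform_le_mjoin_iff[THEN iffD2, OF conjI[OF uniform.trans[OF 1 2] uniform.join_upper(1)]])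
  then have "le \<Gamma> (forall_along tuple_code Q p bound ?D) ?W"
    by (rule forall_along_le_iff[OF square_objects(3,1) square_projections(1), THEN iffD2])
  then show "le \<Gamma> (all_along Q p ?D) ?W"
    by (rule uniform_le_mjoin_iff[THEN iffD2, OF conjI]) (rule uniform.join_upper(2))
next
  let ?F = "forall_along tuple_code Q p bound ?D" and ?F' = "forall_along tuple_code Q' p' bound D"
  obtain \<sigma> where \<sigma>: "\<And>\<gamma> z'. \<gamma> \<in> \<Gamma> \<Longrightarrow> z' \<in> Q' \<Longrightarrow> p' z' = s \<gamma> \<Longrightarrow> \<sigma> (\<gamma>, z') \<in> Q"
    "\<And>\<gamma> z'. \<gamma> \<in> \<Gamma> \<Longrightarrow> z' \<in> Q' \<Longrightarrow> p' z' = s \<gamma> \<Longrightarrow> p (\<sigma> (\<gamma>, z')) = \<gamma>"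
    "\<And>\<gamma> z'. \<gamma> \<in> \<Gamma> \<Longrightarrow> z' \<in> Q' \<Longrightarrow> p' z' = s \<gamma> \<Longrightarrow> u (\<sigma> (\<gamma>, z')) = z'"
    and \<sigma>_code: "code_computable pair_code (\<Gamma> \<times> Q') (\<lambda>a. tuple_code (\<sigma> a))"
    and \<sigma>_le: "uniform_le pair_code (\<Gamma> \<times> Q') (\<lambda>a. bound (\<sigma> a)) (\<lambda>a. mjoin (bound (fst a)) (bound (snd a)))"
    by (rule pullback_section) blast
  have "le \<Gamma> (\<lambda>\<gamma>. ?F' (s \<gamma>)) (all_along Q p ?D)"
  proof (rule uniform_leI)
    fix P e and \<gamma> :: "nat list \<times> (nat \<Rightarrow> nat) \<Rightarrow> nat list"
    assume c: "number_from P e (\<lambda>x. tuple_code (\<gamma> x))" and \<gamma>: "\<And>x. P x \<Longrightarrow> \<gamma> x \<in> \<Gamma>"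
      and S: "solvable_from P e (\<lambda>x. mjoin (?F (\<gamma> x)) (bound (\<gamma> x)))"
    note S = solvable_from_mjoinD[OF S]
    show "solvable_from P e (\<lambda>x. ?F' (s (\<gamma> x)))"
    proof (rule solvable_from_forall_alongI)
      fix R e' z and x :: "(nat list \<times> (nat \<Rightarrow> nat)) \<times> nat list \<times> (nat \<Rightarrow> nat) \<Rightarrow> nat list \<times> (nat \<Rightarrow> nat)"
      assume e': "computable_from R e' (\<lambda>b. e (x b))" and R: "\<And>b. R b \<Longrightarrow> P (x b)"
        and cz: "number_from R e' (\<lambda>b. tuple_code (z b))"
        and bz: "solvable_from R e' (\<lambda>b. bound (z b))"
        and z: "\<And>b. R b \<Longrightarrow> z b \<in> Q'" "\<And>b. R b \<Longrightarrow> p' (z b) = s (\<gamma> (x b))"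
      let ?a = "\<lambda>b. (\<gamma> (x b), z b)"
      have a: "R b \<Longrightarrow> ?a b \<in> \<Gamma> \<times> Q'" for b using R \<gamma> z by simp
      have \<sigma>': "R b \<Longrightarrow> \<sigma> (?a b) \<in> Q" "R b \<Longrightarrow> p (\<sigma> (?a b)) = \<gamma> (x b)"
        "R b \<Longrightarrow> u (\<sigma> (?a b)) = z b" for b
        using \<sigma>[OF \<gamma>[OF R] z] by simp_all
      note tr = solvable_from_transfer[where x = x and P = P and e = e, OF _ e' R]
      have c\<gamma>: "number_from R e' (\<lambda>b. tuple_code (\<gamma> (x b)))"
        by (rule number_from_transfer[OF c e' R])
      have ca: "number_from R e' (\<lambda>b. pair_code (?a b))"
        unfolding pair_code_def fst_conv snd_conv
        by (intro number_fromI computable_at_pair number_from_computable_at[OF c\<gamma>]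
            number_from_computable_at[OF cz])
      \<comment> \<open>The bound of \<open>\<gamma>\<close> is the one joined to the quantifier in
        \<open>all_along\<close>, the bound of \<open>z'\<close> is part of the argument of the
        associate; together they compute the bound of the lifted point.\<close>
      have "solvable_from R e' (\<lambda>b. mjoin (bound (fst (?a b))) (bound (snd (?a b))))"
        unfolding fst_conv snd_conv by (rule solvable_from_mjoin[OF tr[OF S(2)] bz])
      then have b\<sigma>: "solvable_from R e' (\<lambda>b. bound (\<sigma> (?a b)))"
        by (rule solvable_from_reduce[where i = ?a, OF \<sigma>_le ca _ a])
      have c\<sigma>: "number_from R e' (\<lambda>b. tuple_code (\<sigma> (?a b)))"
        by (rule number_from_code_computable[OF \<sigma>_code ca a])
      have F: "solvable_from R e' (\<lambda>b. ?F (p (\<sigma> (?a b))))"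
        by (rule solvable_from_mono[OF tr[OF S(1)]]) (simp_all add: \<sigma>')
      have "solvable_from R e' (\<lambda>b. ?D (\<sigma> (?a b)))"
        by (rule solvable_from_forall_along[where i = "\<lambda>b. \<sigma> (?a b)" and c = tuple_code and I = Q
              and \<alpha> = p and B = bound and D = ?D, OF F c\<sigma> b\<sigma> \<sigma>'(1)])
      from solvable_from_mjoinD(1)[OF this] show "solvable_from R e' (\<lambda>b. D (z b))"
        by (rule solvable_from_mono) (simp_all add: \<sigma>')
    qed
  qed
  then show "le \<Gamma> ?W (all_along Q p ?D)"
    by (intro uniform_le_mjoin_iff[THEN iffD2] conjI uniform.join_upper(2)
        uniform.joinI2[OF HomD(3)[OF s]])
qed

end

end

theorem theorem5p6:
  fixes A :: mass_problem and B :: "int \<Rightarrow> mass_problem"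
  assumes "medvedev_omega_le (\<lambda>n. B (int n)) (\<lambda>n. A)"
    and "medvedev_omega_le (\<lambda>n. B (- 1)) (\<lambda>n. B (int n))"
    and "\<forall>i\<ge>-1. \<not> medvedev_le A (B i)"
  shows "first_order_hyperdoctrine (base_category B) (interval_fibre B A) (interval_pull B)"
proof -
  interpret bounded_family A B using assms(1,2) by unfold_locales
  show ?thesis
  proof (intro first_order_hyperdoctrine.intro first_order_hyperdoctrine_axioms.intro category_base)
    fix X Q :: "nat list set" and p q \<Delta> assume prod: "is_product \<C> X X Q p q" and \<Delta>: "\<Delta> \<in> Hom \<C> X Q"
    then show "\<exists>e\<in>carrier (\<P> Q). \<forall>a\<in>carrier (\<P> Q).
        pull X Q \<Delta> a \<sqsubseteq>\<^bsub>\<P> X\<^esub> \<bottom>\<^bsub>\<P> X\<^esub> \<longleftrightarrow> a \<sqsubseteq>\<^bsub>\<P> Q\<^esub> e"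
      using equality_exists[OF _ _ \<Delta>] is_productD[OF prod] by simp
  next
    fix \<Gamma> X Q :: "nat list set" and p q assume "is_product \<C> \<Gamma> X Q p q"
    note * = is_productD[OF this, unfolded Obj_base]
    show "\<exists>E. is_right_adjoint (\<P> \<Gamma>) (\<P> Q) (pull Q \<Gamma> p) E"
      by (rule right_adjoint_exists[OF *(3,1,4)])
    show "\<exists>F. is_left_adjoint (\<P> \<Gamma>) (\<P> Q) (pull Q \<Gamma> p) F"
      by (rule left_adjoint_exists[OF *(3,1,4)])
  next
    fix \<Gamma> X Q \<Gamma>' Q' :: "nat list set" and p q p' q' s u and E E' :: "(nat list \<Rightarrow> mass_problem) set \<Rightarrow> _" and a
    assume hyps: "powers_of_common_object \<C> \<Gamma> X" "is_product \<C> \<Gamma> X Q p q"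
      "powers_of_common_object \<C> \<Gamma>' X" "is_product \<C> \<Gamma>' X Q' p' q'"
      "s \<in> Hom \<C> \<Gamma> \<Gamma>'" "u \<in> Hom \<C> Q Q'"
      "Cmp \<C> Q Q' \<Gamma>' p' u = Cmp \<C> Q \<Gamma> \<Gamma>' s p" "Cmp \<C> Q Q' X q' u = q"
      and a: "a \<in> carrier (\<P> Q')"
    note obj = is_productD(1,3,4)[OF hyps(2), unfolded Obj_base]
      is_productD(1,3,4)[OF hyps(4), unfolded Obj_base]
    obtain D where D: "a = deg Q' D" "in_interval Q' D"
      using a unfolding carrier_fibre[OF obj(5)] by blast
    note D' = in_interval_pull[OF obj(2) hyps(6) D(2)]
    show "E (pull Q Q' u a) = pull \<Gamma> \<Gamma>' s (E' a)"
      if "is_right_adjoint (\<P> \<Gamma>) (\<P> Q) (pull Q \<Gamma> p) E"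
        "is_right_adjoint (\<P> \<Gamma>') (\<P> Q') (pull Q' \<Gamma>' p') E'"
      unfolding D(1) pull_degree[OF obj(2,5) hyps(6)] right_adjoint_degree[OF obj(2,1,3) that(1) D']
        right_adjoint_degree[OF obj(5,4,6) that(2) D(2)] pull_degree[OF obj(1,4) hyps(5)]
      by (rule ex_along_beck_chevalley[OF hyps D(2)])
    \<comment> \<open>Here \<open>E\<close> and \<open>E'\<close> are left adjoints; the universal
      case shares all other data with the existential one.\<close>
    show "E (pull Q Q' u a) = pull \<Gamma> \<Gamma>' s (E' a)"
      if "is_left_adjoint (\<P> \<Gamma>) (\<P> Q) (pull Q \<Gamma> p) E"
        "is_left_adjoint (\<P> \<Gamma>') (\<P> Q') (pull Q' \<Gamma>' p') E'"
      unfolding D(1) pull_degree[OF obj(2,5) hyps(6)] left_adjoint_degree[OF obj(2,1,3) that(1) D']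
        left_adjoint_degree[OF obj(5,4,6) that(2) D(2)] pull_degree[OF obj(1,4) hyps(5)]
      by (rule all_along_beck_chevalley[OF hyps D(2)])
  qed (simp_all add: finite_powers_base brouwer_algebra_fibre brouwer_hom_pull pull_Idt_base
      pull_Cmp_base)
qed

end
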